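(* Let $N\in\mathbb{N}$, $T>0$, and let $V\in C^1(\mathbb{R}\times\mathbb{R}^N,\mathbb{R})$ be $T$-periodic in $t$ and of the form $$V(t,u)=\tfrac12\langle U(t)u,u\rangle+W(t,u),$$ where $U(\cdot)$ is a continuous $T$-periodic function with values in the symmetric real $N\times N$ matrices. Assume: (SQ$_1$) there exist constants $a_1>0$ and $\nu>2$ such that $|\nabla_uW(t,u)|\le a_1(1+|u|^{\nu-1})$ for all $t\in[0,T]$ and $u\in\mathbb{R}^N$; (SQ$_2$) $W(t,u)\ge0$ for all $(t,u)\in[0,T]\times\mathbb{R}^N$, and $\lim_{|u|\to\infty}\frac{W(t,u)}{|u|^2}=\infty$ uniformly for $t\in[0,T]$; (SQ$_3$) there exist constants $\varrho$ with $\varrho\ge1$ and $\varrho>\nu-2$, and $b>0$, such that $\liminf_{|u|\to\infty}\frac{\langle\nabla_uW(t,u),u\rangle-2W(t,u)}{|u|^{\varrho}}\ge b$ uniformly for $t\in[0,T]$. Assume also that $W(t,u)$ is even in $u$, i.e. $W(t,-u)=W(t,u)$ for all $(t,u)\in[0,T]\times\mathbb{R}^N$. Then the problem $$\ddot u+\nabla_uV(t,u)=0\quad(t\in\mathbb{R}),\qquad u(0)=u(T),\quad \dot u(0)=\dot u(T)$$ possesses infinitely many nontrivial solutions.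
   Context: $\langle\cdot,\cdot\rangle$ and $|\cdot|$ denote the standard inner product and norm on $\mathbb{R}^N$; $\nabla_u$ denotes the gradient with respect to $u$. Solutions are ($T$-periodic) functions $u$ with values in $\mathbb{R}^N$; nontrivial means not identically zero. The constant $\nu$ in (SQ$_3$) is the one from (SQ$_1$). *)

theory Defs
  imports "HOL-Analysis.Analysis"
begin

definition C1 :: "('a::real_normed_vector \<Rightarrow> 'b::real_normed_vector) \<Rightarrow> bool" where
  "C1 f \<longleftrightarrow> (\<exists>f' :: 'a \<Rightarrow> 'a \<Rightarrow>\<^sub>L 'b.
     (\<forall>x. (f has_derivative blinfun_apply (f' x)) (at x)) \<and> continuous_on UNIV f')"

text \<open>Meaningful where \<open>f\<close> is differentiable, since \<open>GDERIV\<close> determines its vector uniquely.\<close>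

definition gradient :: "('a::real_inner \<Rightarrow> real) \<Rightarrow> 'a \<Rightarrow> 'a" where
  "gradient f x = (THE g. GDERIV f x :> g)"

lemma gradient_eqI:
  assumes "GDERIV f x :> g"
  shows "gradient f x = g"
proof -
  have "g' = g" if "GDERIV f x :> g'" for g'
  proof -
    have "(\<lambda>h. h \<bullet> g') = (\<lambda>h. h \<bullet> g)"
      using has_derivative_unique that assms unfolding gderiv_def by blast
    then have "(g' - g) \<bullet> g' = (g' - g) \<bullet> g"
      by meson
    then have "(g' - g) \<bullet> (g' - g) = 0"
      by (simp add: inner_diff_right)
    then show ?thesis
      by simp
  qed
  with assms show ?thesis
    unfolding gradient_def by (rule the_equality)
qed

text \<open>The filter of ``\<open>norm u \<longlongrightarrow> \<infinity>\<close>, uniformly for \<open>t\<close> in \<open>[0,T]\<close>''; see the lemmas below.\<close>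

definition at_infinity_unif :: "real \<Rightarrow> (real \<times> 'a::real_normed_vector) filter" where
  "at_infinity_unif T = principal {0..T} \<times>\<^sub>F at_infinity"

lemma eventually_at_infinity_unif:
  "eventually P (at_infinity_unif T) \<longleftrightarrow>
     (\<exists>R. \<forall>u. R \<le> norm u \<longrightarrow> (\<forall>t\<in>{0..T}. P (t, u)))"
proof
  assume "eventually P (at_infinity_unif T)"
  then obtain Q R where "\<forall>t\<in>{0..T}. Q t" and "eventually R at_infinity"
    and *: "\<And>t u. Q t \<Longrightarrow> R u \<Longrightarrow> P (t, u)"
    by (auto simp: at_infinity_unif_def eventually_prod_filter eventually_principal)
  then show "\<exists>R. \<forall>u. R \<le> norm u \<longrightarrow> (\<forall>t\<in>{0..T}. P (t, u))"
    unfolding eventually_at_infinity by blast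
next
  assume "\<exists>R. \<forall>u. R \<le> norm u \<longrightarrow> (\<forall>t\<in>{0..T}. P (t, u))"
  then obtain R where "\<And>u t. R \<le> norm u \<Longrightarrow> t \<in> {0..T} \<Longrightarrow> P (t, u)"
    by blast
  then show "eventually P (at_infinity_unif T)"
    unfolding at_infinity_unif_def eventually_prod_filter eventually_principal eventually_at_infinity
    by (intro exI[of _ "\<lambda>t. t \<in> {0..T}"] exI[of _ "\<lambda>u. R \<le> norm u"]) auto
qed

lemma filterlim_at_infinity_unif:
  fixes f :: "real \<Rightarrow> 'a::real_normed_vector \<Rightarrow> real"
  shows "filterlim (\<lambda>(t, u). f t u) at_top (at_infinity_unif T) \<longleftrightarrow>
     (\<forall>M. \<exists>R. \<forall>u. R \<le> norm u \<longrightarrow> (\<forall>t\<in>{0..T}. M \<le> f t u))"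
  by (simp add: filterlim_at_top eventually_at_infinity_unif)

lemma Liminf_at_infinity_unif:
  fixes f :: "real \<Rightarrow> 'a::real_normed_vector \<Rightarrow> real"
  shows "ereal b \<le> Liminf (at_infinity_unif T) (\<lambda>(t, u). ereal (f t u)) \<longleftrightarrow>
     (\<forall>c<b. \<exists>R. \<forall>u. R \<le> norm u \<longrightarrow> (\<forall>t\<in>{0..T}. c < f t u))"
proof -
  have "(\<forall>y<ereal b. \<exists>R. \<forall>u. R \<le> norm u \<longrightarrow> (\<forall>t\<in>{0..T}. y < ereal (f t u))) \<longleftrightarrow>
        (\<forall>c<b. \<exists>R. \<forall>u. R \<le> norm u \<longrightarrow> (\<forall>t\<in>{0..T}. c < f t u))" (is "?L \<longleftrightarrow> ?R")
  proof
    assume ?L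
    show ?R
    proof (intro allI impI)
      fix c assume "c < b"
      with \<open>?L\<close>[rule_format, of "ereal c"] show
        "\<exists>R. \<forall>u. R \<le> norm u \<longrightarrow> (\<forall>t\<in>{0..T}. c < f t u)" by simp
    qed
  next
    assume ?R
    show ?L
    proof (intro allI impI)
      fix y assume "y < ereal b"
      then show "\<exists>R. \<forall>u. R \<le> norm u \<longrightarrow> (\<forall>t\<in>{0..T}. y < ereal (f t u))"
        using \<open>?R\<close> by (cases y) auto
    qed
  qed
  then show ?thesis
    by (simp add: le_Liminf_iff eventually_at_infinity_unif)
qed

text \<open>A classical solution: \<open>u\<close> is twice differentiable on all of \<open>\<real>\<close>, \<open>T\<close>-periodic, and satisfies
  the equation at every \<open>t\<close>. Periodicity is a separate clause because the boundary conditions alone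
  do not imply it: for \<open>V\<close> merely \<open>C\<^sup>1\<close> the initial value problem need not be uniquely solvable.\<close>

definition periodic_solution :: "real \<Rightarrow> (real \<Rightarrow> 'a::real_inner \<Rightarrow> real) \<Rightarrow> (real \<Rightarrow> 'a) \<Rightarrow> bool" where
  "periodic_solution T V u \<longleftrightarrow>
     (\<forall>t. u (t + T) = u t) \<and>
     (\<exists>u' u''. (\<forall>t. (u has_vector_derivative u' t) (at t)) \<and>
               (\<forall>t. (u' has_vector_derivative u'' t) (at t)) \<and>
               (\<forall>t. u'' t + gradient (V t) (u t) = 0) \<and>
               u 0 = u T \<and> u' 0 = u' T)"

end

(* The action functional is discretized in time: on M-periodic sequences with mesh h = T/M it becomes
   a C1 function of finitely many variables. Its critical points are solutions of the difference
   equation, and they converge to classical solutions as M tends to infinity as soon as they are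
   bounded, so that no Sobolev spaces are needed.

   Let M = 2kr. On the sequences vanishing at k equidistant nodes the kinetic energy controls the
   supremum norm with a factor T/k, so the discrete action is large on a suitable ellipsoid there.
   On the sequences that are piecewise linear with 2k nodes it is bounded above by superquadraticity,
   uniformly in r. By the Borsuk-Ulam theorem every odd image of the ellipsoid meets the second space,
   so maximizing the minimum of the action over odd images gives a critical value between the two
   bounds. The conditions (SQ1) and (SQ3) bound these critical points uniformly in r. Since the lower
   bound on the action is arbitrary, the limits are solutions of arbitrarily large supremum norm.

   The Borsuk-Ulam theorem follows by induction on the dimension from the library's comparison, modulo 2, of the
   degree of an odd map with the degree of its restriction to the equator. *)

theory Submission
  imports Defs "HOL-Analysis.Analysis" "HOL-Complex_Analysis.Great_Picard" "HOL-Homology.Homology"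
    "HOL-Library.Periodic_Fun"
begin

subsection \<open>The Borsuk-Ulam theorem\<close>

text \<open>The degree comparison applies only to a map that carries the equator into itself. To
  deform an odd map into this form, the image of the equator has to miss some line through the
  origin. A merely continuous image could meet every line, so the map is first replaced by a nearby
  odd Lipschitz map; counting grid points then exhibits a missed line, and a reflection turns it
  into the last axis.

  The numbers of nodes, k and 2k, come from a dimension count. Vanishing at k nodes removes k blocks
  of coordinates, while piecewise linearity between 2k nodes leaves 2k blocks free of equations. The
  remaining coordinates therefore outnumber the equations, for every r.

  The gradient of V is only continuous, so it need not generate a flow; this is why the deformation
  in the minimax argument is a single step of fixed length.

  Solutions are told apart by their supremum norm: a critical point bounded by R has an action
  bounded in terms of R alone, so a high level forces a large norm.\<close>

definition unit_sphere :: "nat \<Rightarrow> (nat \<Rightarrow> real) set" where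
  "unit_sphere n = {x. (\<Sum>i\<le>n. (x i)\<^sup>2) = 1 \<and> (\<forall>i>n. x i = 0)}"

lemma topspace_nsphere_unit_sphere: "topspace (nsphere n) = unit_sphere n"
  by (simp add: nsphere unit_sphere_def)

lemma nsphere_top_of_set: "nsphere n = top_of_set (unit_sphere n)"
  by (simp add: nsphere unit_sphere_def euclidean_product_topology)

lemma unit_sphere_minus: "x \<in> unit_sphere n \<Longrightarrow> (\<lambda>i. - x i) \<in> unit_sphere n"
  by (simp add: unit_sphere_def)

lemma unit_sphere_Suc: "unit_sphere n = {x \<in> unit_sphere (Suc n). x (Suc n) = 0}"
proof -
  have "x i = 0" if "x (Suc n) = 0" "\<forall>i>Suc n. x i = 0" "i > n" for x :: "nat \<Rightarrow> real" and i
    using that by (cases "i = Suc n") auto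
  then show ?thesis by (auto simp: unit_sphere_def)
qed

lemma abs_unit_sphere_le: assumes "x \<in> unit_sphere n" shows "\<bar>x i\<bar> \<le> 1"
proof (cases "i \<le> n")
  case True
  then have "(x i)\<^sup>2 \<le> (\<Sum>i\<le>n. (x i)\<^sup>2)" by (intro member_le_sum) auto
  then have "(x i)\<^sup>2 \<le> 1" using assms by (simp add: unit_sphere_def)
  then show ?thesis by (simp add: abs_square_le_1)
next
  case False then show ?thesis using assms by (simp add: unit_sphere_def)
qed

lemma continuous_on_eval [continuous_intros]:
  "continuous_on S (\<lambda>x. (x :: 'i \<Rightarrow> 'b::topological_space) i)"
  by (rule continuous_on_product_then_coordinatewise) (rule continuous_on_id)

text \<open>The topology is that of pointwise convergence on all sequences, so compactness comes
  from Tychonoff's theorem for the cube of sequences in [-1, 1].\<close>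

lemma compact_unit_sphere: "compact (unit_sphere n)"
proof -
  define B :: "(nat \<Rightarrow> real) set" where "B = PiE UNIV (\<lambda>i. {-1..1})"
  have "compactin (product_topology (\<lambda>i. euclidean) UNIV) B"
    unfolding B_def by (subst compactin_PiE) auto
  then have "compact B" by (simp add: euclidean_product_topology)
  moreover have "closed (unit_sphere n)"
    unfolding unit_sphere_def Collect_conj_eq
    by (intro closed_Int closed_Collect_eq closed_Collect_all closed_Collect_imp continuous_intros) auto
  moreover have "unit_sphere n \<subseteq> B"
    using abs_unit_sphere_le by (force simp: B_def abs_le_iff)
  ultimately show ?thesis by (metis compact_Int_closed inf.absorb_iff2)
qed

definition normalize_upto :: "nat \<Rightarrow> (nat \<Rightarrow> real) \<Rightarrow> nat \<Rightarrow> real" where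
  "normalize_upto n y = (\<lambda>i. if i \<le> n then y i / sqrt (\<Sum>j\<le>n. (y j)\<^sup>2) else 0)"

lemma normalize_upto_in: assumes "(\<Sum>j\<le>n. (y j)\<^sup>2) \<noteq> 0" shows "normalize_upto n y \<in> unit_sphere n"
proof -
  have "(\<Sum>i\<le>n. (normalize_upto n y i)\<^sup>2) = (\<Sum>i\<le>n. (y i)\<^sup>2 / (\<Sum>j\<le>n. (y j)\<^sup>2))"
    by (intro sum.cong) (auto simp: normalize_upto_def power_divide sum_nonneg)
  also have "\<dots> = 1" using assms by (simp flip: sum_divide_distrib)
  finally show ?thesis by (simp add: unit_sphere_def normalize_upto_def)
qed

lemma continuous_on_normalize_upto:
  fixes f :: "'a::topological_space \<Rightarrow> nat \<Rightarrow> real"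
  assumes "\<And>i. i \<le> n \<Longrightarrow> continuous_on A (\<lambda>x. f x i)" "\<And>x. x \<in> A \<Longrightarrow> (\<Sum>j\<le>n. (f x j)\<^sup>2) \<noteq> 0"
  shows "continuous_on A (\<lambda>x. normalize_upto n (f x))"
proof (rule continuous_on_coordinatewise_then_product)
  fix i show "continuous_on A (\<lambda>x. normalize_upto n (f x) i)"
    using assms by (cases "i \<le> n") (auto simp: normalize_upto_def intro!: continuous_intros)
qed

text \<open>Only the coordinates up to \<open>n\<close> are inspected. For a map \<open>f\<close> on
  the sphere of dimension \<open>Suc n\<close>, \<open>odd_map n f\<close> therefore says that the
  image of the equator avoids the last axis, which is what the comparison of degrees
  requires.\<close>

definition odd_map :: "nat \<Rightarrow> ((nat \<Rightarrow> real) \<Rightarrow> nat \<Rightarrow> real) \<Rightarrow> bool" where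
  "odd_map n f \<longleftrightarrow> (\<forall>i\<le>n. continuous_on (unit_sphere n) (\<lambda>x. f x i)) \<and>
     (\<forall>x\<in>unit_sphere n. \<forall>i\<le>n. f (\<lambda>j. - x j) i = - f x i) \<and>
     (\<forall>x\<in>unit_sphere n. (\<Sum>i\<le>n. (f x i)\<^sup>2) \<noteq> 0)"

definition sphere_degree :: "nat \<Rightarrow> ((nat \<Rightarrow> real) \<Rightarrow> nat \<Rightarrow> real) \<Rightarrow> int" where
  "sphere_degree n f = Brouwer_degree2 n (\<lambda>x. normalize_upto n (f x))"

lemma odd_map_continuous:
  assumes "odd_map n f"
  shows "continuous_map (nsphere n) (nsphere n) (\<lambda>x. normalize_upto n (f x))"
  using assms unfolding nsphere_top_of_set odd_map_def
  by (auto intro!: continuous_on_normalize_upto normalize_upto_in)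

lemma sphere_degree_homotopic:
  fixes h :: "real \<Rightarrow> (nat \<Rightarrow> real) \<Rightarrow> nat \<Rightarrow> real"
  assumes "\<And>i. i \<le> n \<Longrightarrow> continuous_on ({0..1} \<times> unit_sphere n) (\<lambda>(t, x). h t x i)"
    and "\<And>t x. t \<in> {0..1} \<Longrightarrow> x \<in> unit_sphere n \<Longrightarrow> (\<Sum>i\<le>n. (h t x i)\<^sup>2) \<noteq> 0"
  shows "sphere_degree n (h 0) = sphere_degree n (h 1)"
  unfolding sphere_degree_def
proof (rule Brouwer_degree2_homotopic)
  have "continuous_on ({0..1} \<times> unit_sphere n) (\<lambda>p. normalize_upto n (h (fst p) (snd p)))"
    using assms by (intro continuous_on_normalize_upto) (auto simp: case_prod_unfold)
  then show "homotopic_with (\<lambda>x. True) (nsphere n) (nsphere n) (\<lambda>x. normalize_upto n (h 0 x)) (\<lambda>x. normalize_upto n (h 1 x))"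
    unfolding homotopic_with_def nsphere_top_of_set
    by (intro exI[of _ "\<lambda>p. normalize_upto n (h (fst p) (snd p))"])
       (use assms(2) in \<open>force simp: case_prod_unfold intro!: normalize_upto_in\<close>)
qed

lemma sphere_degree_cong:
  assumes "\<And>x i. x \<in> unit_sphere n \<Longrightarrow> i \<le> n \<Longrightarrow> f x i = g x i"
  shows "sphere_degree n f = sphere_degree n g"
  unfolding sphere_degree_def
  by (rule Brouwer_degree2_eq)
     (auto simp: topspace_nsphere_unit_sphere normalize_upto_def assms intro!: ext)

lemma normalize_upto_minus: 
  assumes "\<And>i. i \<le> n \<Longrightarrow> y i = - z i"
  shows "normalize_upto n y = (\<lambda>i. - normalize_upto n z i)"
  by (auto simp: normalize_upto_def fun_eq_iff assms)

text \<open>The homotopy multiplies the last coordinate by \<open>\<bar>x\<^sub>n\<bar>\<close>, so that the equator is mapped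
  to the equator; it stays in the complement of the origin by the assumption on the equator.\<close>

lemma sphere_degree_step:
  assumes f: "odd_map (Suc n) f" and fn: "odd_map n f"
  shows "even (sphere_degree (Suc n) f - sphere_degree n f)"
proof -
  define g where "g = (\<lambda>x i. if i = Suc n then \<bar>x (Suc n)\<bar> * f x i else f x i)"
  define h where "h = (\<lambda>t x i. if i = Suc n then (1 - t + t * \<bar>x (Suc n)\<bar>) * f x i else f x i)"
  have nz: "(\<Sum>i\<le>Suc n. (h t x i)\<^sup>2) \<noteq> 0" if t: "t \<in> {0..1}" and x: "x \<in> unit_sphere (Suc n)" for t x
  proof
    assume "(\<Sum>i\<le>Suc n. (h t x i)\<^sup>2) = 0"
    then have h0: "\<And>i. i \<le> Suc n \<Longrightarrow> h t x i = 0" by (subst (asm) sum_nonneg_eq_0_iff) auto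
    have f0: "f x i = 0" if "i \<le> n" for i using h0[of i] that by (simp add: h_def)
    have "x (Suc n) \<noteq> 0"
    proof
      assume "x (Suc n) = 0"
      then have "x \<in> unit_sphere n" using x by (simp add: unit_sphere_Suc[of n])
      then have "(\<Sum>i\<le>n. (f x i)\<^sup>2) \<noteq> 0" using fn by (simp add: odd_map_def)
      then show False by (simp add: f0)
    qed
    then have "1 - t + t * \<bar>x (Suc n)\<bar> > 0"
      using t by (cases "t = 0") (auto intro!: add_nonneg_pos mult_pos_pos)
    then have "f x (Suc n) = 0" using h0[of "Suc n"] by (auto simp: h_def)
    with f0 have "(\<Sum>i\<le>Suc n. (f x i)\<^sup>2) = 0" by simp
    then show False using f x by (simp add: odd_map_def)
  qed
  have "sphere_degree (Suc n) f = sphere_degree (Suc n) (h 0)"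
    by (rule sphere_degree_cong) (simp add: h_def)
  also have "\<dots> = sphere_degree (Suc n) (h 1)"
  proof (rule sphere_degree_homotopic[OF _ nz])
    fix i assume i: "i \<le> Suc n"
    have c: "continuous_on ({0..1} \<times> unit_sphere (Suc n)) (\<lambda>p. f (snd p) i)"
      using f i by (intro continuous_on_compose2[of "unit_sphere (Suc n)" "\<lambda>x. f x i" _ snd])
        (auto simp: odd_map_def intro!: continuous_on_snd continuous_on_id)
    have e: "continuous_on ({0..1} \<times> unit_sphere (Suc n)) (\<lambda>p. snd p (Suc n) :: real)"
      by (rule continuous_on_compose2[of UNIV "\<lambda>x. x (Suc n)" _ snd]) (auto intro!: continuous_on_eval continuous_on_snd continuous_on_id)
    show "continuous_on ({0..1} \<times> unit_sphere (Suc n)) (\<lambda>(t, x). h t x i)"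
      using c e by (cases "i = Suc n") (auto simp: case_prod_unfold h_def intro!: continuous_intros)
  qed auto
  also have "\<dots> = sphere_degree (Suc n) g"
    by (rule sphere_degree_cong) (simp add: h_def g_def)
  finally have fg: "sphere_degree (Suc n) f = sphere_degree (Suc n) g" .
  have gsum: "(\<Sum>i\<le>Suc n. (g x i)\<^sup>2) = (\<Sum>i\<le>n. (f x i)\<^sup>2)" if "x \<in> unit_sphere n" for x
    using that by (simp add: g_def unit_sphere_def)
  have geq: "normalize_upto (Suc n) (g x) = normalize_upto n (f x)" if "x \<in> unit_sphere n" for x
    using that unfolding normalize_upto_def gsum[OF that]
    by (auto simp: fun_eq_iff g_def unit_sphere_def le_Suc_eq)
  have g_nz: "(\<Sum>i\<le>Suc n. (g x i)\<^sup>2) \<noteq> 0" if "x \<in> unit_sphere (Suc n)" for x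
  proof -
    have "h 1 x = g x" by (simp add: h_def g_def fun_eq_iff)
    with nz[of 1 x] that show ?thesis by simp
  qed
  have odd: "odd_map (Suc n) g"
    unfolding odd_map_def
  proof (intro conjI allI impI ballI)
    fix i assume "i \<le> Suc n" then show "continuous_on (unit_sphere (Suc n)) (\<lambda>x. g x i)"
      using f by (cases "i = Suc n") (auto simp: g_def odd_map_def intro!: continuous_intros)
  next
    fix x i assume "x \<in> unit_sphere (Suc n)" "i \<le> Suc n"
    then show "g (\<lambda>j. - x j) i = - g x i" using f by (simp add: g_def odd_map_def)
  qed (rule g_nz)
  have "even (Brouwer_degree2 (Suc n) (\<lambda>x. normalize_upto (Suc n) (g x)) - Brouwer_degree2 (Suc n - Suc 0) (\<lambda>x. normalize_upto (Suc n) (g x)))"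
  proof (rule Borsuk_odd_mapping_degree_step)
    show "continuous_map (nsphere (Suc n)) (nsphere (Suc n)) (\<lambda>x. normalize_upto (Suc n) (g x))"
      using odd by (rule odd_map_continuous)
    show "((\<lambda>x. normalize_upto (Suc n) (g x)) \<circ> (\<lambda>x i. - x i)) u = ((\<lambda>x i. - x i) \<circ> (\<lambda>x. normalize_upto (Suc n) (g x))) u"
      if "u \<in> topspace (nsphere (Suc n))" for u
      using odd that unfolding o_def
      by (intro normalize_upto_minus) (auto simp: odd_map_def topspace_nsphere_unit_sphere)
    show "(\<lambda>x. normalize_upto (Suc n) (g x)) \<in> topspace (nsphere (Suc n - Suc 0)) \<rightarrow> topspace (nsphere (Suc n - Suc 0))"
      using fn by (auto simp: topspace_nsphere_unit_sphere geq odd_map_def intro!: normalize_upto_in)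
  qed
  moreover have "Brouwer_degree2 n (\<lambda>x. normalize_upto (Suc n) (g x)) = sphere_degree n f"
    unfolding sphere_degree_def by (rule Brouwer_degree2_eq) (simp add: geq topspace_nsphere_unit_sphere)
  ultimately show ?thesis unfolding fg by (simp add: sphere_degree_def)
qed

section \<open>Lipschitz approximation of odd maps, and directions missed by Lipschitz
  images\<close>

definition lipschitz_unit_sphere :: "nat \<Rightarrow> ((nat \<Rightarrow> real) \<Rightarrow> real) \<Rightarrow> bool" where
  "lipschitz_unit_sphere n p \<longleftrightarrow>
     (\<exists>L. \<forall>x\<in>unit_sphere n. \<forall>y\<in>unit_sphere n. \<bar>p x - p y\<bar> \<le> L * (\<Sum>i\<le>n. \<bar>x i - y i\<bar>))"

lemma lipschitz_unit_sphere_nonneg: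
  assumes "lipschitz_unit_sphere n p"
  obtains L where "L \<ge> 0"
    "\<And>x y. x \<in> unit_sphere n \<Longrightarrow> y \<in> unit_sphere n \<Longrightarrow> \<bar>p x - p y\<bar> \<le> L * (\<Sum>i\<le>n. \<bar>x i - y i\<bar>)"
proof -
  obtain L where L: "\<And>x y. x \<in> unit_sphere n \<Longrightarrow> y \<in> unit_sphere n \<Longrightarrow> \<bar>p x - p y\<bar> \<le> L * (\<Sum>i\<le>n. \<bar>x i - y i\<bar>)"
    using assms by (auto simp: lipschitz_unit_sphere_def)
  have "\<bar>p x - p y\<bar> \<le> \<bar>L\<bar> * (\<Sum>i\<le>n. \<bar>x i - y i\<bar>)" if "x \<in> unit_sphere n" "y \<in> unit_sphere n" for x y
    using L[OF that] by (rule order_trans) (auto intro!: mult_right_mono sum_nonneg)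
  then show ?thesis using that[of "\<bar>L\<bar>"] by simp
qed

lemma lipschitz_unit_sphere_add:
  assumes "lipschitz_unit_sphere n f" "lipschitz_unit_sphere n g"
  shows "lipschitz_unit_sphere n (\<lambda>x. f x + g x)"
proof -
  obtain L where L: "\<And>x y. x \<in> unit_sphere n \<Longrightarrow> y \<in> unit_sphere n \<Longrightarrow> \<bar>f x - f y\<bar> \<le> L * (\<Sum>i\<le>n. \<bar>x i - y i\<bar>)"
    using assms(1) by (auto simp: lipschitz_unit_sphere_def)
  obtain M where M: "\<And>x y. x \<in> unit_sphere n \<Longrightarrow> y \<in> unit_sphere n \<Longrightarrow> \<bar>g x - g y\<bar> \<le> M * (\<Sum>i\<le>n. \<bar>x i - y i\<bar>)"
    using assms(2) by (auto simp: lipschitz_unit_sphere_def)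
  have "\<bar>(f x + g x) - (f y + g y)\<bar> \<le> (L + M) * (\<Sum>i\<le>n. \<bar>x i - y i\<bar>)" if "x \<in> unit_sphere n" "y \<in> unit_sphere n" for x y
    using L[OF that] M[OF that] unfolding distrib_right by linarith
  then show ?thesis unfolding lipschitz_unit_sphere_def by blast
qed

lemma continuous_on_unit_sphere_bounded:
  fixes f :: "(nat \<Rightarrow> real) \<Rightarrow> real"
  assumes "continuous_on (unit_sphere n) f"
  obtains B where "B > 0" "\<And>x. x \<in> unit_sphere n \<Longrightarrow> \<bar>f x\<bar> \<le> B"
proof -
  have "bounded (f ` unit_sphere n)"
    using compact_continuous_image[OF assms compact_unit_sphere] by (rule compact_imp_bounded)
  then show ?thesis using that by (auto simp: bounded_pos)
qed

text \<open>Products stay Lipschitz because continuous factors are bounded on the compact sphere.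
  This makes the continuous Lipschitz functions an algebra, as Stone-Weierstrass requires.\<close>

lemma lipschitz_unit_sphere_mult:
  assumes f: "lipschitz_unit_sphere n f" "continuous_on (unit_sphere n) f"
    and g: "lipschitz_unit_sphere n g" "continuous_on (unit_sphere n) g"
  shows "lipschitz_unit_sphere n (\<lambda>x. f x * g x)"
proof -
  obtain L where L: "L \<ge> 0" "\<And>x y. x \<in> unit_sphere n \<Longrightarrow> y \<in> unit_sphere n \<Longrightarrow> \<bar>f x - f y\<bar> \<le> L * (\<Sum>i\<le>n. \<bar>x i - y i\<bar>)"
    using lipschitz_unit_sphere_nonneg[OF f(1)] by metis
  obtain M where M: "M \<ge> 0" "\<And>x y. x \<in> unit_sphere n \<Longrightarrow> y \<in> unit_sphere n \<Longrightarrow> \<bar>g x - g y\<bar> \<le> M * (\<Sum>i\<le>n. \<bar>x i - y i\<bar>)"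
    using lipschitz_unit_sphere_nonneg[OF g(1)] by metis
  obtain A where A: "A > 0" "\<And>x. x \<in> unit_sphere n \<Longrightarrow> \<bar>f x\<bar> \<le> A"
    using continuous_on_unit_sphere_bounded[OF f(2)] by metis
  obtain B where B: "B > 0" "\<And>x. x \<in> unit_sphere n \<Longrightarrow> \<bar>g x\<bar> \<le> B"
    using continuous_on_unit_sphere_bounded[OF g(2)] by metis
  have "\<bar>f x * g x - f y * g y\<bar> \<le> (A * M + L * B) * (\<Sum>i\<le>n. \<bar>x i - y i\<bar>)" if xy: "x \<in> unit_sphere n" "y \<in> unit_sphere n" for x y
  proof -
    have "\<bar>f x * g x - f y * g y\<bar> = \<bar>f x * (g x - g y) + (f x - f y) * g y\<bar>" by (simp add: algebra_simps)
    also have "\<dots> \<le> \<bar>f x\<bar> * \<bar>g x - g y\<bar> + \<bar>f x - f y\<bar> * \<bar>g y\<bar>"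
      by (metis abs_mult abs_triangle_ineq)
    also have "\<dots> \<le> A * (M * (\<Sum>i\<le>n. \<bar>x i - y i\<bar>)) + (L * (\<Sum>i\<le>n. \<bar>x i - y i\<bar>)) * B"
      using xy A B L M by (intro add_mono mult_mono) (auto intro!: mult_nonneg_nonneg sum_nonneg)
    finally show ?thesis by (simp add: algebra_simps)
  qed
  then show ?thesis unfolding lipschitz_unit_sphere_def by blast
qed

text \<open>Stone-Weierstrass gives a Lipschitz approximation \<open>g\<close>. Its odd part is no
  worse, since the error at x is the mean of the errors of \<open>g\<close> at x and, up to sign, at
  the antipode.\<close>

lemma odd_lipschitz_approximation:
  assumes f: "continuous_on (unit_sphere n) f" and odd: "\<And>x. x \<in> unit_sphere n \<Longrightarrow> f (\<lambda>i. - x i) = - f x"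
    and e: "e > 0"
  obtains p where "continuous_on (unit_sphere n) p" "lipschitz_unit_sphere n p"
    "\<And>x. p (\<lambda>i. - x i) = - p x" "\<And>x. x \<in> unit_sphere n \<Longrightarrow> \<bar>f x - p x\<bar> < e"
proof -
  let ?P = "\<lambda>g. continuous_on (unit_sphere n) g \<and> lipschitz_unit_sphere n g"
  have "\<exists>g. ?P g \<and> (\<forall>x\<in>unit_sphere n. \<bar>f x - g x\<bar> < e)"
  proof (rule Stone_Weierstrass_HOL[OF compact_unit_sphere])
    show "?P (\<lambda>x. c)" for c by (auto simp: lipschitz_unit_sphere_def intro!: exI[of _ 0])
    show "?P (\<lambda>x. g x + h x)" if "?P g \<and> ?P h" for g h
      using that by (auto intro!: continuous_intros lipschitz_unit_sphere_add)
    show "?P (\<lambda>x. g x * h x)" if "?P g \<and> ?P h" for g h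
      using that by (auto intro!: continuous_intros lipschitz_unit_sphere_mult)
    show "\<exists>g. ?P g \<and> g x \<noteq> g y" if xy: "x \<in> unit_sphere n \<and> y \<in> unit_sphere n \<and> x \<noteq> y" for x y
    proof -
      obtain i where i: "x i \<noteq> y i" using xy by (auto simp: fun_eq_iff)
      have "i \<le> n" using i xy by (force simp: unit_sphere_def not_le)
      then have "\<bar>u i - v i\<bar> \<le> 1 * (\<Sum>i\<le>n. \<bar>u i - v i\<bar>)" for u v :: "nat \<Rightarrow> real"
        using member_le_sum[of i "{..n}" "\<lambda>i. \<bar>u i - v i\<bar>"] by simp
      then have "lipschitz_unit_sphere n (\<lambda>x. x i)" unfolding lipschitz_unit_sphere_def by blast
      then show ?thesis using i by (intro exI[of _ "\<lambda>x. x i"]) (auto intro: continuous_on_eval)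
    qed
  qed (use f e in auto)
  then obtain g where g: "continuous_on (unit_sphere n) g" "lipschitz_unit_sphere n g"
    and ge: "\<And>x. x \<in> unit_sphere n \<Longrightarrow> \<bar>f x - g x\<bar> < e" by blast
  define p where "p = (\<lambda>x. (g x + (-1) * g (\<lambda>i. - x i)) * (1/2))"
  have cm: "continuous_on (unit_sphere n) (\<lambda>x. g (\<lambda>i. - x i))"
    by (rule continuous_on_compose2[OF g(1)])
       (auto intro!: continuous_on_coordinatewise_then_product continuous_intros unit_sphere_minus)
  have lm: "lipschitz_unit_sphere n (\<lambda>x. g (\<lambda>i. - x i))"
  proof -
    obtain L where L: "\<And>x y. x \<in> unit_sphere n \<Longrightarrow> y \<in> unit_sphere n \<Longrightarrow> \<bar>g x - g y\<bar> \<le> L * (\<Sum>i\<le>n. \<bar>x i - y i\<bar>)"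
      using g(2) by (auto simp: lipschitz_unit_sphere_def)
    have "\<bar>g (\<lambda>i. - x i) - g (\<lambda>i. - y i)\<bar> \<le> L * (\<Sum>i\<le>n. \<bar>x i - y i\<bar>)" if "x \<in> unit_sphere n" "y \<in> unit_sphere n" for x y
      using L[of "\<lambda>i. - x i" "\<lambda>i. - y i"] that by (simp add: unit_sphere_minus abs_minus_commute)
    then show ?thesis unfolding lipschitz_unit_sphere_def by blast
  qed
  have lc: "lipschitz_unit_sphere n (\<lambda>x. c)" for c
    by (auto simp: lipschitz_unit_sphere_def intro!: exI[of _ 0])
  have "continuous_on (unit_sphere n) p" unfolding p_def by (intro continuous_intros g cm)
  moreover have "lipschitz_unit_sphere n p" unfolding p_def
    by (intro lipschitz_unit_sphere_mult lipschitz_unit_sphere_add lc lm g cm continuous_intros)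
  moreover have "p (\<lambda>i. - x i) = - p x" for x by (simp add: p_def field_simps)
  moreover have "\<bar>f x - p x\<bar> < e" if "x \<in> unit_sphere n" for x
  proof -
    have "\<bar>- f x - g (\<lambda>i. - x i)\<bar> < e" using ge[OF unit_sphere_minus[OF that]] odd[OF that] by simp
    with ge[OF that] show ?thesis unfolding p_def by (simp add: field_simps) 
  qed
  ultimately show ?thesis by (rule that)
qed

text \<open>The radial extension of a Lipschitz function is Lipschitz: s and t are the Euclidean
  norms of the points s x and t y, so the radii differ by at most the distance of these
  points.\<close>

lemma cone_lipschitz:
  assumes L: "\<And>x y. x \<in> unit_sphere n \<Longrightarrow> y \<in> unit_sphere n \<Longrightarrow> \<bar>p x - p y\<bar> \<le> L * (\<Sum>i\<le>n. \<bar>x i - y i\<bar>)"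
    and "L \<ge> 0" and B: "\<And>x. x \<in> unit_sphere n \<Longrightarrow> \<bar>p x\<bar> \<le> B"
    and s: "s \<ge> 0" and t: "t \<ge> 0" and x: "x \<in> unit_sphere n" and y: "y \<in> unit_sphere n"
  shows "\<bar>s * p x - t * p y\<bar> \<le> (L * (n + 2) + B) * (\<Sum>i\<le>n. \<bar>s * x i - t * y i\<bar>)"
proof -
  let ?d = "\<Sum>i\<le>n. \<bar>s * x i - t * y i\<bar>"
  have nrm: "L2_set (\<lambda>i. r * z i) {..n} = r" if "z \<in> unit_sphere n" "r \<ge> 0" for z r
    using that by (simp add: L2_set_def unit_sphere_def power_mult_distrib flip: sum_distrib_left)
  have le: "r \<le> q + (\<Sum>i\<le>n. \<bar>r * z i - q * w i\<bar>)"
    if "z \<in> unit_sphere n" "w \<in> unit_sphere n" "r \<ge> 0" "q \<ge> 0" for z w r q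
  proof -
    have "r = L2_set (\<lambda>i. q * w i + (r * z i - q * w i)) {..n}" using nrm[of z r] that by simp
    also have "\<dots> \<le> L2_set (\<lambda>i. q * w i) {..n} + L2_set (\<lambda>i. r * z i - q * w i) {..n}"
      by (rule L2_set_triangle_ineq)
    also have "\<dots> \<le> q + (\<Sum>i\<le>n. \<bar>r * z i - q * w i\<bar>)"
      using nrm[of w q] that by (simp add: L2_set_le_sum_abs)
    finally show ?thesis .
  qed
  have st: "\<bar>s - t\<bar> \<le> ?d"
    using le[OF x y s t] le[OF y x t s] by (simp add: abs_minus_commute abs_le_iff)
  \<comment> \<open>From s (x - y) = (s x - t y) - (s - t) y, each of the n + 1 coordinates costs an
    additional |s - t|, hence the factor n + 2.\<close>
  have "s * (\<Sum>i\<le>n. \<bar>x i - y i\<bar>) \<le> (\<Sum>i\<le>n. \<bar>s * x i - t * y i\<bar> + \<bar>s - t\<bar>)"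
    unfolding sum_distrib_left
  proof (rule sum_mono)
    fix i
    have "s * \<bar>x i - y i\<bar> = \<bar>(s * x i - t * y i) - (s - t) * y i\<bar>"
      using s by (simp add: left_diff_distrib abs_mult flip: right_diff_distrib)
    also have "\<dots> \<le> \<bar>s * x i - t * y i\<bar> + \<bar>s - t\<bar> * \<bar>y i\<bar>"
      by (metis abs_mult abs_triangle_ineq4)
    also have "\<dots> \<le> \<bar>s * x i - t * y i\<bar> + \<bar>s - t\<bar>"
      using abs_unit_sphere_le[OF y, of i] by (simp add: mult_left_le)
    finally show "s * \<bar>x i - y i\<bar> \<le> \<bar>s * x i - t * y i\<bar> + \<bar>s - t\<bar>" .
  qed
  also have "\<dots> = ?d + (real n + 1) * \<bar>s - t\<bar>" by (simp add: sum.distrib)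
  also have "\<dots> \<le> ?d + (real n + 1) * ?d" using st by (intro add_left_mono mult_left_mono) auto
  finally have sx: "s * (\<Sum>i\<le>n. \<bar>x i - y i\<bar>) \<le> (real n + 2) * ?d" by (simp add: algebra_simps)
  have "\<bar>s * p x - t * p y\<bar> = \<bar>s * (p x - p y) + (s - t) * p y\<bar>" by (simp add: algebra_simps)
  also have "\<dots> \<le> \<bar>s * (p x - p y)\<bar> + \<bar>(s - t) * p y\<bar>" by (rule abs_triangle_ineq)
  also have "\<dots> = s * \<bar>p x - p y\<bar> + \<bar>s - t\<bar> * \<bar>p y\<bar>" using s by (simp add: abs_mult)
  also have "\<dots> \<le> s * (L * (\<Sum>i\<le>n. \<bar>x i - y i\<bar>)) + ?d * B"
    using s st B[OF y] L[OF x y] by (intro add_mono mult_mono mult_left_mono) (auto intro!: sum_nonneg)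
  also have "\<dots> = L * (s * (\<Sum>i\<le>n. \<bar>x i - y i\<bar>)) + ?d * B" by (simp add: algebra_simps)
  also have "\<dots> \<le> L * ((real n + 2) * ?d) + ?d * B" using sx \<open>L \<ge> 0\<close> by (intro add_mono mult_left_mono) auto
  finally show ?thesis by (simp add: algebra_simps)
qed

text \<open>A cone over the Lipschitz image of \<open>S\<^sup>n\<close> meets only \<open>O(m\<^sup>n\<^sup>+\<^sup>1)\<close> of the \<open>(m + 1)\<^sup>n\<^sup>+\<^sup>2\<close> points of a grid of
  mesh \<open>1/m\<close> in the unit cube.\<close>

lemma lipschitz_cone_not_surjective:
  fixes p :: "(nat \<Rightarrow> real) \<Rightarrow> nat \<Rightarrow> real"
  assumes cont: "\<And>i. i \<le> Suc n \<Longrightarrow> continuous_on (unit_sphere n) (\<lambda>x. p x i)"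
    and lip: "\<And>i. i \<le> Suc n \<Longrightarrow> lipschitz_unit_sphere n (\<lambda>x. p x i)"
    and nz: "c > 0" "\<And>x. x \<in> unit_sphere n \<Longrightarrow> \<exists>i\<le>Suc n. \<bar>p x i\<bar> \<ge> c"
  obtains q where "\<And>t x. t \<ge> 0 \<Longrightarrow> x \<in> unit_sphere n \<Longrightarrow> \<exists>i\<le>Suc n. q i \<noteq> t * p x i"
proof (rule ccontr)
  assume "\<not> thesis"
  with that have all: "\<exists>t x. t \<ge> 0 \<and> x \<in> unit_sphere n \<and> (\<forall>i\<le>Suc n. q i = t * p x i)" for q by metis
  have "\<exists>L. L \<ge> 0 \<and> (\<forall>x y. x \<in> unit_sphere n \<longrightarrow> y \<in> unit_sphere n \<longrightarrow> \<bar>p x i - p y i\<bar> \<le> L * (\<Sum>i\<le>n. \<bar>x i - y i\<bar>))" if "i \<le> Suc n" for i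
    using lipschitz_unit_sphere_nonneg[OF lip[OF that]] by metis
  then obtain L where L: "\<And>i. i \<le> Suc n \<Longrightarrow> L i \<ge> 0" 
    "\<And>i x y. i \<le> Suc n \<Longrightarrow> x \<in> unit_sphere n \<Longrightarrow> y \<in> unit_sphere n \<Longrightarrow> \<bar>p x i - p y i\<bar> \<le> L i * (\<Sum>i\<le>n. \<bar>x i - y i\<bar>)"
    by metis
  have "\<exists>B. B > 0 \<and> (\<forall>x. x \<in> unit_sphere n \<longrightarrow> \<bar>p x i\<bar> \<le> B)" if "i \<le> Suc n" for i
    using continuous_on_unit_sphere_bounded[OF cont[OF that]] by metis
  then obtain B where B: "\<And>i. i \<le> Suc n \<Longrightarrow> B i > 0" 
    "\<And>i x. i \<le> Suc n \<Longrightarrow> x \<in> unit_sphere n \<Longrightarrow> \<bar>p x i\<bar> \<le> B i"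
    by metis
  have LB: "0 \<le> L i * (n + 2) + B i" if "i \<le> Suc n" for i
    using L(1)[OF that] B(1)[OF that] by (intro add_nonneg_nonneg mult_nonneg_nonneg) auto
  define C where "C = (\<Sum>i\<le>Suc n. L i * (n + 2) + B i)"
  have C: "\<bar>s * p x i - t * p y i\<bar> \<le> C * (\<Sum>i\<le>n. \<bar>s * x i - t * y i\<bar>)"
    if "i \<le> Suc n" "s \<ge> 0" "t \<ge> 0" "x \<in> unit_sphere n" "y \<in> unit_sphere n" for i s t x y
  proof -
    have "\<bar>s * p x i - t * p y i\<bar> \<le> (L i * (n + 2) + B i) * (\<Sum>i\<le>n. \<bar>s * x i - t * y i\<bar>)"
      using that L B by (intro cone_lipschitz) auto
    also have "\<dots> \<le> C * (\<Sum>i\<le>n. \<bar>s * x i - t * y i\<bar>)"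
      unfolding C_def using that LB by (intro mult_right_mono member_le_sum sum_nonneg) auto
    finally show ?thesis .
  qed
  have "C \<ge> 0" unfolding C_def using LB by (intro sum_nonneg) auto
  \<comment> \<open>\<open>A\<close> bounds the radius of a cone point lying over the unit cube.
    \<open>D\<close> bounds, in units of the grid, the distance between two grid points whose
    preimages share a cell.\<close>
  obtain A :: nat where A: "1 / c \<le> real A" using real_arch_simple by blast
  obtain D :: nat where D: "C * (n + 1) \<le> real D" using real_arch_simple by blast
  \<comment> \<open>This value closes the count: at most ((2A+1)(m+1))^(n+1) (D+1)^(n+2) =
    (m+1)^(n+1) m grid points can be told apart by \<open>cell\<close> and \<open>res\<close>, fewer
    than the (m+1)^(n+2) that exist.\<close>
  define m where "m = (2 * A + 1) ^ (n + 1) * (D + 1) ^ (n + 2)"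
  have m: "m > 0" by (simp add: m_def)
  define K where "K = PiE {..Suc n} (\<lambda>_. {0..int m})"
  have "\<exists>t x. t \<ge> 0 \<and> x \<in> unit_sphere n \<and> (\<forall>i\<le>Suc n. of_int (k i) = real m * (t * p x i))" for k :: "nat \<Rightarrow> int"
    using all[of "\<lambda>i. of_int (k i) / m"] m by (simp add: field_simps) 
  then obtain t x where t: "\<And>k. t k \<ge> 0" and x: "\<And>k. x k \<in> unit_sphere n"
    and k: "\<And>k i. i \<le> Suc n \<Longrightarrow> of_int (k i) = real m * (t k * p (x k) i)" for k :: "nat \<Rightarrow> int"
    by metis
  have tA: "t k \<le> A" if "k \<in> K" for k
  proof -
    obtain i where i: "i \<le> Suc n" "\<bar>p (x k) i\<bar> \<ge> c" using nz(2)[OF x] by blast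
    have "k i \<in> {0..int m}" using that i by (auto simp: K_def)
    then have "\<bar>of_int (k i)\<bar> \<le> real m" by auto
    then have "real m * (t k * \<bar>p (x k) i\<bar>) \<le> real m" unfolding k[OF i(1)] using t by (simp add: abs_mult)
    then have "t k * \<bar>p (x k) i\<bar> \<le> 1" using m by simp
    moreover have "t k * c \<le> t k * \<bar>p (x k) i\<bar>" using i t by (intro mult_left_mono)
    ultimately have "t k * c \<le> 1" by linarith
    then have "t k \<le> 1 / c" using nz(1) by (simp add: field_simps)
    then show ?thesis using A by linarith
  qed
  \<comment> \<open>A grid point is determined by the cell of its preimage, of side 1/m, together
    with its coordinates modulo \<open>D + 1\<close>, because grid points with preimages in one cell
    differ by at most \<open>D\<close> in each coordinate.\<close>
  define cell where "cell = (\<lambda>k. restrict (\<lambda>j. \<lfloor>m * (t k * x k j)\<rfloor>) {..n})"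
  define res where "res = (\<lambda>k::nat \<Rightarrow> int. restrict (\<lambda>i. k i mod (int D + 1)) {..Suc n})"
  define F where "F = PiE {..n} (\<lambda>_. {-int (A * m)..int (A * m)}) \<times> PiE {..Suc n} (\<lambda>_. {0..int D})"
  have cell_bound: "\<lfloor>m * (t k * x k j)\<rfloor> \<in> {-int (A * m)..int (A * m)}" if "k \<in> K" for k j
  proof -
    have "\<bar>t k * x k j\<bar> \<le> real A * 1"
      unfolding abs_mult using tA[OF that] t[of k] abs_unit_sphere_le[OF x, of k j] by (intro mult_mono) auto
    then have "\<bar>m * (t k * x k j)\<bar> \<le> A * m"
      by (simp add: abs_mult mult.commute[of "real A"] mult_left_mono)
    then have "- real (A * m) \<le> m * (t k * x k j)" "m * (t k * x k j) \<le> real (A * m)" by linarith+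
    then show ?thesis by (auto simp: le_floor_iff floor_le_iff)
  qed
  have "inj_on (\<lambda>k. (cell k, res k)) K"
  proof (rule inj_onI)
    fix k l assume kl: "k \<in> K" "l \<in> K" "(cell k, res k) = (cell l, res l)"
    have cj: "\<bar>t k * x k j - t l * x l j\<bar> \<le> 1 / m" if "j \<le> n" for j
    proof -
      have "\<lfloor>m * (t k * x k j)\<rfloor> = \<lfloor>m * (t l * x l j)\<rfloor>"
        using kl(3) that by (auto simp: cell_def dest!: fun_cong[of _ _ j])
      then have "\<bar>m * (t k * x k j) - m * (t l * x l j)\<bar> \<le> 1" by linarith
      then have "m * \<bar>t k * x k j - t l * x l j\<bar> \<le> 1" by (simp add: abs_mult flip: right_diff_distrib)
      then show ?thesis using m by (simp add: field_simps)
    qed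
    have "k i = l i" if i: "i \<le> Suc n" for i
    proof -
      have "\<bar>real_of_int (k i) - l i\<bar> = m * \<bar>t k * p (x k) i - t l * p (x l) i\<bar>"
        unfolding k[OF i] by (simp add: abs_mult flip: right_diff_distrib)
      also have "\<dots> \<le> m * (C * (\<Sum>j\<le>n. \<bar>t k * x k j - t l * x l j\<bar>))"
        using i t x by (intro mult_left_mono C) auto
      also have "\<dots> \<le> m * (C * (\<Sum>j\<le>n. 1 / m))"
        using \<open>C \<ge> 0\<close> cj by (intro mult_left_mono sum_mono) auto
      also have "\<dots> = C * (n + 1)" using m by (simp add: field_simps)
      also have "\<dots> \<le> D" by (rule D)
      finally have "\<bar>k i - l i\<bar> \<le> int D" by linarith
      moreover have "k i mod (int D + 1) = l i mod (int D + 1)"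
        using kl(3) i by (auto simp: res_def dest!: fun_cong[of _ _ i])
      then have "(int D + 1) dvd (k i - l i)" by (simp add: mod_eq_dvd_iff)
      ultimately show ?thesis
        using dvd_imp_le_int[of "k i - l i" "int D + 1"] by fastforce
    qed
    then show "k = l" using kl(1,2) unfolding K_def by (intro PiE_ext) auto
  qed
  moreover have "(\<lambda>k. (cell k, res k)) ` K \<subseteq> F"
  proof -
    have "cell k \<in> PiE {..n} (\<lambda>_. {-int (A * m)..int (A * m)})" if "k \<in> K" for k
      unfolding cell_def by (rule restrict_PiE_iff[THEN iffD2]) (use cell_bound[OF that] in blast)
    moreover have "res k \<in> PiE {..Suc n} (\<lambda>_. {0..int D})" for k
      unfolding res_def by (rule restrict_PiE_iff[THEN iffD2]) (use pos_mod_bound[of "int D + 1"] in \<open>auto simp flip: zless_add1_eq\<close>)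
    ultimately show ?thesis by (auto simp: F_def)
  qed
  moreover have "finite F" by (auto simp: F_def intro!: finite_cartesian_product finite_PiE)
  ultimately have "card K \<le> card F" by (metis card_inj_on_le)
  moreover have "card K = (m + 1) ^ (n + 2)" by (simp add: K_def card_PiE nat_add_distrib)
  moreover have "card F = (2 * A * m + 1) ^ (n + 1) * (D + 1) ^ (n + 2)"
  proof -
    have "nat (1 + int D) = Suc D" "nat (int (A * m) + 1 + int (A * m)) = Suc (2 * A * m)"
      by linarith+
    then show ?thesis by (simp add: F_def card_cartesian_product card_PiE algebra_simps)
  qed
  ultimately have "(m + 1) ^ (n + 2) \<le> (2 * A * m + 1) ^ (n + 1) * (D + 1) ^ (n + 2)" by simp
  also have "\<dots> \<le> ((2 * A + 1) * (m + 1)) ^ (n + 1) * (D + 1) ^ (n + 2)"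
    by (intro mult_right_mono power_mono) (auto simp: algebra_simps)
  also have "\<dots> = (m + 1) ^ (n + 1) * m" unfolding m_def power_mult_distrib by (simp add: algebra_simps)
  also have "\<dots> < (m + 1) ^ (n + 2)" by simp
  finally show False by simp
qed

section \<open>Reflections, and the parity of the degree of an odd map\<close>

definition householder :: "nat \<Rightarrow> (nat \<Rightarrow> real) \<Rightarrow> (nat \<Rightarrow> real) \<Rightarrow> nat \<Rightarrow> real" where
  "householder n w y = (\<lambda>i. y i - 2 * (\<Sum>j\<le>n. y j * w j) / (\<Sum>j\<le>n. (w j)\<^sup>2) * w i)"

lemma sum_householder:
  "(\<Sum>j\<le>n. householder n w y j * w j) = - (\<Sum>j\<le>n. y j * w j)"
proof -
  define c where "c = 2 * (\<Sum>j\<le>n. y j * w j) / (\<Sum>j\<le>n. (w j)\<^sup>2)"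
  have h: "householder n w y i = y i - c * w i" for i by (simp add: householder_def c_def)
  have "(\<Sum>j\<le>n. householder n w y j * w j) = (\<Sum>j\<le>n. y j * w j) - c * (\<Sum>j\<le>n. (w j)\<^sup>2)"
    unfolding sum_distrib_left sum_subtractf[symmetric]
    by (intro sum.cong) (auto simp: h algebra_simps power2_eq_square)
  moreover have "(\<Sum>j\<le>n. y j * w j) = 0" if "(\<Sum>j\<le>n. (w j)\<^sup>2) = 0"
    using that by (simp add: sum_nonneg_eq_0_iff)
  ultimately show ?thesis by (cases "(\<Sum>j\<le>n. (w j)\<^sup>2) = 0") (auto simp: c_def)
qed

lemma householder_involution: "householder n w (householder n w y) = y"
proof
  fix i
  have "householder n w (householder n w y) i =
    householder n w y i - 2 * (\<Sum>j\<le>n. householder n w y j * w j) / (\<Sum>j\<le>n. (w j)\<^sup>2) * w i"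
    by (simp only: householder_def[of n w "householder n w y"])
  also have "\<dots> = y i" unfolding sum_householder by (simp add: householder_def)
  finally show "householder n w (householder n w y) i = y i" .
qed

lemma householder_norm: "(\<Sum>i\<le>n. (householder n w y i)\<^sup>2) = (\<Sum>i\<le>n. (y i)\<^sup>2)"
proof -
  define c where "c = 2 * (\<Sum>j\<le>n. y j * w j) / (\<Sum>j\<le>n. (w j)\<^sup>2)"
  have h: "householder n w y i = y i - c * w i" for i by (simp add: householder_def c_def)
  have "(\<Sum>i\<le>n. (householder n w y i)\<^sup>2) = (\<Sum>i\<le>n. (y i)\<^sup>2) - c * ((\<Sum>i\<le>n. y i * w i) + (\<Sum>i\<le>n. householder n w y i * w i))"
    unfolding sum_distrib_left sum_subtractf[symmetric] sum.distrib[symmetric]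
    by (intro sum.cong) (auto simp: h algebra_simps power2_eq_square)
  then show ?thesis by (simp add: sum_householder)
qed

text \<open>The reflection that exchanges \<open>q\<close> with the point of equal norm on the last
  axis; its normal \<open>w\<close> is their difference.\<close>

lemma householder_to_axis:
  assumes n: "\<And>i. i > n \<Longrightarrow> q i = 0"
  obtains w where "householder n w q = (\<lambda>i. if i = n then sqrt (\<Sum>j\<le>n. (q j)\<^sup>2) else 0)" "\<And>i. i > n \<Longrightarrow> w i = 0"
proof -
  define r where "r = sqrt (\<Sum>j\<le>n. (q j)\<^sup>2)"
  define w where "w = (\<lambda>i. if i = n then q i - r else q i)"
  have r2: "r\<^sup>2 = (\<Sum>j\<le>n. (q j)\<^sup>2)" by (simp add: r_def sum_nonneg)
  have qq: "(\<Sum>j\<le>n. (q j)\<^sup>2) = (\<Sum>j<n. (q j)\<^sup>2) + (q n)\<^sup>2" by (simp flip: lessThan_Suc_atMost)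
  have "(\<Sum>j\<le>n. q j * w j) = (\<Sum>j<n. (q j)\<^sup>2) + q n * (q n - r)"
    by (simp add: w_def power2_eq_square flip: lessThan_Suc_atMost)
  then have a: "(\<Sum>j\<le>n. q j * w j) = r * (r - q n)"
    using r2 qq by (simp add: power2_eq_square algebra_simps)
  have "(\<Sum>j\<le>n. (w j)\<^sup>2) = (\<Sum>j<n. (q j)\<^sup>2) + (q n - r)\<^sup>2"
    by (simp add: w_def flip: lessThan_Suc_atMost)
  then have b: "(\<Sum>j\<le>n. (w j)\<^sup>2) = 2 * r * (r - q n)"
    using r2 qq by (simp add: power2_eq_square algebra_simps)
  have "householder n w q = (\<lambda>i. if i = n then r else 0)"
  proof (cases "r * (r - q n) = 0")
    case False
    then show ?thesis unfolding householder_def a b by (auto simp: fun_eq_iff w_def)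
  next
    \<comment> \<open>Here \<open>q\<close> already lies on the nonnegative last axis, so
      \<open>w\<close> vanishes and the reflection leaves \<open>q\<close> fixed.\<close>
    case True
    then have "(\<Sum>j\<le>n. (w j)\<^sup>2) = 0" using b by simp
    then have w0: "w j = 0" if "j \<le> n" for j using that by (simp add: sum_nonneg_eq_0_iff)
    have "householder n w q = q" unfolding householder_def a True by simp
    moreover have "q i = (if i = n then r else 0)" for i
      using w0[of i] n[of i] by (cases "i \<le> n") (auto simp: w_def split: if_splits)
    ultimately show ?thesis by auto
  qed
  then show ?thesis unfolding r_def by (rule that[of w]) (auto simp: w_def n)
qed

lemma normalize_householder:
  assumes "\<And>i. i > n \<Longrightarrow> w i = 0"
  shows "normalize_upto n (householder n w y) = householder n w (normalize_upto n y)"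
proof
  fix i
  define s where "s = sqrt (\<Sum>j\<le>n. (y j)\<^sup>2)"
  have "(\<Sum>j\<le>n. normalize_upto n y j * w j) = (\<Sum>j\<le>n. y j * w j) / s"
    unfolding sum_divide_distrib by (intro sum.cong) (auto simp: normalize_upto_def s_def)
  then show "normalize_upto n (householder n w y) i = householder n w (normalize_upto n y) i"
    unfolding normalize_upto_def[of n "householder n w y"] householder_norm s_def[symmetric]
    using assms[of i]
    by (auto simp: householder_def normalize_upto_def s_def[symmetric] diff_divide_distrib)
qed

text \<open>A reflection is an involution, so its degree has square 1 and is odd; composing with it
  preserves parity.\<close>

lemma sphere_degree_householder:
  assumes f: "odd_map n f" and w: "\<And>i. i > n \<Longrightarrow> w i = 0"
  shows "even (sphere_degree n (\<lambda>x. householder n w (f x))) \<longleftrightarrow> even (sphere_degree n f)"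
proof -
  have hc: "continuous_map (nsphere n) (nsphere n) (householder n w)"
    unfolding nsphere_top_of_set
  proof (simp, intro conjI continuous_on_coordinatewise_then_product Pi_I)
    fix i show "continuous_on (unit_sphere n) (\<lambda>x. householder n w x i)"
      unfolding householder_def divide_inverse by (intro continuous_intros)
  next
    fix x assume "x \<in> unit_sphere n"
    then show "householder n w x \<in> unit_sphere n"
      using w by (simp add: unit_sphere_def householder_norm) (simp add: householder_def)
  qed
  have "Brouwer_degree2 n (householder n w) * Brouwer_degree2 n (householder n w) = Brouwer_degree2 n (householder n w \<circ> householder n w)"
    by (rule Brouwer_degree2_compose[OF hc hc, symmetric])
  also have "\<dots> = Brouwer_degree2 n id"
    by (rule Brouwer_degree2_eq) (simp add: householder_involution)
  finally have "odd (Brouwer_degree2 n (householder n w))"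
    by (metis Brouwer_degree2_id even_mult_iff odd_one)
  moreover have "sphere_degree n (\<lambda>x. householder n w (f x)) = Brouwer_degree2 n (householder n w) * sphere_degree n f"
    unfolding sphere_degree_def
    by (subst Brouwer_degree2_compose[OF odd_map_continuous[OF f] hc, symmetric])
      (simp add: o_def normalize_householder[OF w])
  ultimately show ?thesis by simp
qed

text \<open>In the induction step, \<open>P\<close> is a Lipschitz map homotopic to
  \<open>f\<close>, and \<open>G\<close> is \<open>P\<close> followed by a reflection chosen so that
  the image of the equator avoids the last axis. The parity then descends from \<open>G\<close> on
  the sphere to \<open>G\<close> on the equator.\<close>

theorem odd_map_odd_degree:
  assumes "odd_map n f" shows "odd (sphere_degree n f)"
  using assms
proof (induction n arbitrary: f)
  case 0
  define e :: "nat \<Rightarrow> real" where "e = (\<lambda>i. if i = 0 then 1 else 0)"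
  \<comment> \<open>The sphere of dimension 0 has two points, so oddness leaves only the identity
    and the reflection, of degree 1 and -1.\<close>
  have S0: "x = e \<or> x = (\<lambda>i. - e i)" if "x \<in> unit_sphere 0" for x
  proof -
    have "(x 0)\<^sup>2 = 1" "\<And>i. i > 0 \<Longrightarrow> x i = 0" using that by (auto simp: unit_sphere_def)
    then show ?thesis by (auto simp: e_def fun_eq_iff power2_eq_1_iff)
  qed
  have e: "e \<in> unit_sphere 0" "(\<lambda>i. - e i) \<in> unit_sphere 0" by (auto simp: e_def unit_sphere_def)
  define s where "s = sgn (f e 0)"
  have "f e 0 \<noteq> 0" using 0 e(1) by (auto simp: odd_map_def)
  then have s: "s = 1 \<or> s = -1" by (auto simp: s_def sgn_if)
  have *: "normalize_upto 0 (f x) = (\<lambda>i. s * x i)" if "x \<in> unit_sphere 0" for x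
  proof -
    have "f (\<lambda>i. - e i) 0 = - f e 0" using 0 e(1) by (simp add: odd_map_def)
    moreover have "f e 0 / \<bar>f e 0\<bar> = s" by (simp add: s_def sgn_if)
    ultimately have "f x 0 / \<bar>f x 0\<bar> = s * x 0"
      using S0[OF that] by (elim disjE) (simp_all add: e_def)
    then show ?thesis using that by (auto simp: normalize_upto_def fun_eq_iff unit_sphere_def)
  qed
  show ?case
  proof (cases "s = 1")
    case True
    have "sphere_degree 0 f = Brouwer_degree2 0 id"
      unfolding sphere_degree_def
      by (rule Brouwer_degree2_eq) (simp add: topspace_nsphere_unit_sphere * True)
    then show ?thesis by simp
  next
    case False
    have "sphere_degree 0 f = Brouwer_degree2 0 (\<lambda>x i. if i = 0 then - x i else x i)"
      unfolding sphere_degree_def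
      by (rule Brouwer_degree2_eq)
        (use s False in \<open>auto simp: topspace_nsphere_unit_sphere * fun_eq_iff unit_sphere_def\<close>)
    then show ?thesis by (simp add: Brouwer_degree2_reflection)
  qed
next
  case (Suc n)
  note f = Suc.prems
  have fc: "\<And>i. i \<le> Suc n \<Longrightarrow> continuous_on (unit_sphere (Suc n)) (\<lambda>x. f x i)"
    and fo: "\<And>x i. x \<in> unit_sphere (Suc n) \<Longrightarrow> i \<le> Suc n \<Longrightarrow> f (\<lambda>j. - x j) i = - f x i"
    and fnz: "\<And>x. x \<in> unit_sphere (Suc n) \<Longrightarrow> (\<Sum>i\<le>Suc n. (f x i)\<^sup>2) \<noteq> 0"
    using f unfolding odd_map_def by blast+
  have sub: "unit_sphere n \<subseteq> unit_sphere (Suc n)" using unit_sphere_Suc by blast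
  \<comment> \<open>A quantitative form of nonvanishing: an approximation within c/2 in every
    coordinate is joined to \<open>f\<close> by segments that avoid the origin.\<close>
  obtain c where c: "c > 0" "\<And>x. x \<in> unit_sphere (Suc n) \<Longrightarrow> \<exists>i\<le>Suc n. \<bar>f x i\<bar> \<ge> c"
  proof -
    have "continuous_on (unit_sphere (Suc n)) (\<lambda>x. \<Sum>i\<le>Suc n. \<bar>f x i\<bar>)"
      by (intro continuous_intros fc) auto
    moreover have "unit_sphere (Suc n) \<noteq> {}"
      using in_topspace_nsphere[of "Suc n"] by (auto simp: topspace_nsphere_unit_sphere)
    ultimately obtain x0 where x0: "x0 \<in> unit_sphere (Suc n)"
      "\<And>x. x \<in> unit_sphere (Suc n) \<Longrightarrow> (\<Sum>i\<le>Suc n. \<bar>f x0 i\<bar>) \<le> (\<Sum>i\<le>Suc n. \<bar>f x i\<bar>)"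
      using continuous_attains_inf[OF compact_unit_sphere] by metis
    \<comment> \<open>The divisor exceeds the number n + 2 of summands, so some coordinate must
      reach \<open>c\<close>.\<close>
    define c where "c = (\<Sum>i\<le>Suc n. \<bar>f x0 i\<bar>) / (n + 3)"
    have "(\<Sum>i\<le>Suc n. \<bar>f x0 i\<bar>) \<noteq> 0"
      using fnz[OF x0(1)] by (subst sum_nonneg_eq_0_iff) (auto simp del: sum.atMost_Suc simp: sum_nonneg_eq_0_iff)
    then have "(\<Sum>i\<le>Suc n. \<bar>f x0 i\<bar>) > 0"
      by (simp add: order_less_le sum_nonneg del: sum.atMost_Suc)
    then have "c > 0" by (simp add: c_def del: sum.atMost_Suc)
    moreover have "\<exists>i\<le>Suc n. \<bar>f x i\<bar> \<ge> c" if "x \<in> unit_sphere (Suc n)" for x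
    proof (rule ccontr)
      assume "\<not> ?thesis"
      then have "(\<Sum>i\<le>Suc n. \<bar>f x i\<bar>) \<le> (\<Sum>i\<le>Suc n. c)" by (intro sum_mono) force
      also have "\<dots> < (n + 3) * c" using \<open>c > 0\<close> by (simp add: algebra_simps)
      also have "\<dots> = (\<Sum>i\<le>Suc n. \<bar>f x0 i\<bar>)" by (simp add: c_def del: sum.atMost_Suc)
      finally show False using x0(2)[OF that] by linarith
    qed
    ultimately show ?thesis by (rule that)
  qed
  have "\<exists>p. continuous_on (unit_sphere (Suc n)) p \<and> lipschitz_unit_sphere (Suc n) p \<and>
      (\<forall>x. p (\<lambda>j. - x j) = - p x) \<and> (\<forall>x \<in> unit_sphere (Suc n). \<bar>f x i - p x\<bar> < c / 2)" if "i \<le> Suc n" for i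
    using odd_lipschitz_approximation[OF fc[OF that] fo[OF _ that], of "c / 2"] c(1) by (metis half_gt_zero)
  then obtain p where pc: "\<And>i. i \<le> Suc n \<Longrightarrow> continuous_on (unit_sphere (Suc n)) (p i)"
    and pl: "\<And>i. i \<le> Suc n \<Longrightarrow> lipschitz_unit_sphere (Suc n) (p i)"
    and po: "\<And>i x. i \<le> Suc n \<Longrightarrow> p i (\<lambda>j. - x j) = - p i x"
    and pe: "\<And>i x. i \<le> Suc n \<Longrightarrow> x \<in> unit_sphere (Suc n) \<Longrightarrow> \<bar>f x i - p i x\<bar> < c / 2"
    by metis
  have hnz: "\<exists>i\<le>Suc n. \<bar>(1 - t) * f x i + t * p i x\<bar> \<ge> c / 2" if "t \<in> {0..1}" "x \<in> unit_sphere (Suc n)" for t x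
  proof -
    from c(2)[OF that(2)] obtain i where i: "i \<le> Suc n" "\<bar>f x i\<bar> \<ge> c" by blast
    have "t * \<bar>f x i - p i x\<bar> \<le> 1 * (c / 2)"
      using pe[OF i(1) that(2)] that(1) by (intro mult_mono) auto
    moreover have "(1 - t) * f x i + t * p i x = f x i - t * (f x i - p i x)" by (simp add: algebra_simps)
    moreover have "\<bar>t * (f x i - p i x)\<bar> = t * \<bar>f x i - p i x\<bar>" using that(1) by (simp add: abs_mult)
    ultimately have "c / 2 \<le> \<bar>(1 - t) * f x i + t * p i x\<bar>" using i(2) by linarith
    then show ?thesis using i(1) by blast
  qed
  have nzI: "(\<Sum>i\<le>Suc n. (y i)\<^sup>2) \<noteq> 0" if "\<exists>i\<le>Suc n. \<bar>y i\<bar> \<ge> c / 2" for y :: "nat \<Rightarrow> real"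
  proof -
    from that obtain i where "i \<le> Suc n" "y i \<noteq> 0" using c(1) by fastforce
    then show ?thesis by (subst sum_nonneg_eq_0_iff) auto
  qed
  define P where "P = (\<lambda>x i. p i x)"
  define H where "H = (\<lambda>t x i. (1 - t) * f x i + t * p i x)"
  have "sphere_degree (Suc n) (H 0) = sphere_degree (Suc n) (H 1)"
  proof (rule sphere_degree_homotopic)
    fix i assume i: "i \<le> Suc n"
    have "continuous_on ({0..1} \<times> unit_sphere (Suc n)) (\<lambda>q :: real \<times> (nat \<Rightarrow> real). f (snd q) i)"
      by (rule continuous_on_compose2[OF fc[OF i] continuous_on_snd[OF continuous_on_id]]) auto
    moreover have "continuous_on ({0..1} \<times> unit_sphere (Suc n)) (\<lambda>q :: real \<times> (nat \<Rightarrow> real). p i (snd q))"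
      by (rule continuous_on_compose2[OF pc[OF i] continuous_on_snd[OF continuous_on_id]]) auto
    ultimately show "continuous_on ({0..1} \<times> unit_sphere (Suc n)) (\<lambda>(t, x). H t x i)"
      unfolding H_def case_prod_unfold by (intro continuous_intros)
  next
    fix t :: real and x :: "nat \<Rightarrow> real" assume "t \<in> {0..1}" "x \<in> unit_sphere (Suc n)"
    then show "(\<Sum>i\<le>Suc n. (H t x i)\<^sup>2) \<noteq> 0" unfolding H_def by (intro nzI hnz)
  qed
  then have fP: "sphere_degree (Suc n) f = sphere_degree (Suc n) P" by (simp add: P_def H_def)
  have Pc: "\<exists>i\<le>Suc n. \<bar>P x i\<bar> \<ge> c / 2" if "x \<in> unit_sphere (Suc n)" for x
    using hnz[of 1 x] that by (simp add: P_def)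
  have oddP: "odd_map (Suc n) P"
    unfolding odd_map_def
  proof (intro conjI allI impI ballI)
    show "continuous_on (unit_sphere (Suc n)) (\<lambda>x. P x i)" if "i \<le> Suc n" for i
      using pc[OF that] by (simp add: P_def)
    show "P (\<lambda>j. - x j) i = - P x i" if "i \<le> Suc n" for x i using po[OF that] by (simp add: P_def)
    show "(\<Sum>i\<le>Suc n. (P x i)\<^sup>2) \<noteq> 0" if "x \<in> unit_sphere (Suc n)" for x by (rule nzI[OF Pc[OF that]])
  qed
  have lipP: "lipschitz_unit_sphere n (\<lambda>x. P x i)" if i: "i \<le> Suc n" for i
  proof -
    obtain L where L: "L \<ge> 0" "\<And>x y. x \<in> unit_sphere (Suc n) \<Longrightarrow> y \<in> unit_sphere (Suc n) \<Longrightarrow> \<bar>p i x - p i y\<bar> \<le> L * (\<Sum>i\<le>Suc n. \<bar>x i - y i\<bar>)"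
      using lipschitz_unit_sphere_nonneg[OF pl[OF i]] by metis
    have "\<bar>P x i - P y i\<bar> \<le> L * (\<Sum>i\<le>n. \<bar>x i - y i\<bar>)" if "x \<in> unit_sphere n" "y \<in> unit_sphere n" for x y
      using L(2)[of x y] that sub by (auto simp: P_def unit_sphere_def)
    then show ?thesis unfolding lipschitz_unit_sphere_def by blast
  qed
  \<comment> \<open>The cone over the image of the equator misses \<open>q\<close>, and by oddness
    of \<open>P\<close> it misses the antipode of \<open>q\<close> too.\<close>
  obtain q where q: "\<And>t x. t \<ge> 0 \<Longrightarrow> x \<in> unit_sphere n \<Longrightarrow> \<exists>i\<le>Suc n. q i \<noteq> t * P x i"
  proof (rule lipschitz_cone_not_surjective[of n P "c / 2"])
    show "continuous_on (unit_sphere n) (\<lambda>x. P x i)" if "i \<le> Suc n" for i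
      using continuous_on_subset[OF pc[OF that] sub] by (simp add: P_def[abs_def])
    show "lipschitz_unit_sphere n (\<lambda>x. P x i)" if "i \<le> Suc n" for i by (rule lipP[OF that])
    show "c / 2 > 0" using c(1) by simp
    show "\<exists>i\<le>Suc n. c / 2 \<le> \<bar>P x i\<bar>" if "x \<in> unit_sphere n" for x using Pc sub that by blast
  qed blast
  define q' where "q' = (\<lambda>i. if i \<le> Suc n then q i else 0)"
  obtain w where w: "householder (Suc n) w q' = (\<lambda>i. if i = Suc n then sqrt (\<Sum>j\<le>Suc n. (q' j)\<^sup>2) else 0)"
    "\<And>i. i > Suc n \<Longrightarrow> w i = 0"
    using householder_to_axis[of "Suc n" q'] by (auto simp: q'_def)
  define r where "r = sqrt (\<Sum>j\<le>Suc n. (q' j)\<^sup>2)"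
  define G where "G = (\<lambda>x. householder (Suc n) w (P x))"
  have Po: "P (\<lambda>j. - x j) i = - P x i" if "i \<le> Suc n" for x i using po[OF that] by (simp add: P_def)
  have Godd: "G (\<lambda>j. - x j) i = - G x i" if "i \<le> Suc n" for x i
  proof -
    have "(\<Sum>j\<le>Suc n. P (\<lambda>j. - x j) j * w j) = - (\<Sum>j\<le>Suc n. P x j * w j)"
      unfolding sum_negf[symmetric] by (intro sum.cong) (auto simp: Po)
    then show ?thesis using that unfolding G_def householder_def by (simp add: Po del: sum.atMost_Suc)
  qed
  have Pcont: "continuous_on (unit_sphere (Suc n)) (\<lambda>x. P x i)" if "i \<le> Suc n" for i
    using pc[OF that] by (simp add: P_def)
  have Gc: "continuous_on (unit_sphere (Suc n)) (\<lambda>x. G x i)" if "i \<le> Suc n" for i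
    unfolding G_def householder_def divide_inverse using that
    by (intro continuous_on_diff continuous_on_mult continuous_on_sum continuous_on_const Pcont) auto
  have oddG: "odd_map (Suc n) G"
    unfolding odd_map_def
  proof (intro conjI allI impI ballI)
    show "(\<Sum>i\<le>Suc n. (G x i)\<^sup>2) \<noteq> 0" if "x \<in> unit_sphere (Suc n)" for x
      unfolding G_def householder_norm by (rule nzI[OF Pc[OF that]])
  qed (use Gc Godd in blast)+
  have "odd_map n G"
    unfolding odd_map_def
  proof (intro conjI allI impI ballI)
    show "continuous_on (unit_sphere n) (\<lambda>x. G x i)" if "i \<le> n" for i
      using continuous_on_subset[OF Gc sub] that by simp
    show "G (\<lambda>j. - x j) i = - G x i" if "i \<le> n" for x i using Godd that by simp
  next
    fix x assume x: "x \<in> unit_sphere n"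
    show "(\<Sum>i\<le>n. (G x i)\<^sup>2) \<noteq> 0"
    proof
      assume "(\<Sum>i\<le>n. (G x i)\<^sup>2) = 0"
      then have G0: "G x i = 0" if "i \<le> n" for i using that by (simp add: sum_nonneg_eq_0_iff)
      have sc: "householder (Suc n) w (\<lambda>i. a * z i) i = a * householder (Suc n) w z i" for a z i
        unfolding householder_def by (simp add: sum_distrib_left right_diff_distrib mult.assoc mult.left_commute del: sum.atMost_Suc)
      define s where "s = G x (Suc n)"
      have "(\<Sum>i\<le>Suc n. (G x i)\<^sup>2) \<noteq> 0" using oddG x sub by (auto simp: odd_map_def)
      then have s: "s \<noteq> 0" using G0 by (auto simp: s_def)
      \<comment> \<open>\<open>G x\<close> and the reflection of \<open>q'\<close> both lie on the
        last axis, so undoing the reflection makes \<open>P x\<close> parallel to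
        \<open>q'\<close>.\<close>
      have "r * P x i = s * q' i" if "i \<le> Suc n" for i
      proof -
        define z where "z = (\<lambda>i. if i \<le> Suc n then P x i else 0)"
        have "householder (Suc n) w z = (\<lambda>i. if i = Suc n then s else 0)"
        proof
          fix i
          have "householder (Suc n) w z i = G x i" if "i \<le> Suc n"
            using that unfolding G_def householder_def z_def by simp
          then show "householder (Suc n) w z i = (if i = Suc n then s else 0)"
            using G0[of i] w(2)[of i] by (auto simp: s_def le_Suc_eq householder_def z_def not_less_eq)
        qed
        then have "(\<lambda>i. r * householder (Suc n) w z i) = (\<lambda>i. s * householder (Suc n) w q' i)"
          unfolding w(1) r_def[symmetric] by (auto simp: fun_eq_iff)
        then have "householder (Suc n) w (\<lambda>i. r * z i) = householder (Suc n) w (\<lambda>i. s * q' i)"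
          by (simp add: sc fun_eq_iff)
        then have "(\<lambda>i. r * z i) = (\<lambda>i. s * q' i)" by (metis householder_involution)
        then show ?thesis using that by (auto simp: z_def fun_eq_iff split: if_splits)
      qed
      then have eq: "q i = (r / s) * P x i" if "i \<le> Suc n" for i
        using that s by (simp add: q'_def field_simps)
      show False
      \<comment> \<open>The cone only contains nonnegative multiples; a negative factor is absorbed
        by passing to the antipode of \<open>x\<close>.\<close>
      proof (cases "r / s \<ge> 0")
        case True then show False using q[OF True x] eq by auto
      next
        case False
        then have "- (r / s) \<ge> 0" by simp
        from q[OF this unit_sphere_minus[OF x]] obtain i where "i \<le> Suc n" "q i \<noteq> - (r / s) * P (\<lambda>i. - x i) i" by blast
        then show False using eq[of i] by (simp add: P_def po)
      qed
    qed
  qed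
  then have "odd (sphere_degree n G)" by (rule Suc.IH)
  with sphere_degree_step[OF oddG \<open>odd_map n G\<close>] have "odd (sphere_degree (Suc n) G)" by simp
  then show ?case
    using sphere_degree_householder[OF oddP, of w] w(2) by (simp add: fP G_def)
qed

text \<open>Without a common zero, appending a last coordinate 0 would give an odd map of the sphere
  whose image stays in the equator. It would miss the pole and so have degree 0, which is
  even.\<close>

theorem Borsuk_Ulam_coordinates:
  fixes f :: "(nat \<Rightarrow> real) \<Rightarrow> nat \<Rightarrow> real"
  assumes cont: "\<And>i. i < n \<Longrightarrow> continuous_on (unit_sphere n) (\<lambda>x. f x i)"
    and odd: "\<And>x i. x \<in> unit_sphere n \<Longrightarrow> i < n \<Longrightarrow> f (\<lambda>j. - x j) i = - f x i"
  obtains x where "x \<in> unit_sphere n" "\<And>i. i < n \<Longrightarrow> f x i = 0"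
proof (rule ccontr)
  assume "\<not> thesis"
  with that have nz: "\<exists>i<n. f x i \<noteq> 0" if "x \<in> unit_sphere n" for x using \<open>x \<in> unit_sphere n\<close> by blast
  define g where "g = (\<lambda>x i. if i < n then f x i else 0)"
  have "odd_map n g"
    unfolding odd_map_def
  proof (intro conjI allI impI ballI)
    fix x assume "x \<in> unit_sphere n"
    then obtain i where "i < n" "f x i \<noteq> 0" using nz by blast
    then show "(\<Sum>i\<le>n. (g x i)\<^sup>2) \<noteq> 0"
      by (subst sum_nonneg_eq_0_iff) (auto simp: g_def intro!: bexI[of _ i])
  next
    fix i show "continuous_on (unit_sphere n) (\<lambda>x. g x i)"
      using cont by (cases "i < n") (auto simp: g_def)
  qed (use odd in \<open>auto simp: g_def\<close>)
  then have "odd (sphere_degree n g)" by (rule odd_map_odd_degree)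
  moreover have "sphere_degree n g = 0"
    unfolding sphere_degree_def
  proof (rule Brouwer_degree2_nonsurjective[OF odd_map_continuous[OF \<open>odd_map n g\<close>]])
    define e :: "nat \<Rightarrow> real" where "e = (\<lambda>i. if i = n then 1 else 0)"
    have "e \<in> unit_sphere n" by (auto simp: unit_sphere_def e_def if_distrib[of "\<lambda>x. x\<^sup>2"] cong: if_cong)
    moreover have "e \<notin> (\<lambda>x. normalize_upto n (g x)) ` unit_sphere n"
      by (auto simp: e_def normalize_upto_def g_def fun_eq_iff dest!: spec[of _ n])
    ultimately show "(\<lambda>x. normalize_upto n (g x)) ` topspace (nsphere n) \<noteq> topspace (nsphere n)"
      by (auto simp: topspace_nsphere_unit_sphere)
  qed
  ultimately show False by simp
qed

section \<open>Borsuk-Ulam for vector-valued coordinates\<close>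

definition block_sphere :: "nat set \<Rightarrow> (nat \<Rightarrow> 'a::euclidean_space) set" where
  "block_sphere P = {u. (\<Sum>i\<in>P. (norm (u i))\<^sup>2) = 1 \<and> (\<forall>i. i \<notin> P \<longrightarrow> u i = 0)}"

lemma norm_sum_Basis:
  "(norm (\<Sum>b\<in>Basis. c b *\<^sub>R b :: 'a::euclidean_space))\<^sup>2 = (\<Sum>b\<in>Basis. (c b)\<^sup>2)"
  by (simp add: norm_eq_sqrt_inner, subst euclidean_inner)
    (simp add: inner_sum_left_Basis sum_nonneg flip: power2_eq_square)

text \<open>Blocks are flattened along \<open>P \<times> Basis\<close>. Strict inclusion of
  \<open>Q\<close> leaves fewer scalar equations than coordinates, and the list of equations is
  padded with zeros.\<close>

theorem Borsuk_Ulam_blocks: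
  fixes f :: "(nat \<Rightarrow> 'a::euclidean_space) \<Rightarrow> nat \<Rightarrow> 'a"
  assumes P: "finite P" and QP: "Q \<subset> P"
    and cont: "\<And>i. i \<in> Q \<Longrightarrow> continuous_on (block_sphere P) (\<lambda>u. f u i)"
    and odd: "\<And>u i. u \<in> block_sphere P \<Longrightarrow> i \<in> Q \<Longrightarrow> f (\<lambda>j. - u j) i = - f u i"
  obtains u where "u \<in> block_sphere P" "\<And>i. i \<in> Q \<Longrightarrow> f u i = 0"
proof -
  define A where "A = P \<times> (Basis :: 'a set)"
  define B where "B = Q \<times> (Basis :: 'a set)"
  define n where "n = card A - 1"
  have finA: "finite A" "finite B" using P QP by (auto simp: A_def B_def finite_subset)
  have ne: "(Basis :: 'a set) \<noteq> {}" by simp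
  have "B \<subset> A"
  proof
    show "B \<subseteq> A" using QP by (auto simp: A_def B_def)
    obtain j b where "j \<in> P" "j \<notin> Q" "b \<in> (Basis :: 'a set)" using QP ne by blast
    then show "B \<noteq> A" by (auto simp: A_def B_def)
  qed
  then have cB: "card B < card A" using finA psubset_card_mono by blast
  then have cA: "card A = Suc n" by (simp add: n_def)
  obtain e0 where "bij_betw e0 A {0..<card A}" using ex_bij_betw_finite_nat[OF finA(1)] by blast
  then have e: "bij_betw e0 A {..n}" by (simp add: cA atLeast0LessThan lessThan_Suc_atMost)
  obtain d where d: "bij_betw d {0..<card B} B" using ex_bij_betw_nat_finite[OF finA(2)] by blast
  define E where "E = (\<lambda>(x :: nat \<Rightarrow> real) j. if j \<in> P then \<Sum>b\<in>Basis. x (e0 (j, b)) *\<^sub>R b else (0::'a))"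
  have E_in: "E x \<in> block_sphere P" if x: "x \<in> unit_sphere n" for x
  proof -
    have "(\<Sum>j\<in>P. (norm (E x j))\<^sup>2) = (\<Sum>j\<in>P. \<Sum>b\<in>Basis. (x (e0 (j, b)))\<^sup>2)"
      by (intro sum.cong refl)
        (simp add: E_def norm_sum_Basis)
    also have "\<dots> = (\<Sum>p\<in>A. (x (e0 p))\<^sup>2)" by (simp add: A_def sum.cartesian_product split_def)
    also have "\<dots> = (\<Sum>i\<le>n. (x i)\<^sup>2)" by (rule sum.reindex_bij_betw[OF e])
    also have "\<dots> = 1" using x by (simp add: unit_sphere_def)
    finally show ?thesis by (simp add: block_sphere_def E_def)
  qed
  have Em: "E (\<lambda>j. - x j) = (\<lambda>j. - E x j)" for x by (auto simp: E_def sum_negf fun_eq_iff)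
  have Ec: "continuous_on S E" for S
  proof (rule continuous_on_coordinatewise_then_product)
    fix j show "continuous_on S (\<lambda>x. E x j)"
      unfolding E_def
      by (cases "j \<in> P") (auto intro!: continuous_on_sum continuous_on_scaleR continuous_on_eval)
  qed
  define g where "g = (\<lambda>x i. if i < card B then f (E x) (fst (d i)) \<bullet> snd (d i) else 0)"
  have dB: "fst (d i) \<in> Q" "snd (d i) \<in> Basis" if "i < card B" for i
    using bij_betwE[OF d] that by (auto simp: B_def mem_Times_iff)
  obtain x where x: "x \<in> unit_sphere n" "\<And>i. i < n \<Longrightarrow> g x i = 0"
  proof (rule Borsuk_Ulam_coordinates[of n g])
    fix i assume "i < n"
    show "continuous_on (unit_sphere n) (\<lambda>x. g x i)"
    proof (cases "i < card B")
      case True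
      have "continuous_on (unit_sphere n) (\<lambda>x. f (E x) (fst (d i)))"
        by (rule continuous_on_compose2[OF cont[OF dB(1)[OF True]] Ec]) (use E_in in auto)
      then show ?thesis using True by (simp add: g_def continuous_on_inner)
    qed (simp add: g_def)
  next
    fix x i assume "x \<in> unit_sphere n"
    then show "g (\<lambda>j. - x j) i = - g x i" using odd[OF E_in] dB by (simp add: g_def Em)
  qed blast
  have "f (E x) j = 0" if j: "j \<in> Q" for j
  proof (rule euclidean_eqI)
    fix b :: 'a assume b: "b \<in> Basis"
    have "(j, b) \<in> B" using j b by (simp add: B_def)
    then obtain i where i: "i < card B" "d i = (j, b)" using d by (force simp: bij_betw_def image_iff)
    have "i < n \<or> i = n" using i cB cA by linarith
    then have "g x i = 0" using x(2) i cB cA by auto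
    then show "f (E x) j \<bullet> b = 0 \<bullet> b" using i by (simp add: g_def)
  qed
  with E_in[OF x(1)] show ?thesis by (rule that)
qed

subsection \<open>A minimax principle for even functions\<close>

text \<open>Vectors of length \<open>M\<close> are encoded as sequences in one fixed type because
  the dimension varies with the mesh.\<close>

definition finite_seqs :: "nat \<Rightarrow> (nat \<Rightarrow> 'a::zero) set" where
  "finite_seqs M = {u. \<forall>i\<ge>M. u i = 0}"

lemma closed_finite_seqs: "closed (finite_seqs M :: (nat \<Rightarrow> 'a::{zero,t2_space}) set)"
  unfolding finite_seqs_def
  by (intro closed_Collect_all closed_Collect_imp closed_Collect_eq continuous_on_eval continuous_on_const) auto

lemma compact_finite_seqs:
  fixes K :: "(nat \<Rightarrow> 'a::euclidean_space) set"
  assumes "closed K" "K \<subseteq> finite_seqs M" and R: "\<And>u i. u \<in> K \<Longrightarrow> i < M \<Longrightarrow> norm (u i) \<le> R"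
  shows "compact K"
proof -
  define B :: "(nat \<Rightarrow> 'a) set" where "B = PiE UNIV (\<lambda>i. cball 0 \<bar>R\<bar>)"
  have "compactin (product_topology (\<lambda>i. euclidean) UNIV) B"
    unfolding B_def by (subst compactin_PiE) auto
  then have "compact B" by (simp add: euclidean_product_topology)
  moreover have "K \<subseteq> B"
  proof
    fix u assume u: "u \<in> K"
    have "norm (u i) \<le> \<bar>R\<bar>" for i
      using R[OF u, of i] u assms(2) by (cases "i < M") (auto simp: finite_seqs_def)
    then show "u \<in> B" by (auto simp: B_def)
  qed
  ultimately show ?thesis using assms(1) by (metis compact_Int_closed inf.absorb_iff2)
qed

text \<open>The level \<open>\<gamma>\<close> is the supremum of the minima of \<open>\<Phi>\<close> over odd images of the sphere. If it
  were regular, a single explicit Euler step along the gradient would raise a nearly optimal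
  image above \<open>\<gamma>\<close>.\<close>

theorem even_functional_critical_point:
  fixes \<Phi> :: "(nat \<Rightarrow> 'a::euclidean_space) \<Rightarrow> real" and G L h :: "(nat \<Rightarrow> 'a) \<Rightarrow> nat \<Rightarrow> 'a"
  assumes contG: "\<And>i. continuous_on UNIV (\<lambda>u. G u i)" and cont\<Phi>: "continuous_on UNIV \<Phi>"
    and G0: "\<And>u i. i \<ge> M \<Longrightarrow> G u i = 0" and Godd: "\<And>u i. G (\<lambda>j. - u j) i = - G u i"
    and deriv: "\<And>u w s. ((\<lambda>s. \<Phi> (\<lambda>i. u i + s *\<^sub>R w i)) has_real_derivative
        (\<Sum>i<M. G (\<lambda>i. u i + s *\<^sub>R w i) i \<bullet> w i)) (at s)"
    and coer: "\<And>c. \<exists>R. \<forall>u\<in>finite_seqs M. \<Phi> u \<ge> c \<longrightarrow> (\<forall>i<M. norm (u i) \<le> R)"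
    and P: "finite P" and QP: "Q \<subset> P"
    and h: "continuous_on (block_sphere P) h" "\<And>x. x \<in> block_sphere P \<Longrightarrow> h (\<lambda>j. - x j) = (\<lambda>j. - h x j)"
      "\<And>x. x \<in> block_sphere P \<Longrightarrow> h x \<in> finite_seqs M" "\<And>x. x \<in> block_sphere P \<Longrightarrow> \<Phi> (h x) \<ge> \<alpha>"
    and L: "\<And>i. i \<in> Q \<Longrightarrow> continuous_on UNIV (\<lambda>u. L u i)" "\<And>u i. i \<in> Q \<Longrightarrow> L (\<lambda>j. - u j) i = - L u i"
    and upper: "\<And>u. u \<in> finite_seqs M \<Longrightarrow> (\<And>i. i \<in> Q \<Longrightarrow> L u i = 0) \<Longrightarrow> \<Phi> u \<le> \<beta>"
  obtains u where "u \<in> finite_seqs M" "\<alpha> \<le> \<Phi> u" "\<Phi> u \<le> \<beta>" "\<And>i. G u i = 0"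
proof -
  define S :: "(nat \<Rightarrow> 'a) set" where "S = block_sphere P"
  define E :: "(nat \<Rightarrow> 'a) set" where "E = finite_seqs M"
  define adm where "adm = (\<lambda>f :: (nat \<Rightarrow> 'a) \<Rightarrow> nat \<Rightarrow> 'a. continuous_on S f \<and> (\<forall>x\<in>S. f (\<lambda>j. - x j) = (\<lambda>j. - f x j)) \<and> f ` S \<subseteq> E)"
  define C where "C = {c. \<exists>f. adm f \<and> (\<forall>x\<in>S. \<Phi> (f x) \<ge> c)}"
  have "\<alpha> \<in> C" using h unfolding C_def adm_def S_def E_def by blast
  have C_le: "c \<le> \<beta>" if c: "c \<in> C" for c
  proof -
    obtain f where f: "adm f" "\<And>x. x \<in> S \<Longrightarrow> \<Phi> (f x) \<ge> c" using c by (auto simp: C_def)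
    obtain x where x: "x \<in> block_sphere P" "\<And>i. i \<in> Q \<Longrightarrow> L (f x) i = 0"
    proof (rule Borsuk_Ulam_blocks[OF P QP, of "\<lambda>x. L (f x)"])
      show "continuous_on (block_sphere P) (\<lambda>u. L (f u) i)" if "i \<in> Q" for i
        using f(1) by (intro continuous_on_compose2[OF L(1)[OF that]]) (auto simp: adm_def S_def)
      show "L (f (\<lambda>j. - u j)) i = - L (f u) i" if "u \<in> block_sphere P" "i \<in> Q" for u i
        using f(1) that L(2) by (simp add: adm_def S_def)
    qed blast
    then have "\<Phi> (f x) \<le> \<beta>" using f(1) by (intro upper) (auto simp: adm_def S_def E_def)
    then show ?thesis using f(2)[of x] x(1) by (simp add: S_def)
  qed
  define \<gamma> where "\<gamma> = Sup C"
  have bdd: "bdd_above C" using C_le by (rule bdd_aboveI)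
  have \<gamma>: "\<alpha> \<le> \<gamma>" "\<gamma> \<le> \<beta>"
    unfolding \<gamma>_def using \<open>\<alpha> \<in> C\<close> C_le bdd by (auto intro: cSup_upper cSup_least)
  have "\<exists>u\<in>E. \<Phi> u = \<gamma> \<and> (\<forall>i. G u i = 0)"
  proof (rule ccontr)
    assume nocrit: "\<not> ?thesis"
    define g2 where "g2 = (\<lambda>u. \<Sum>i<M. G u i \<bullet> G u i)"
    have g2_pos: "g2 u > 0" if u: "u \<in> E" "\<Phi> u = \<gamma>" for u
    proof -
      obtain i where i: "G u i \<noteq> 0" using nocrit u by blast
      then have "i < M" using G0 by (meson not_le)
      then show ?thesis unfolding g2_def using i by (intro sum_pos2[of _ i]) auto
    qed
    have cg2: "continuous_on A g2" for A
      unfolding g2_def by (intro continuous_on_sum continuous_on_inner continuous_on_subset[OF contG]) auto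
    have c\<Phi>: "continuous_on A \<Phi>" for A using cont\<Phi> by (rule continuous_on_subset) simp
    \<comment> \<open>Compactness of this superlevel set, a consequence of coercivity, takes the
      place of a Palais-Smale condition.\<close>
    define K where "K = {u \<in> E. \<Phi> u \<ge> \<gamma> - 1}"
    have closedK: "closed K"
      unfolding K_def Collect_conj_eq E_def using closed_finite_seqs
      by (intro closed_Int closed_Collect_le c\<Phi> continuous_on_const) simp
    have "compact K"
    proof -
      obtain R where "\<forall>u\<in>finite_seqs M. \<Phi> u \<ge> \<gamma> - 1 \<longrightarrow> (\<forall>i<M. norm (u i) \<le> R)" using coer by blast
      then show ?thesis using closedK by (intro compact_finite_seqs[of K M R]) (auto simp: K_def E_def)
    qed
    \<comment> \<open>The maximum of |\<Phi> - \<gamma>| and the squared gradient vanishes only at a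
      critical point of level \<gamma>, so on the compact set \<open>K\<close> it has a positive
      minimum.\<close>
    obtain e where e: "e > 0" "e \<le> 1" and e2: "\<And>u. u \<in> E \<Longrightarrow> \<bar>\<Phi> u - \<gamma>\<bar> \<le> e \<Longrightarrow> g2 u \<ge> e"
    proof (cases "K = {}")
      case True
      then have False if "u \<in> E" "\<bar>\<Phi> u - \<gamma>\<bar> \<le> 1" for u using that unfolding K_def by force
      then show ?thesis using that[of 1] by force
    next
      case False
      have "continuous_on K (\<lambda>u. max \<bar>\<Phi> u - \<gamma>\<bar> (g2 u))"
        by (intro continuous_on_max continuous_on_rabs continuous_on_diff c\<Phi> cg2 continuous_on_const)
      from continuous_attains_inf[OF \<open>compact K\<close> False this]
      obtain v where v: "v \<in> K" "\<And>u. u \<in> K \<Longrightarrow> max \<bar>\<Phi> v - \<gamma>\<bar> (g2 v) \<le> max \<bar>\<Phi> u - \<gamma>\<bar> (g2 u)" by blast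
      define m where "m = max \<bar>\<Phi> v - \<gamma>\<bar> (g2 v)"
      have "m > 0" using g2_pos[of v] v(1) unfolding m_def K_def by (cases "\<Phi> v = \<gamma>") auto
      show ?thesis
      proof (rule that[of "min (m / 2) 1"])
        fix u assume u: "u \<in> E" "\<bar>\<Phi> u - \<gamma>\<bar> \<le> min (m / 2) 1"
        then have "u \<in> K" by (auto simp: K_def)
        then have "m \<le> max \<bar>\<Phi> u - \<gamma>\<bar> (g2 u)" using v(2) by (simp add: m_def)
        then show "min (m / 2) 1 \<le> g2 u" using u(2) \<open>m > 0\<close> by (auto simp: max_def split: if_splits)
      qed (use \<open>m > 0\<close> in auto)
    qed
    define step where "step = (\<lambda>s u i. u i + s *\<^sub>R G u i)"
    have cstep: "continuous_on UNIV (\<lambda>p. step (snd p) (fst p))"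
      unfolding step_def
    proof (rule continuous_on_coordinatewise_then_product)
      fix i
      have "continuous_on UNIV (\<lambda>p :: (nat \<Rightarrow> 'a) \<times> real. G (fst p) i)"
        by (rule continuous_on_compose2[OF contG]) (auto intro: continuous_on_fst continuous_on_id)
      moreover have "continuous_on UNIV (\<lambda>p :: (nat \<Rightarrow> 'a) \<times> real. fst p i)"
        by (rule continuous_on_compose2[OF continuous_on_eval[of UNIV]]) (auto intro: continuous_on_fst continuous_on_id)
      ultimately show "continuous_on UNIV (\<lambda>p :: (nat \<Rightarrow> 'a) \<times> real. fst p i + snd p *\<^sub>R G (fst p) i)"
        by (intro continuous_on_add continuous_on_scaleR continuous_on_snd continuous_on_id)
    qed
    \<comment> \<open>The derivative of \<Phi> along the step from the first component, at the time
      given by the second. Its uniform continuity supplies one step length for all points of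
      \<open>K\<close>.\<close>
    define D where "D = (\<lambda>p. \<Sum>i<M. G (step (snd p) (fst p)) i \<bullet> G (fst p) i)"
    have cD: "continuous_on UNIV D"
      unfolding D_def
      by (intro continuous_on_sum continuous_on_inner continuous_on_compose2[OF contG cstep]
          continuous_on_compose2[OF contG continuous_on_fst[OF continuous_on_id]]) auto
    have "compact (K \<times> {0..1::real})" using \<open>compact K\<close> compact_Icc by (rule compact_Times)
    with continuous_on_subset[OF cD subset_UNIV] have "uniformly_continuous_on (K \<times> {0..1}) D"
      by (rule compact_uniformly_continuous)
    then have "\<exists>d>0. \<forall>p\<in>K \<times> {0..1}. \<forall>q\<in>K \<times> {0..1}. dist q p < d \<longrightarrow> dist (D q) (D p) < e / 2"
      unfolding uniformly_continuous_on_def by (elim allE[of _ "e / 2"] impE) (use e(1) in auto)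
    then obtain d where d: "d > 0" "\<And>p q. p \<in> K \<times> {0..1} \<Longrightarrow> q \<in> K \<times> {0..1} \<Longrightarrow> dist q p < d \<Longrightarrow> dist (D q) (D p) < e / 2"
      by blast
    define s where "s = min (d / 2) 1"
    have s: "s > 0" "s \<le> 1" "s < d" using d(1) by (auto simp: s_def)
    have gain: "\<Phi> (step s u) \<ge> \<Phi> u + s * (g2 u - e / 2)" if u: "u \<in> K" for u
    proof -
      have der: "((\<lambda>r. \<Phi> (step r u)) has_real_derivative D (u, r)) (at r)" for r
        using deriv[of u "G u" r] by (simp add: D_def step_def)
      obtain r where r: "r > 0" "r < s" "\<Phi> (step s u) - \<Phi> (step 0 u) = (s - 0) * D (u, r)"
        using MVT2[of 0 s "\<lambda>r. \<Phi> (step r u)" "\<lambda>r. D (u, r)"] der s(1) by auto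
      have "dist (D (u, r)) (D (u, 0)) < e / 2"
        using u r s by (intro d(2)) (auto simp: dist_Pair_Pair)
      moreover have "D (u, 0) = g2 u" by (simp add: D_def g2_def step_def)
      ultimately have "D (u, r) \<ge> g2 u - e / 2" unfolding dist_real_def by linarith
      then have "s * D (u, r) \<ge> s * (g2 u - e / 2)" using s by (intro mult_left_mono) auto
      with r(3) show ?thesis by (simp add: step_def)
    qed
    have se: "s * e \<le> e" using s e by (simp add: mult_left_le_one_le)
    have "s * e > 0" using s e by simp
    \<comment> \<open>Near the level the step gains at least s e / 2, so an image within s e / 4
      below \<gamma> ends at least s e / 4 above it.\<close>
    then have "\<gamma> - s * e / 4 < Sup C" by (simp add: \<gamma>_def)
    then obtain c where c: "c \<in> C" "\<gamma> - s * e / 4 < c" using less_cSupE[of _ C] \<open>\<alpha> \<in> C\<close> by blast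
    then obtain f where f: "adm f" "\<And>x. x \<in> S \<Longrightarrow> \<Phi> (f x) \<ge> c" by (auto simp: C_def)
    have "adm (\<lambda>x. step s (f x))"
      unfolding adm_def
    proof (intro conjI ballI)
      have "continuous_on UNIV (\<lambda>u. step s u)"
        using continuous_on_compose2[OF cstep continuous_on_Pair[OF continuous_on_id continuous_on_const], of s UNIV]
        by simp
      then show "continuous_on S (\<lambda>x. step s (f x))"
        by (rule continuous_on_compose2) (use f(1) in \<open>auto simp: adm_def\<close>)
      show "step s (f (\<lambda>j. - x j)) = (\<lambda>j. - step s (f x) j)" if "x \<in> S" for x
        using f(1) that by (auto simp: adm_def step_def Godd)
      show "(\<lambda>x. step s (f x)) ` S \<subseteq> E"
        using f(1) G0 by (auto simp: adm_def E_def finite_seqs_def step_def image_subset_iff)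
    qed
    moreover have "\<Phi> (step s (f x)) \<ge> \<gamma> + s * e / 4" if x: "x \<in> S" for x
    proof -
      have fx: "f x \<in> E" "\<Phi> (f x) > \<gamma> - s * e / 4"
        using f x c(2) by (auto simp: adm_def) (metis order_less_le_trans)
      moreover from fx(2) have "\<gamma> - 1 \<le> \<Phi> (f x)" using se e by linarith
      ultimately have "f x \<in> K" by (simp add: K_def)
      note gn = gain[OF this]
      show ?thesis
      proof (cases "\<Phi> (f x) \<le> \<gamma> + e")
        case True
        then have "\<bar>\<Phi> (f x) - \<gamma>\<bar> \<le> e" using fx(2) se \<open>s * e > 0\<close> by linarith
        with fx(1) have "g2 (f x) \<ge> e" by (rule e2)
        then have "s * (g2 (f x) - e / 2) \<ge> s * (e / 2)" using s by (intro mult_left_mono) auto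
        then show ?thesis using gn fx(2) by (simp add: field_simps)
      next
        \<comment> \<open>Far above the level the gradient may be small and the step may lose, but
          by at most s e / 2, which the margin \<open>e\<close> covers.\<close>
        case False
        have "g2 (f x) \<ge> 0" by (auto simp: g2_def intro: sum_nonneg)
        then have "s * (g2 (f x) - e / 2) \<ge> s * (- e / 2)" using s by (intro mult_left_mono) auto
        then show ?thesis using gn False se \<open>s * e > 0\<close> by (simp add: field_simps)
      qed
    qed
    ultimately have "\<gamma> + s * e / 4 \<in> C" unfolding C_def by blast
    then have "\<gamma> + s * e / 4 \<le> \<gamma>" unfolding \<gamma>_def using bdd by (rule cSup_upper)
    then show False using \<open>s * e > 0\<close> by simp
  qed
  then show ?thesis using that \<gamma> by (auto simp: E_def)
qed

subsection \<open>The discrete action\<close>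

definition cyc_next :: "nat \<Rightarrow> nat \<Rightarrow> nat" where "cyc_next M i = Suc i mod M"
text \<open>Adding M - 1 modulo M steps back without truncated subtraction at index 0.\<close>

definition cyc_prev :: "nat \<Rightarrow> nat \<Rightarrow> nat" where "cyc_prev M i = (i + (M - 1)) mod M"

lemma cyc_less: "i < M \<Longrightarrow> cyc_next M i < M" "i < M \<Longrightarrow> cyc_prev M i < M"
  by (auto simp: cyc_next_def cyc_prev_def)

lemma cyc_next_eq: "Suc i < M \<Longrightarrow> cyc_next M i = Suc i"
  by (simp add: cyc_next_def)

lemma cyc_prev_next: "i < M \<Longrightarrow> cyc_prev M (cyc_next M i) = i"
  by (cases "Suc i = M") (auto simp: cyc_next_def cyc_prev_def mod_if)

lemma cyc_next_prev: "i < M \<Longrightarrow> cyc_next M (cyc_prev M i) = i"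
  by (cases i) (auto simp: cyc_next_def cyc_prev_def mod_if)

lemma bij_cyc_next: "bij_betw (cyc_next M) {..<M} {..<M}"
  by (rule bij_betwI[of _ _ _ "cyc_prev M"]) (auto simp: cyc_less cyc_prev_next cyc_next_prev)

lemma sum_cyc_next: "(\<Sum>i<M. f (cyc_next M i)) = (\<Sum>i<M. f i :: 'b::comm_monoid_add)"
  by (rule sum.reindex_bij_betw[OF bij_cyc_next])

text \<open>Shifting the index permutes a period, so summation by parts leaves no boundary
  terms.\<close>

lemma sum_cyc_by_parts:
  fixes a w :: "nat \<Rightarrow> 'a::real_inner"
  shows "(\<Sum>i<M. a i \<bullet> (w (cyc_next M i) - w i)) = (\<Sum>i<M. (a (cyc_prev M i) - a i) \<bullet> w i)"
proof -
  have "(\<Sum>i<M. a i \<bullet> w (cyc_next M i)) = (\<Sum>i<M. a (cyc_prev M (cyc_next M i)) \<bullet> w (cyc_next M i))"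
    by (intro sum.cong) (auto simp: cyc_prev_next)
  also have "\<dots> = (\<Sum>i<M. a (cyc_prev M i) \<bullet> w i)" by (rule sum_cyc_next)
  finally show ?thesis by (simp add: inner_diff_right inner_diff_left sum_subtractf)
qed

text \<open>Cauchy-Schwarz for a telescoping sum, the discrete form of |u(t) - u(s)|^2 \<le> |t - s|
  times the integral of |u'|^2. The order of \<open>i\<close> and \<open>j\<close> keeps the path
  from wrapping around.\<close>

lemma norm_diff_le_sqrt:
  fixes u :: "nat \<Rightarrow> 'a::real_normed_vector"
  assumes "i \<le> j" "j < M"
  shows "norm (u j - u i) \<le> sqrt (real (j - i) * (\<Sum>l<M. (norm (u (cyc_next M l) - u l))\<^sup>2))"
proof -
  have "norm (u j - u i) = norm (\<Sum>l=i..<j. u (Suc l) - u l)"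
    using assms by (simp add: sum_Suc_diff')
  also have "\<dots> \<le> (\<Sum>l=i..<j. \<bar>1\<bar> * \<bar>norm (u (Suc l) - u l)\<bar>)"
    by (simp add: sum_norm_le)
  also have "\<dots> \<le> L2_set (\<lambda>_. 1) {i..<j} * L2_set (\<lambda>l. norm (u (Suc l) - u l)) {i..<j}"
    by (rule L2_set_mult_ineq)
  also have "\<dots> = sqrt (real (j - i) * (\<Sum>l=i..<j. (norm (u (Suc l) - u l))\<^sup>2))"
    by (simp add: L2_set_def real_sqrt_mult)
  also have "(\<Sum>l=i..<j. (norm (u (Suc l) - u l))\<^sup>2) = (\<Sum>l=i..<j. (norm (u (cyc_next M l) - u l))\<^sup>2)"
    using assms by (intro sum.cong) (auto simp: cyc_next_eq)
  also have "sqrt (real (j - i) * \<dots>) \<le> sqrt (real (j - i) * (\<Sum>l<M. (norm (u (cyc_next M l) - u l))\<^sup>2))"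
    using assms by (intro real_sqrt_le_mono mult_left_mono sum_mono2) auto
  finally show ?thesis .
qed

lemma shift_into_period:
  assumes "T > 0" shows "t + of_int (- \<lfloor>t / T\<rfloor>) * T \<in> {0..T}"
  using floor_divide_lower[OF assms, of t] floor_divide_upper[OF assms, of t] by (simp add: algebra_simps)

lemma bounded_on_cylinder:
  fixes f :: "real \<Rightarrow> 'a::euclidean_space \<Rightarrow> 'b::real_normed_vector"
  assumes "continuous_on UNIV (\<lambda>(t, x). f t x)"
  obtains B where "B > 0" "\<And>t x. t \<in> {0..T} \<Longrightarrow> norm x \<le> R \<Longrightarrow> norm (f t x) \<le> B"
proof -
  have "bounded ((\<lambda>(t, x). f t x) ` ({0..T} \<times> cball 0 R))"
    by (intro compact_imp_bounded compact_continuous_image compact_Times continuous_on_subset[OF assms]) auto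
  then show ?thesis using that unfolding bounded_pos by (auto simp: image_iff)
qed

text \<open>The splitting of the potential has disappeared: since W dominates every multiple of
  |u|^2, the quadratic form is absorbed into \<open>superquadratic\<close>. The bounds hold for all
  times because the data are periodic.\<close>

locale even_potential =
  fixes T :: real and V :: "real \<Rightarrow> 'a::euclidean_space \<Rightarrow> real" and g :: "real \<Rightarrow> 'a \<Rightarrow> 'a"
  assumes T_pos: "T > 0"
    and V_cont: "continuous_on UNIV (\<lambda>(t, x). V t x)"
    and g_cont: "continuous_on UNIV (\<lambda>(t, x). g t x)"
    and V_deriv: "\<And>t x. (V t has_derivative (\<lambda>y. g t x \<bullet> y)) (at x)"
    and V_periodic: "\<And>t x. V (t + T) x = V t x" and g_periodic: "\<And>t x. g (t + T) x = g t x"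
    and g_odd: "\<And>t x. g t (- x) = - g t x"
    and superquadratic: "\<And>K. \<exists>C. \<forall>t x. V t x \<ge> K * (norm x)\<^sup>2 - C"
begin

lemma periodic_of_int: "V (t + of_int n * T) x = V t x" "g (t + of_int n * T) x = g t x"
proof -
  interpret V: periodic_fun_simple "\<lambda>t. V t x" T by unfold_locales (rule V_periodic)
  interpret g: periodic_fun_simple "\<lambda>t. g t x" T by unfold_locales (rule g_periodic)
  show "V (t + of_int n * T) x = V t x" "g (t + of_int n * T) x = g t x"
    by (rule V.plus_of_int g.plus_of_int)+
qed

lemma bounded_on_balls:
  obtains B where "B > 0" "\<And>t x. norm x \<le> R \<Longrightarrow> \<bar>V t x\<bar> \<le> B" "\<And>t x. norm x \<le> R \<Longrightarrow> norm (g t x) \<le> B"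
proof -
  obtain B1 where B1: "B1 > 0" "\<And>t x. t \<in> {0..T} \<Longrightarrow> norm x \<le> R \<Longrightarrow> norm (V t x) \<le> B1"
    using bounded_on_cylinder[OF V_cont] by metis
  obtain B2 where B2: "B2 > 0" "\<And>t x. t \<in> {0..T} \<Longrightarrow> norm x \<le> R \<Longrightarrow> norm (g t x) \<le> B2"
    using bounded_on_cylinder[OF g_cont] by metis
  show ?thesis
  proof (rule that[of "max B1 B2"])
    fix t x assume x: "norm (x::'a) \<le> R"
    note t = shift_into_period[OF T_pos, of t]
    show "\<bar>V t x\<bar> \<le> max B1 B2" "norm (g t x) \<le> max B1 B2"
      using B1(2)[OF t x] B2(2)[OF t x] by (simp_all only: periodic_of_int real_norm_def le_max_iff_disj simp_thms)
  qed (use B1 in auto)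
qed

text \<open>\<open>action\<close> discretizes \<open>\<integral> \<bar>u'\<bar>\<^sup>2 / 2 - V (t, u)\<close> over a period; a zero of \<open>action_grad\<close> is an
  \<open>M\<close>-periodic solution of the second order difference equation.\<close>

definition mesh :: "nat \<Rightarrow> real" where "mesh M = T / M"

text \<open>Approximates the integral of |u'|^2, that is twice the kinetic energy: the mesh times
  the squares of the difference quotients.\<close>

definition kinetic :: "nat \<Rightarrow> (nat \<Rightarrow> 'a) \<Rightarrow> real" where
  "kinetic M u = (\<Sum>i<M. (norm (u (cyc_next M i) - u i))\<^sup>2) / mesh M"

definition action :: "nat \<Rightarrow> (nat \<Rightarrow> 'a) \<Rightarrow> real" where
  "action M u = kinetic M u / 2 - mesh M * (\<Sum>i<M. V (i * mesh M) (u i))"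

definition action_grad :: "nat \<Rightarrow> (nat \<Rightarrow> 'a) \<Rightarrow> nat \<Rightarrow> 'a" where
  "action_grad M u i = (if i < M then
     (1 / mesh M) *\<^sub>R ((u i - u (cyc_prev M i)) - (u (cyc_next M i) - u i)) - mesh M *\<^sub>R g (i * mesh M) (u i) else 0)"

lemma mesh_pos: "M > 0 \<Longrightarrow> mesh M > 0" using T_pos by (simp add: mesh_def)
lemma mesh_mult: "M > 0 \<Longrightarrow> M * mesh M = T" by (simp add: mesh_def)

text \<open>The weak form of the difference equation. It identifies \<open>action_grad\<close> as
  the gradient of \<open>action\<close>, and \<open>w = u\<close> gives the energy identity at
  critical points.\<close>

lemma action_grad_inner:
  "(\<Sum>i<M. action_grad M u i \<bullet> w i) =
    (\<Sum>i<M. (u (cyc_next M i) - u i) \<bullet> (w (cyc_next M i) - w i)) / mesh M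
     - mesh M * (\<Sum>i<M. g (i * mesh M) (u i) \<bullet> w i)"
proof -
  have "(\<Sum>i<M. action_grad M u i \<bullet> w i) = (\<Sum>i<M. ((u (cyc_next M (cyc_prev M i)) - u (cyc_prev M i)) - (u (cyc_next M i) - u i)) \<bullet> w i / mesh M
      - mesh M * (g (i * mesh M) (u i) \<bullet> w i))"
    by (intro sum.cong) (auto simp: action_grad_def inner_diff_left cyc_next_prev diff_divide_distrib)
  also have "\<dots> = (\<Sum>i<M. ((u (cyc_next M (cyc_prev M i)) - u (cyc_prev M i)) - (u (cyc_next M i) - u i)) \<bullet> w i) / mesh M
      - mesh M * (\<Sum>i<M. g (i * mesh M) (u i) \<bullet> w i)"
    by (simp only: sum_subtractf sum_divide_distrib sum_distrib_left)
  finally show ?thesis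
    unfolding sum_cyc_by_parts[of "\<lambda>i. u (cyc_next M i) - u i" w M] .
qed

lemma kinetic_deriv:
  "((\<lambda>s. kinetic M (\<lambda>i. u i + s *\<^sub>R w i)) has_real_derivative
    2 * (\<Sum>i<M. ((u (cyc_next M i) + s *\<^sub>R w (cyc_next M i)) - (u i + s *\<^sub>R w i)) \<bullet> (w (cyc_next M i) - w i)) / mesh M) (at s)"
proof -
  have "((\<lambda>s. (norm ((u (cyc_next M i) + s *\<^sub>R w (cyc_next M i)) - (u i + s *\<^sub>R w i)))\<^sup>2) has_real_derivative
     2 * (((u (cyc_next M i) + s *\<^sub>R w (cyc_next M i)) - (u i + s *\<^sub>R w i)) \<bullet> (w (cyc_next M i) - w i))) (at s)" for i
    unfolding power2_norm_eq_inner has_field_derivative_def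
    by (rule derivative_eq_intros refl ext | simp add: inner_commute algebra_simps)+
  then show ?thesis unfolding kinetic_def sum_distrib_left
    by (intro DERIV_cdivide DERIV_sum)
qed

lemma action_deriv:
  "((\<lambda>s. action M (\<lambda>i. u i + s *\<^sub>R w i)) has_real_derivative
    (\<Sum>i<M. action_grad M (\<lambda>i. u i + s *\<^sub>R w i) i \<bullet> w i)) (at s)"
proof -
  have "((\<lambda>s. V t (x + s *\<^sub>R y)) has_real_derivative g t (x + s *\<^sub>R y) \<bullet> y) (at s)" for t x y
  proof -
    have "((\<lambda>s. x + s *\<^sub>R y) has_derivative (\<lambda>h. h *\<^sub>R y)) (at s)"
      by (auto intro!: derivative_eq_intros)
    from has_derivative_compose[OF this V_deriv[of t "x + s *\<^sub>R y"]]
    show ?thesis unfolding has_field_derivative_def by (simp add: mult.commute[of _ "g _ _ \<bullet> _"])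
  qed
  then have "((\<lambda>s. \<Sum>i<M. V (i * mesh M) (u i + s *\<^sub>R w i)) has_real_derivative
      (\<Sum>i<M. g (i * mesh M) (u i + s *\<^sub>R w i) \<bullet> w i)) (at s)"
    by (intro DERIV_sum)
  from DERIV_diff[OF DERIV_cdivide[OF kinetic_deriv[of M u w s], where c = 2] DERIV_cmult[OF this, where c = "mesh M"]]
  show ?thesis unfolding action_def action_grad_inner by simp
qed

lemma kinetic_nonneg: "kinetic M u \<ge> 0"
  unfolding kinetic_def mesh_def using T_pos by (intro divide_nonneg_nonneg sum_nonneg) auto

lemma continuous_kinetic: "continuous_on UNIV (kinetic M)"
  unfolding kinetic_def divide_inverse
  by (intro continuous_on_mult continuous_on_sum continuous_on_power continuous_on_norm continuous_on_diff continuous_on_eval continuous_on_const)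

lemma continuous_action: "continuous_on UNIV (action M)"
proof -
  have "continuous_on UNIV (\<lambda>u :: nat \<Rightarrow> 'a. V t (u i))" for t i
    using continuous_on_compose2[OF V_cont continuous_on_Pair[OF continuous_on_const continuous_on_eval], of t i UNIV] by simp
  then show ?thesis unfolding action_def divide_inverse
    by (intro continuous_on_diff continuous_on_mult continuous_on_sum continuous_on_const continuous_kinetic)
qed

lemma continuous_action_grad: "continuous_on UNIV (\<lambda>u. action_grad M u i)"
proof -
  have "continuous_on UNIV (\<lambda>u :: nat \<Rightarrow> 'a. g t (u i))" for t i
    using continuous_on_compose2[OF g_cont continuous_on_Pair[OF continuous_on_const continuous_on_eval], of t i UNIV] by simp
  then show ?thesis unfolding action_grad_def
    by (cases "i < M") (auto intro!: continuous_on_diff continuous_on_scaleR continuous_on_const continuous_on_eval)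
qed

text \<open>At a fixed mesh the kinetic term is at most a multiple of the sum of squares, which the
  superquadratic potential outweighs. The bound depends on \<open>M\<close> and serves only for
  compactness in the minimax principle.\<close>

lemma action_coercive:
  assumes M: "M > 0"
  shows "\<exists>R. \<forall>u\<in>finite_seqs M. action M u \<ge> c \<longrightarrow> (\<forall>i<M. norm (u i) \<le> R)"
proof -
  define h where "h = mesh M"
  have h: "h > 0" using mesh_pos[OF M] by (simp add: h_def)
  \<comment> \<open>Half the kinetic term is at most 2/h times the sum of squares; h K exceeds this
    factor by 1, which leaves minus one sum of squares.\<close>
  define K where "K = (2 / h + 1) / h"
  obtain C where C: "\<And>t x. V t x \<ge> K * (norm x)\<^sup>2 - C" using superquadratic[of K] by blast
  have "norm (u i) \<le> sqrt (T * C - c)" if u: "action M u \<ge> c" and i: "i < M" for u i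
  proof -
    have "kinetic M u \<le> (\<Sum>i<M. 2 * (norm (u (cyc_next M i)))\<^sup>2 + 2 * (norm (u i))\<^sup>2) / h"
      unfolding kinetic_def h_def[symmetric]
    proof (intro divide_right_mono sum_mono)
      fix i
      have "(norm (u (cyc_next M i) - u i))\<^sup>2 \<le> (norm (u (cyc_next M i)) + norm (u i))\<^sup>2"
        by (intro power_mono norm_triangle_ineq4) simp
      also have "\<dots> \<le> 2 * (norm (u (cyc_next M i)))\<^sup>2 + 2 * (norm (u i))\<^sup>2"
        using sum_squares_bound[of "norm (u (cyc_next M i))" "norm (u i)"] by (simp add: power2_sum)
      finally show "(norm (u (cyc_next M i) - u i))\<^sup>2 \<le> 2 * (norm (u (cyc_next M i)))\<^sup>2 + 2 * (norm (u i))\<^sup>2" .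
    qed (use h in simp)
    also have "\<dots> = 4 / h * (\<Sum>i<M. (norm (u i))\<^sup>2)"
      using sum_cyc_next[of "\<lambda>i. (norm (u i))\<^sup>2" M]
      by (simp add: sum.distrib flip: sum_distrib_left)
    finally have k: "kinetic M u \<le> 4 / h * (\<Sum>i<M. (norm (u i))\<^sup>2)" .
    have "(\<Sum>i<M. V (i * h) (u i)) \<ge> (\<Sum>i<M. K * (norm (u i))\<^sup>2 - C)" by (intro sum_mono C)
    then have "(\<Sum>i<M. V (i * h) (u i)) \<ge> K * (\<Sum>i<M. (norm (u i))\<^sup>2) - M * C"
      by (simp add: sum_subtractf sum_distrib_left)
    then have "h * (\<Sum>i<M. V (i * h) (u i)) \<ge> h * (K * (\<Sum>i<M. (norm (u i))\<^sup>2) - M * C)"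
      using h by (intro mult_left_mono) auto
    also have "h * (K * (\<Sum>i<M. (norm (u i))\<^sup>2) - M * C) = (2 / h + 1) * (\<Sum>i<M. (norm (u i))\<^sup>2) - T * C"
      using h mesh_mult[OF M] by (simp add: K_def h_def[symmetric] algebra_simps add_divide_distrib)
    finally have "action M u \<le> T * C - (\<Sum>i<M. (norm (u i))\<^sup>2)"
      using k unfolding action_def h_def[symmetric] by (simp add: algebra_simps)
    then have "(\<Sum>i<M. (norm (u i))\<^sup>2) \<le> T * C - c" using u by simp
    moreover have "(norm (u i))\<^sup>2 \<le> (\<Sum>i<M. (norm (u i))\<^sup>2)" using i by (intro member_le_sum) auto
    ultimately show ?thesis by (intro real_le_rsqrt) simp
  qed
  then show ?thesis by blast
qed

text \<open>A node lies at most 2r steps to the left, so |u_i|^2 is at most 2 r h times the kinetic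
  term, and 2 r h = T/k.\<close>

lemma norm_le_kinetic:
  assumes M: "M = 2 * k * r" "k > 0" "r > 0" and z: "\<And>i. 2 * r dvd i \<Longrightarrow> u i = 0" and i: "i < M"
  shows "(norm (u i))\<^sup>2 \<le> T / k * kinetic M u"
proof -
  define p where "p = 2 * r * (i div (2 * r))"
  have p: "p \<le> i" "i - p \<le> 2 * r" and "u p = 0"
    using z M by (auto simp: p_def minus_mult_div_eq_mod) 
  let ?D = "\<Sum>l<M. (norm (u (cyc_next M l) - u l))\<^sup>2"
  have "norm (u i - u p) \<le> sqrt (real (i - p) * ?D)"
    using p i by (intro norm_diff_le_sqrt)
  then have "(norm (u i))\<^sup>2 \<le> real (i - p) * ?D"
    using \<open>u p = 0\<close> by (simp add: real_le_rsqrt sqrt_ge_absD)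
  also have "\<dots> \<le> real (2 * r) * ?D" using p(2) by (intro mult_right_mono sum_nonneg) (auto simp flip: of_nat_mult)
  also have "\<dots> = T / k * kinetic M u"
    using M T_pos by (simp add: kinetic_def mesh_def)
  finally show ?thesis .
qed

text \<open>This vanishes for all \<open>i\<close> iff \<open>u\<close> is linear between the multiples of \<open>r\<close>; only at the
  non-multiples of \<open>r\<close> is this a condition, which gives the dimension count for Borsuk-Ulam.\<close>

definition pl_defect :: "nat \<Rightarrow> nat \<Rightarrow> (nat \<Rightarrow> 'a) \<Rightarrow> nat \<Rightarrow> 'a" where
  "pl_defect M r u i = u i - ((1 - real (i mod r) / r) *\<^sub>R u (r * (i div r))
     + (real (i mod r) / r) *\<^sub>R u ((r * (i div r) + r) mod M))"

text \<open>The kinetic term and the discrete square integral are both comparable to the square of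
  the largest node value \<open>s\<close>, with constants that depend on k and T but not on r. A
  large enough quadratic lower bound for V then outweighs the kinetic term.\<close>

lemma action_bounded_on_pl:
  assumes k: "k > 0"
  obtains \<beta> where "\<And>r u. r > 0 \<Longrightarrow> (\<And>i. i < 2 * k * r \<Longrightarrow> \<not> r dvd i \<Longrightarrow> pl_defect (2 * k * r) r u i = 0) \<Longrightarrow>
    action (2 * k * r) u \<le> \<beta>"
proof -
  \<comment> \<open>With half the kinetic term at most 8 k^2 s^2 / T and the square integral at
    least T s^2 / (32 k), this is the factor that makes the two balance.\<close>
  define K where "K = 256 * real k ^ 3 / T\<^sup>2"
  have "K \<ge> 0" by (simp add: K_def)
  obtain C where C: "\<And>t x. V t x \<ge> K * (norm x)\<^sup>2 - C" using superquadratic[of K] by blast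
  have "action (2 * k * r) u \<le> T * C"
    if r: "r > 0" and defect: "\<And>i. i < 2 * k * r \<Longrightarrow> \<not> r dvd i \<Longrightarrow> pl_defect (2 * k * r) r u i = 0" for r u
  proof -
    define M where "M = 2 * k * r"
    have M: "M > 0" using k r by (simp add: M_def)
    \<comment> \<open>Node values extended periodically, so that the piece after the last node
      returns to node 0.\<close>
    define a where "a = (\<lambda>q. u (r * (q mod (2 * k))))"
    have node: "a q = u (r * q)" if "q < 2 * k" for q using that by (simp add: a_def)
    have divl: "i div r < 2 * k" if "i < M" for i
      using that by (simp add: M_def less_mult_imp_div_less)
    have pl: "u i = a (i div r) + (real (i mod r) / r) *\<^sub>R (a (Suc (i div r)) - a (i div r))" if i: "i < M" for i
    proof -
      have "(r * (i div r) + r) mod M = r * (Suc (i div r) mod (2 * k))"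
        unfolding M_def mult_mod_right by (simp add: ac_simps)
      then have a: "pl_defect M r u i = u i - (a (i div r) + (real (i mod r) / r) *\<^sub>R (a (Suc (i div r)) - a (i div r)))"
        using node[OF divl[OF i]] by (simp add: pl_defect_def a_def algebra_simps)
      show ?thesis
      proof (cases "r dvd i")
        case True then show ?thesis using node[OF divl[OF i]] by auto
      next
        case False then show ?thesis using defect[of i] i a by (simp add: M_def)
      qed
    qed
    define s where "s = Max ((\<lambda>q. norm (a q)) ` {..<2 * k})"
    have "s \<in> (\<lambda>q. norm (a q)) ` {..<2 * k}" unfolding s_def using k by (intro Max_in) (auto simp: lessThan_empty_iff)
    then obtain q0 where q0: "q0 < 2 * k" "norm (a q0) = s" by auto
    have as: "norm (a q) \<le> s" for q
    proof -
      have "a q = a (q mod (2 * k))" by (simp add: a_def)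
      then show ?thesis unfolding s_def using k by (intro Max_ge) auto
    qed
    have "s \<ge> 0" using q0(2) by auto
    have diff: "norm (u (cyc_next M i) - u i) \<le> 2 * s / r" if i: "i < M" for i
    proof -
      have "u (cyc_next M i) = a (i div r) + (real (Suc (i mod r)) / r) *\<^sub>R (a (Suc (i div r)) - a (i div r))"
      \<comment> \<open>One formula covers both cases: the last index of a piece is followed by the
        next node, where the interpolation parameter is 1.\<close>
      proof (cases "Suc (i mod r) = r")
        case True
        then have "Suc i = r * Suc (i div r)"
          by (metis add_Suc_right mult_Suc_right mult_div_mod_eq add.commute)
        then have "cyc_next M i = r * (Suc (i div r) mod (2 * k))"
          unfolding cyc_next_def M_def mult_mod_right by (simp add: mult.commute mult.left_commute)
        then show ?thesis using True r by (simp add: a_def)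
      next
        case False
        then have *: "Suc i div r = i div r" "Suc i mod r = Suc (i mod r)" by (auto simp: div_Suc mod_Suc)
        have "Suc i < M"
        proof (rule ccontr)
          assume "\<not> Suc i < M"
          then have "Suc i = M" using i by simp
          then have "Suc i mod r = 0" by (simp add: M_def)
          then show False using * by simp
        qed
        then show ?thesis using pl[of "Suc i"] * by (simp add: cyc_next_eq)
      qed
      then have "u (cyc_next M i) - u i = (1 / r) *\<^sub>R (a (Suc (i div r)) - a (i div r))"
        using pl[OF i] by (simp add: add_divide_distrib scaleR_left_distrib)
      then have "norm (u (cyc_next M i) - u i) = (1 / r) * norm (a (Suc (i div r)) - a (i div r))" by simp
      also have "\<dots> \<le> (1 / r) * (s + s)"
        using as by (intro mult_left_mono order_trans[OF norm_triangle_ineq4] add_mono) auto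
      finally show ?thesis by simp
    qed
    have "kinetic M u \<le> (\<Sum>i<M. (2 * s / r)\<^sup>2) / mesh M"
      unfolding kinetic_def using diff mesh_pos[OF M]
      by (intro divide_right_mono sum_mono power_mono) auto
    also have "\<dots> = 16 * (real k)\<^sup>2 * s\<^sup>2 / T"
      using r T_pos k by (simp add: mesh_def M_def power2_eq_square field_simps)
    finally have kin: "kinetic M u \<le> 16 * (real k)\<^sup>2 * s\<^sup>2 / T" .
    \<comment> \<open>The first quarter of the piece that starts at the largest node, with at least
      r/4 indices. There the value has moved by at most 2s/4, so its norm is still at least
      s/2.\<close>
    define J where "J = {..<Suc ((r - 1) div 4)}"
    have J: "j < r \<and> real j / r \<le> 1 / 4" if "j \<in> J" for j
    proof -
      have "4 * j \<le> r - 1" using that by (simp add: J_def less_Suc_eq_le)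
      then have "4 * j \<le> r" "j < r" using r by auto
      then have "4 * real j \<le> real r" by (simp flip: of_nat_le_iff)
      then show ?thesis using r \<open>j < r\<close> by (simp add: field_simps)
    qed
    have inM: "r * q0 + j < M" if "j \<in> J" for j
    proof -
      have "r * q0 + j < r * Suc q0" using J[OF that] by simp
      also have "\<dots> \<le> r * (2 * k)" using q0(1) by (intro mult_left_mono) auto
      finally show ?thesis by (simp add: M_def mult.commute)
    qed
    have big: "norm (u (r * q0 + j)) \<ge> s / 2" if j: "j \<in> J" for j
    proof -
      define \<tau> where "\<tau> = real j / r"
      have "\<tau> \<ge> 0" "\<tau> \<le> 1 / 4" using J[OF j] by (auto simp: \<tau>_def)
      have "(r * q0 + j) div r = q0" "(r * q0 + j) mod r = j" using J[OF j] by auto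
      then have "u (r * q0 + j) = a q0 + \<tau> *\<^sub>R (a (Suc q0) - a q0)"
        using pl[OF inM[OF j]] by (simp add: \<tau>_def)
      moreover have "norm (\<tau> *\<^sub>R (a (Suc q0) - a q0)) \<le> 1 / 4 * (s + s)"
        using \<open>\<tau> \<ge> 0\<close> \<open>\<tau> \<le> 1 / 4\<close> \<open>s \<ge> 0\<close> as unfolding norm_scaleR
        by (intro mult_mono order_trans[OF norm_triangle_ineq4] add_mono) auto
      moreover have "norm (a q0) - norm (\<tau> *\<^sub>R (a (Suc q0) - a q0)) \<le> norm (a q0 + \<tau> *\<^sub>R (a (Suc q0) - a q0))"
        using norm_diff_ineq by blast
      ultimately show ?thesis using q0(2) by simp
    qed
    have "real r / 4 * (s / 2)\<^sup>2 \<le> card J * (s / 2)\<^sup>2"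
    proof (rule mult_right_mono)
      have "r \<le> 4 * Suc ((r - 1) div 4)" using r mult_div_mod_eq[of 4 "r - 1"] mod_less_divisor[of 4 "r - 1"] by simp
      then have "real r \<le> real (4 * Suc ((r - 1) div 4))" by (simp only: of_nat_le_iff)
      then show "real r / 4 \<le> card J" by (simp add: J_def)
    qed simp
    also have "\<dots> = (\<Sum>j\<in>J. (s / 2)\<^sup>2)" by simp
    also have "\<dots> \<le> (\<Sum>j\<in>J. (norm (u (r * q0 + j)))\<^sup>2)"
      using big \<open>s \<ge> 0\<close> by (intro sum_mono power_mono) auto
    also have "\<dots> = (\<Sum>i\<in>(\<lambda>j. r * q0 + j) ` J. (norm (u i))\<^sup>2)"
      by (subst sum.reindex) (auto simp: inj_on_def)
    also have "\<dots> \<le> (\<Sum>i<M. (norm (u i))\<^sup>2)"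
      using inM by (intro sum_mono2) auto
    finally have "mesh M * (real r / 4 * (s / 2)\<^sup>2) \<le> mesh M * (\<Sum>i<M. (norm (u i))\<^sup>2)"
      using mesh_pos[OF M] by (intro mult_left_mono) auto
    moreover have "mesh M * (real r / 4 * (s / 2)\<^sup>2) = T * s\<^sup>2 / (32 * k)"
      using r k by (simp add: mesh_def M_def power2_eq_square field_simps)
    ultimately have "K * (T * s\<^sup>2 / (32 * k)) \<le> K * (mesh M * (\<Sum>i<M. (norm (u i))\<^sup>2))"
      using \<open>K \<ge> 0\<close> by (intro mult_left_mono) auto
    moreover have "K * (T * s\<^sup>2 / (32 * k)) = 8 * (real k)\<^sup>2 * s\<^sup>2 / T"
      using k T_pos by (simp add: K_def power2_eq_square power3_eq_cube field_simps)
    ultimately have quad: "8 * (real k)\<^sup>2 * s\<^sup>2 / T \<le> K * (mesh M * (\<Sum>i<M. (norm (u i))\<^sup>2))" by simp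
    have "(\<Sum>i<M. K * (norm (u i))\<^sup>2 - C) \<le> (\<Sum>i<M. V (i * mesh M) (u i))" by (intro sum_mono C)
    then have "mesh M * (\<Sum>i<M. K * (norm (u i))\<^sup>2 - C) \<le> mesh M * (\<Sum>i<M. V (i * mesh M) (u i))"
      using mesh_pos[OF M] by (intro mult_left_mono) auto
    moreover have "mesh M * (\<Sum>i<M. K * (norm (u i))\<^sup>2 - C) = K * (mesh M * (\<Sum>i<M. (norm (u i))\<^sup>2)) - T * C"
      using mesh_mult[OF M] by (simp add: sum_subtractf algebra_simps flip: sum_distrib_left)
    ultimately show "action (2 * k * r) u \<le> T * C"
      using kin quad unfolding action_def M_def[symmetric] by simp
  qed
  then show ?thesis by (rule that)
qed

lemma kinetic_scale: "kinetic M (\<lambda>i. c *\<^sub>R u i) = c\<^sup>2 * kinetic M u"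
  unfolding kinetic_def
  by (simp add: power_mult_distrib flip: scaleR_right_diff_distrib sum_distrib_left)

lemma kinetic_minus: "kinetic M (\<lambda>i. - u i) = kinetic M u"
  using kinetic_scale[of M "-1" u] by simp

text \<open>\<open>k\<close> and \<beta> are fixed before \<open>r\<close>, so both action bounds
  survive the refinement of the mesh.\<close>

lemma discrete_critical_points:
  obtains k \<beta> where "k > 0"
    "\<And>r. r > 0 \<Longrightarrow> \<exists>u\<in>finite_seqs (2 * k * r). A \<le> action (2 * k * r) u \<and> action (2 * k * r) u \<le> \<beta> \<and> (\<forall>i. action_grad (2 * k * r) u i = 0)"
proof -
  obtain B where B: "B > 0" "\<And>t x. norm x \<le> 1 \<Longrightarrow> \<bar>V t x\<bar> \<le> B" using bounded_on_balls[of 1] by metis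
  define A' where "A' = max 1 (A + T * B)"
  have A': "A' > 0" "A' - T * B \<ge> A" by (auto simp: A'_def)
  \<comment> \<open>With kinetic term 2 A', the squared norms are at most 2 A' T / k \<le> 1, so the
    potential costs at most T B and the action stays above A' - T B \<ge> A.\<close>
  obtain k :: nat where k: "k > 2 * A' * T" using reals_Archimedean2 by blast
  have "k > 0"
  proof -
    have "real k > 0" using k A' T_pos by (smt (verit) mult_pos_pos)
    then show ?thesis by simp
  qed
  obtain \<beta> where \<beta>: "\<And>r u. r > 0 \<Longrightarrow> (\<And>i. i < 2 * k * r \<Longrightarrow> \<not> r dvd i \<Longrightarrow> pl_defect (2 * k * r) r u i = 0) \<Longrightarrow>
    action (2 * k * r) u \<le> \<beta>"
    using action_bounded_on_pl[OF \<open>k > 0\<close>] by metis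
  have "\<exists>u\<in>finite_seqs (2 * k * r). A \<le> action (2 * k * r) u \<and> action (2 * k * r) u \<le> \<beta> \<and> (\<forall>i. action_grad (2 * k * r) u i = 0)"
    if r: "r > 0" for r
  proof -
    define M where "M = 2 * k * r"
    have M: "M > 0" using r \<open>k > 0\<close> by (simp add: M_def)
    \<comment> \<open>\<open>P\<close> indexes the free coordinates of sequences vanishing at k
      nodes, \<open>Q\<close> the equations of piecewise linearity. The index r is a node of the
      finer kind only, which makes the inclusion strict.\<close>
    define P where "P = {i. i < M \<and> \<not> 2 * r dvd i}"
    define Q where "Q = {i. i < M \<and> \<not> r dvd i}"
    have "r < M" using r \<open>k > 0\<close> by (simp add: M_def)
    have "Q \<subseteq> P" by (auto simp: P_def Q_def dvd_mult_right)
    moreover have "r \<in> P - Q" using r \<open>r < M\<close> by (auto simp: P_def Q_def dest: dvd_imp_le)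
    ultimately have QP: "Q \<subset> P" by blast
    have finP: "finite P" by (simp add: P_def)
    have small: "(norm (u i))\<^sup>2 \<le> T / k * kinetic M u" if u: "\<And>i. i \<notin> P \<Longrightarrow> u i = 0" for u i
    proof (cases "i < M")
      case True
      then show ?thesis using u \<open>k > 0\<close> r by (intro norm_le_kinetic[of M k r]) (auto simp: M_def P_def)
    next
      case False
      then have "u i = 0" using u by (auto simp: P_def)
      then show ?thesis using T_pos kinetic_nonneg by simp
    qed
    have kpos: "kinetic M u > 0" if u: "u \<in> block_sphere P" for u
    proof (rule ccontr)
      assume "\<not> kinetic M u > 0"
      then have "kinetic M u = 0" using kinetic_nonneg[of M u] by linarith
      then have "u i = 0" for i using small[of u i] u by (simp add: block_sphere_def)
      then show False using u by (simp add: block_sphere_def)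
    qed
    \<comment> \<open>Rescales the unit sphere radially to the ellipsoid of kinetic term 2
      A'.\<close>
    define h where "h = (\<lambda>u i. sqrt (2 * A' / kinetic M u) *\<^sub>R u i)"
    have kh: "kinetic M (h u) = 2 * A'" if "u \<in> block_sphere P" for u
      unfolding h_def kinetic_scale using kpos[OF that] A' by simp
    have hact: "action M (h u) \<ge> A" if u: "u \<in> block_sphere P" for u
    proof -
      have "norm (h u i) \<le> 1" for i
      proof -
        have "(norm (h u i))\<^sup>2 \<le> T / k * (2 * A')"
          using small[of "h u" i] kh[OF u] u by (simp add: block_sphere_def h_def)
        also have "\<dots> \<le> 1" using k \<open>k > 0\<close> by (simp add: field_simps)
        finally show ?thesis by (simp add: abs_square_le_1)
      qed
      then have "(\<Sum>i<M. V (i * mesh M) (h u i)) \<le> (\<Sum>i<M. B)" using B(2) by (intro sum_mono) (auto simp: abs_le_iff)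
      then have "mesh M * (\<Sum>i<M. V (i * mesh M) (h u i)) \<le> mesh M * (\<Sum>i<M. B)"
        using mesh_pos[OF M] by (intro mult_left_mono) auto
      also have "\<dots> = T * B" using mesh_mult[OF M] by (simp add: algebra_simps)
      finally show ?thesis using A'(2) kh[OF u] by (simp add: action_def)
    qed
    obtain u where u: "u \<in> finite_seqs M" "A \<le> action M u" "action M u \<le> \<beta>" "\<And>i. action_grad M u i = 0"
    proof (rule even_functional_critical_point[of "action_grad M" "action M" M P Q h A "pl_defect M r" \<beta>])
      show "continuous_on UNIV (\<lambda>u. action_grad M u i)" for i by (rule continuous_action_grad)
      show "continuous_on UNIV (action M)" by (rule continuous_action)
      show "action_grad M u i = 0" if "i \<ge> M" for u i using that by (simp add: action_grad_def)
      show "action_grad M (\<lambda>j. - u j) i = - action_grad M u i" for u i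
        by (simp add: action_grad_def g_odd algebra_simps)
      show "\<exists>R. \<forall>u\<in>finite_seqs M. c \<le> action M u \<longrightarrow> (\<forall>i<M. norm (u i) \<le> R)" for c
        by (rule action_coercive[OF M])
      have "continuous_on (block_sphere P) (\<lambda>u. sqrt (2 * A' / kinetic M u))"
        using kpos by (intro continuous_on_real_sqrt continuous_on_divide continuous_on_const continuous_on_subset[OF continuous_kinetic]) force+
      then show "continuous_on (block_sphere P) h"
        unfolding h_def by (intro continuous_on_coordinatewise_then_product continuous_on_scaleR continuous_on_eval)
      show "h (\<lambda>j. - x j) = (\<lambda>j. - h x j)" for x by (simp add: h_def kinetic_minus)
      show "h x \<in> finite_seqs M" if "x \<in> block_sphere P" for x
        using that by (auto simp: h_def finite_seqs_def block_sphere_def P_def)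
      show "continuous_on UNIV (\<lambda>u. pl_defect M r u i)" for i
        unfolding pl_defect_def
        by (intro continuous_on_diff continuous_on_add continuous_on_scaleR continuous_on_const continuous_on_eval)
      show "pl_defect M r (\<lambda>j. - u j) i = - pl_defect M r u i" for u i
        by (simp add: pl_defect_def algebra_simps)
      show "action M u \<le> \<beta>" if "\<And>i. i \<in> Q \<Longrightarrow> pl_defect M r u i = 0" for u
        using \<beta>[OF r, of u] that unfolding M_def[symmetric] by (simp add: Q_def)
    qed (use action_deriv finP QP hact in auto)
    then show ?thesis unfolding M_def by blast
  qed
  then show ?thesis using that \<open>k > 0\<close> by blast
qed

end

subsection \<open>A priori bounds\<close>

text \<open>The difference equation tested with \<open>u\<close> itself.\<close>

lemma (in even_potential) critical_kinetic:
  assumes "\<And>i. action_grad M u i = 0"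
  shows "kinetic M u = mesh M * (\<Sum>i<M. g (i * mesh M) (u i) \<bullet> u i)"
  using action_grad_inner[of M u u] by (simp add: assms kinetic_def power2_norm_eq_inner)

text \<open>The kinetic term cancels, and what remains is the expression that (SQ3) bounds from
  below.\<close>

lemma (in even_potential) critical_action:
  assumes "\<And>i. action_grad M u i = 0"
  shows "2 * action M u = mesh M * (\<Sum>i<M. g (i * mesh M) (u i) \<bullet> u i - 2 * V (i * mesh M) (u i))"
  unfolding action_def critical_kinetic[OF assms] by (simp add: sum_subtractf sum_distrib_left algebra_simps)

text \<open>Used in the contrapositive: critical points of large action must leave the ball of
  radius \<open>R\<close>, at every mesh.\<close>

lemma (in even_potential) critical_action_le:
  obtains B where "\<And>M u. M > 0 \<Longrightarrow> (\<And>i. action_grad M u i = 0) \<Longrightarrow> (\<And>i. i < M \<Longrightarrow> norm (u i) \<le> R) \<Longrightarrow> action M u \<le> B"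
proof -
  obtain B where B: "B > 0" "\<And>t x. norm x \<le> R \<Longrightarrow> \<bar>V t x\<bar> \<le> B" "\<And>t x. norm x \<le> R \<Longrightarrow> norm (g t x) \<le> B"
    using bounded_on_balls[of R] by metis
  have "action M u \<le> T * (B * R + 2 * B) / 2"
    if M: "M > 0" and crit: "\<And>i. action_grad M u i = 0" and R: "\<And>i. i < M \<Longrightarrow> norm (u i) \<le> R" for M u
  proof -
    have "(\<Sum>i<M. g (i * mesh M) (u i) \<bullet> u i - 2 * V (i * mesh M) (u i)) \<le> (\<Sum>i<M. B * R + 2 * B)"
    proof (rule sum_mono)
      fix i assume "i \<in> {..<M}"
      then have i: "norm (u i) \<le> R" using R by simp
      have "g (i * mesh M) (u i) \<bullet> u i \<le> norm (g (i * mesh M) (u i)) * norm (u i)" by (rule norm_cauchy_schwarz)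
      also have "\<dots> \<le> B * R" using B(1) B(3)[OF i] i by (intro mult_mono) auto
      finally show "g (i * mesh M) (u i) \<bullet> u i - 2 * V (i * mesh M) (u i) \<le> B * R + 2 * B"
        using B(2)[OF i, of "i * mesh M"] by linarith
    qed
    then have "2 * action M u \<le> mesh M * (\<Sum>i<M. B * R + 2 * B)"
      unfolding critical_action[OF crit] using mesh_pos[OF M] by (intro mult_left_mono) auto
    also have "\<dots> = T * (B * R + 2 * B)" using mesh_mult[OF M] by (simp add: algebra_simps)
    finally show ?thesis by simp
  qed
  then show ?thesis by (rule that)
qed

text \<open>\<open>\<rho> \<le> \<nu>\<close> makes \<open>\<nu> - \<rho>\<close> a nonnegative
  exponent; it can be arranged by enlarging \<nu>, since that only weakens the growth condition. The
  constant \<open>C\<^sub>0\<close> absorbs bounded arguments, where (SQ3) gives nothing.\<close>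

locale superquadratic_potential = even_potential T V g
  for T :: real and V :: "real \<Rightarrow> 'a::euclidean_space \<Rightarrow> real" and g :: "real \<Rightarrow> 'a \<Rightarrow> 'a" +
  fixes \<nu> \<rho> c C\<^sub>0 C\<^sub>1 :: real
  assumes \<rho>: "1 \<le> \<rho>" "\<rho> \<le> \<nu>" "\<nu> < \<rho> + 2" and c: "c > 0" and C1: "C\<^sub>1 \<ge> 0"
    and gap: "\<And>t x. g t x \<bullet> x - 2 * V t x \<ge> c * norm x powr \<rho> - C\<^sub>0"
    and growth: "\<And>t x. g t x \<bullet> x \<le> C\<^sub>1 * (1 + norm x powr \<nu>)"
begin

text \<open>With \<open>X = 1 + sup \<bar>u\<bar>\<close>, the gap condition bounds the discrete integral of \<open>\<bar>u\<bar>\<^sup>\<rho>\<close>, hence the kinetic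
  energy by a multiple of \<open>X\<^sup>\<nu>\<^sup>-\<^sup>\<rho>\<close>, and therefore \<open>X\<^sup>2\<close> as well; the exponent \<open>\<nu> - \<rho>\<close> is less than 2.\<close>

lemma critical_sup_bound:
  obtains S where "\<And>M u i. M > 0 \<Longrightarrow> (\<And>i. action_grad M u i = 0) \<Longrightarrow> action M u \<le> \<beta> \<Longrightarrow> i < M \<Longrightarrow> norm (u i) \<le> S"
proof -
  \<comment> \<open>\<open>C2\<close> bounds the discrete integral of |u|^\<rho>, and
    \<open>m\<close> bounds 1 plus the least norm of \<open>u\<close>.\<close>
  define C2 where "C2 = \<bar>2 * \<beta> + T * C\<^sub>0\<bar> / c"
  define m where "m = 2 + C2 / T"
  define E where "E = 2 * m\<^sup>2 + 2 * T * (T * C\<^sub>1) + 2 * T * (C\<^sub>1 * C2)"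
  have "C2 \<ge> 0" using c by (simp add: C2_def)
  then have m: "m \<ge> 0" using T_pos by (simp add: m_def)
  have "norm (u i) \<le> E powr (1 / (2 - (\<nu> - \<rho>)))"
    if M: "M > 0" and crit: "\<And>i. action_grad M u i = 0" and act: "action M u \<le> \<beta>" and i: "i < M" for M u i
  proof -
    define h where "h = mesh M"
    have h: "h > 0" "M * h = T" using mesh_pos[OF M] mesh_mult[OF M] by (simp_all add: h_def)
    have "h * (\<Sum>i<M. c * norm (u i) powr \<rho> - C\<^sub>0) \<le> h * (\<Sum>i<M. g (i * h) (u i) \<bullet> u i - 2 * V (i * h) (u i))"
      using h by (intro mult_left_mono sum_mono gap) auto
    also have "\<dots> = 2 * action M u" using critical_action[OF crit] by (simp add: h_def)
    finally have "c * (h * (\<Sum>i<M. norm (u i) powr \<rho>)) - T * C\<^sub>0 \<le> 2 * \<beta>"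
      using act h by (simp add: sum_subtractf algebra_simps flip: sum_distrib_left)
    then have int_rho: "h * (\<Sum>i<M. norm (u i) powr \<rho>) \<le> C2"
      using c by (simp add: C2_def field_simps)
    define S where "S = Max ((\<lambda>i. norm (u i)) ` {..<M})"
    have ne: "(\<lambda>i. norm (u i)) ` {..<M} \<noteq> {}" using M by (auto simp: lessThan_empty_iff)
    have "S \<in> (\<lambda>i. norm (u i)) ` {..<M}" unfolding S_def using ne by (intro Max_in) auto
    then obtain p where p: "p < M" "norm (u p) = S" by auto
    have uS: "norm (u j) \<le> S" if "j < M" for j unfolding S_def using that by (intro Max_ge) auto
    have "S \<ge> 0" using p(2) by auto
    define X where "X = 1 + S"
    have X: "X \<ge> 1" using \<open>S \<ge> 0\<close> by (simp add: X_def)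
    have "Min ((\<lambda>i. norm (u i)) ` {..<M}) \<in> (\<lambda>i. norm (u i)) ` {..<M}" using ne by (intro Min_in) auto
    then obtain q where q: "q < M" "norm (u q) = Min ((\<lambda>i. norm (u i)) ` {..<M})" by auto
    have qmin: "norm (u q) \<le> norm (u j)" if "j < M" for j unfolding q(2) using that by (intro Min_le) auto
    \<comment> \<open>The least norm is controlled by the mean of |u|^\<rho>. Once it exceeds 1 it
      is at most its own power \<rho>, because \<rho> \<ge> 1.\<close>
    have "norm (u q) \<le> 1 + C2 / T"
    proof (cases "norm (u q) \<le> 1")
      case True
      have "C2 / T \<ge> 0" using \<open>C2 \<ge> 0\<close> T_pos by simp
      with True show ?thesis by linarith
    next
      case False
      then have "norm (u q) powr 1 \<le> norm (u q) powr \<rho>" using \<rho> by (intro powr_mono) auto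
      then have "T * norm (u q) \<le> T * norm (u q) powr \<rho>" using T_pos False by (intro mult_left_mono) auto
      also have "\<dots> = h * (\<Sum>i<M. norm (u q) powr \<rho>)" using h(2) by (simp add: algebra_simps)
      also have "\<dots> \<le> h * (\<Sum>i<M. norm (u i) powr \<rho>)"
        using h \<rho> qmin by (intro mult_left_mono sum_mono powr_mono2) auto
      also have "\<dots> \<le> C2" by (rule int_rho)
      finally show ?thesis using T_pos by (simp add: field_simps)
    qed
    have pw: "norm (u j) powr \<nu> \<le> X powr (\<nu> - \<rho>) * norm (u j) powr \<rho>" if "j < M" for j
    proof -
      have "norm (u j) powr \<nu> = norm (u j) powr (\<nu> - \<rho>) * norm (u j) powr \<rho>"
        by (simp flip: powr_add)
      also have "\<dots> \<le> X powr (\<nu> - \<rho>) * norm (u j) powr \<rho>"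
        using \<rho> uS[OF that] by (intro mult_right_mono powr_mono2) (auto simp: X_def)
      finally show ?thesis .
    qed
    have "kinetic M u \<le> h * (\<Sum>i<M. C\<^sub>1 * (1 + X powr (\<nu> - \<rho>) * norm (u i) powr \<rho>))"
      unfolding critical_kinetic[OF crit] h_def[symmetric] using h pw C1
      by (intro mult_left_mono sum_mono order_trans[OF growth]) auto
    also have "\<dots> = T * C\<^sub>1 + C\<^sub>1 * (X powr (\<nu> - \<rho>) * (h * (\<Sum>i<M. norm (u i) powr \<rho>)))"
      using h(2) by (simp add: sum.distrib sum_distrib_left algebra_simps)
    also have "\<dots> \<le> T * C\<^sub>1 + C\<^sub>1 * (X powr (\<nu> - \<rho>) * C2)"
      using C1 int_rho by (intro add_left_mono mult_left_mono) auto
    finally have kin: "kinetic M u \<le> T * C\<^sub>1 + C\<^sub>1 * C2 * X powr (\<nu> - \<rho>)" by (simp add: mult_ac)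
    let ?D = "\<Sum>l<M. (norm (u (cyc_next M l) - u l))\<^sup>2"
    have D: "M * ?D = T * kinetic M u" using h M by (simp add: kinetic_def flip: h_def) (simp add: field_simps)
    have "norm (u p - u q) \<le> sqrt (T * kinetic M u)"
    proof -
      have *: "norm (u j - u i) \<le> sqrt (T * kinetic M u)" if "i \<le> j" "j < M" for i j
      proof -
        have "norm (u j - u i) \<le> sqrt (real (j - i) * ?D)" using that by (rule norm_diff_le_sqrt)
        also have "\<dots> \<le> sqrt (M * ?D)"
          using that by (intro real_sqrt_le_mono mult_right_mono sum_nonneg) auto
        finally show ?thesis by (simp add: D)
      qed
      show ?thesis using *[of p q] *[of q p] p q by (cases "p \<le> q") (auto simp: norm_minus_commute)
    qed
    moreover have "norm (u p) \<le> norm (u q) + norm (u p - u q)" by (metis norm_triangle_sub)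
    ultimately have "X \<le> m + sqrt (T * kinetic M u)"
      using \<open>norm (u q) \<le> 1 + C2 / T\<close> p(2) by (simp add: X_def m_def)
    then have "X\<^sup>2 \<le> (m + sqrt (T * kinetic M u))\<^sup>2" using X by (intro power_mono) auto
    also have "\<dots> \<le> 2 * m\<^sup>2 + 2 * (sqrt (T * kinetic M u))\<^sup>2"
      using sum_squares_bound[of m "sqrt (T * kinetic M u)"] by (simp add: power2_sum)
    also have "\<dots> = 2 * m\<^sup>2 + 2 * T * kinetic M u" using T_pos kinetic_nonneg by simp
    also have "\<dots> \<le> 2 * m\<^sup>2 + 2 * T * (T * C\<^sub>1 + C\<^sub>1 * C2 * X powr (\<nu> - \<rho>))"
      using T_pos kin by (intro add_left_mono mult_left_mono) auto
    also have "\<dots> \<le> E * X powr (\<nu> - \<rho>)"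
    proof -
      have "1 \<le> X powr (\<nu> - \<rho>)" using X \<rho> by (intro ge_one_powr_ge_zero) auto
      then have "(2 * m\<^sup>2 + 2 * T * (T * C\<^sub>1)) * 1 \<le> (2 * m\<^sup>2 + 2 * T * (T * C\<^sub>1)) * X powr (\<nu> - \<rho>)"
        using T_pos C1 by (intro mult_left_mono) auto
      then show ?thesis by (simp add: E_def algebra_simps)
    qed
    finally have "X\<^sup>2 \<le> E * X powr (\<nu> - \<rho>)" .
    moreover have "X\<^sup>2 = X powr (2 - (\<nu> - \<rho>)) * X powr (\<nu> - \<rho>)"
      using X by (simp flip: powr_add)
    ultimately have "X powr (2 - (\<nu> - \<rho>)) \<le> E" using X by simp
    then have "(X powr (2 - (\<nu> - \<rho>))) powr (1 / (2 - (\<nu> - \<rho>))) \<le> E powr (1 / (2 - (\<nu> - \<rho>)))"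
      using \<rho> by (intro powr_mono2) auto
    then have "X \<le> E powr (1 / (2 - (\<nu> - \<rho>)))" using X \<rho> by (simp add: powr_powr)
    then show ?thesis using uS[OF i] by (simp add: X_def)
  qed
  then show ?thesis by (rule that)
qed

end

subsection \<open>Passage to the limit\<close>

definition pl_interp :: "(int \<Rightarrow> 'b::real_normed_vector) \<Rightarrow> real \<Rightarrow> 'b" where
  "pl_interp W x = W \<lfloor>x\<rfloor> + frac x *\<^sub>R (W (\<lfloor>x\<rfloor> + 1) - W \<lfloor>x\<rfloor>)"

lemma pl_interp_of_int [simp]: "pl_interp W (of_int j) = W j"
  by (simp add: pl_interp_def)

lemma norm_pl_interp_le:
  assumes "\<And>j. norm (W j) \<le> B" shows "norm (pl_interp W x) \<le> B"
proof -
  have f: "0 \<le> frac x" "frac x \<le> 1" using frac_lt_1[of x] by auto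
  have "pl_interp W x = (1 - frac x) *\<^sub>R W \<lfloor>x\<rfloor> + frac x *\<^sub>R W (\<lfloor>x\<rfloor> + 1)"
    by (simp add: pl_interp_def algebra_simps)
  also have "norm \<dots> \<le> (1 - frac x) * B + frac x * B"
    using f assms by (intro order_trans[OF norm_triangle_ineq] add_mono) (auto intro!: mult_left_mono)
  finally show ?thesis by (simp add: algebra_simps)
qed

text \<open>If x and y lie in different unit intervals, the increment splits into the rest of the
  first interval, whole steps and the start of the last one, whose lengths add up to y - x.\<close>

lemma lipschitz_pl_interp:
  assumes step: "\<And>j. norm (W (j + 1) - W j) \<le> L"
  shows "norm (pl_interp W y - pl_interp W x) \<le> L * \<bar>y - x\<bar>"
proof -
  have int: "norm (W (i + int n) - W i) \<le> L * n" for i n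
  proof (induction n)
    case (Suc n)
    have "norm (W (i + int (Suc n)) - W i) = norm ((W (i + int n + 1) - W (i + int n)) + (W (i + int n) - W i))"
      by (simp add: algebra_simps)
    also have "\<dots> \<le> L + L * n" using step Suc by (intro order_trans[OF norm_triangle_ineq] add_mono)
    finally show ?case by (simp add: algebra_simps)
  qed simp
  have le: "norm (pl_interp W y - pl_interp W x) \<le> L * (y - x)" if "x \<le> y" for x y
  proof (cases "\<lfloor>x\<rfloor> = \<lfloor>y\<rfloor>")
    case True
    then have "pl_interp W y - pl_interp W x = (y - x) *\<^sub>R (W (\<lfloor>x\<rfloor> + 1) - W \<lfloor>x\<rfloor>)"
      by (simp add: pl_interp_def frac_def flip: scaleR_left_diff_distrib)
    then show ?thesis using that step[of "\<lfloor>x\<rfloor>"] by (simp add: mult.commute[of L] mult_left_mono)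
  next
    case False
    then have fl: "\<lfloor>x\<rfloor> < \<lfloor>y\<rfloor>" using floor_mono[OF that] by linarith
    define n where "n = nat (\<lfloor>y\<rfloor> - (\<lfloor>x\<rfloor> + 1))"
    have n: "\<lfloor>y\<rfloor> = \<lfloor>x\<rfloor> + 1 + int n" using fl by (simp add: n_def)
    have f: "0 \<le> frac y" "0 \<le> 1 - frac x" using frac_lt_1[of x] by auto
    have "pl_interp W y - pl_interp W x = frac y *\<^sub>R (W (\<lfloor>y\<rfloor> + 1) - W \<lfloor>y\<rfloor>)
        + (W (\<lfloor>x\<rfloor> + 1 + int n) - W (\<lfloor>x\<rfloor> + 1)) + (1 - frac x) *\<^sub>R (W (\<lfloor>x\<rfloor> + 1) - W \<lfloor>x\<rfloor>)"
      unfolding pl_interp_def n[symmetric] by (simp add: algebra_simps)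
    also have "norm \<dots> \<le> frac y * L + L * n + (1 - frac x) * L"
      using f step int[of "\<lfloor>x\<rfloor> + 1" n]
      by (intro order_trans[OF norm_triangle_ineq] add_mono) (auto intro!: mult_left_mono)
    also have "\<dots> = L * (y - x)"
    proof -
      have "real_of_int \<lfloor>y\<rfloor> = of_int \<lfloor>x\<rfloor> + 1 + real n" using n by simp
      then show ?thesis by (simp add: frac_def algebra_simps)
    qed
    finally show ?thesis .
  qed
  show ?thesis using le[of x y] le[of y x] by (cases "x \<le> y") (auto simp: norm_minus_commute)
qed

lemma pl_interp_periodic:
  assumes "\<And>j. W (j + N) = W j" shows "pl_interp W (x + of_int N) = pl_interp W x"
proof -
  have "W (\<lfloor>x\<rfloor> + N + 1) = W (\<lfloor>x\<rfloor> + 1)" using assms[of "\<lfloor>x\<rfloor> + 1"] by (simp add: algebra_simps)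
  then show ?thesis by (simp add: pl_interp_def assms frac_def)
qed

lemma floor_mesh_tendsto:
  fixes h :: "nat \<Rightarrow> real"
  assumes h: "\<And>n. h n > 0" "h \<longlonglongrightarrow> 0"
  shows "(\<lambda>n. of_int \<lfloor>t / h n\<rfloor> * h n) \<longlonglongrightarrow> t"
proof (rule LIM_zero_cancel, rule Lim_null_comparison[OF _ h(2)])
  show "\<forall>\<^sub>F n in sequentially. norm (of_int \<lfloor>t / h n\<rfloor> * h n - t) \<le> h n"
  proof (intro always_eventually allI)
    fix n
    show "norm (of_int \<lfloor>t / h n\<rfloor> * h n - t) \<le> h n"
      using floor_divide_lower[OF h(1)[of n], of t] floor_divide_upper[OF h(1)[of n], of t]
      by (simp add: algebra_simps abs_le_iff)
  qed
qed

text \<open>Arzela-Ascoli for the piecewise linear interpolants, which inherit a common bound,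
  Lipschitz constant and period. The last two conclusions return to grid values, so that
  interpolation can be forgotten afterwards.\<close>

lemma discrete_compactness:
  fixes W :: "nat \<Rightarrow> int \<Rightarrow> 'b::euclidean_space" and h :: "nat \<Rightarrow> real" and N :: "nat \<Rightarrow> int"
  assumes T: "T > 0" and h: "\<And>n. h n > 0" and N: "\<And>n. of_int (N n) * h n = T"
    and per: "\<And>n j. W n (j + N n) = W n j" and step: "\<And>n j. norm (W n (j + 1) - W n j) \<le> L * h n"
    and B: "\<And>n j. norm (W n j) \<le> B" and L: "L > 0"
  obtains k f where "strict_mono k" "\<And>t. f (t + T) = f t" "continuous_on UNIV f"
    "\<And>e. e > 0 \<Longrightarrow> \<exists>n0. \<forall>n\<ge>n0. \<forall>j. norm (W (k n) j - f (of_int j * h (k n))) < e"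
    "\<And>j t. (\<lambda>n. of_int (j n) * h (k n)) \<longlonglongrightarrow> t \<Longrightarrow> (\<lambda>n. W (k n) (j n)) \<longlonglongrightarrow> f t"
proof -
  define F where "F = (\<lambda>n t. pl_interp (W n) (t / h n))"
  have Fj: "F n (of_int j * h n) = W n j" for n j using h[of n] by (simp add: F_def)
  have lip: "norm (F n s - F n t) \<le> L * \<bar>s - t\<bar>" for n s t
  proof -
    have "norm (F n s - F n t) \<le> L * h n * \<bar>s / h n - t / h n\<bar>"
      unfolding F_def by (rule lipschitz_pl_interp) (rule step)
    also have "\<dots> = L * \<bar>s - t\<bar>" using h[of n] by (simp flip: diff_divide_distrib)
    finally show ?thesis .
  qed
  have FT: "F n (t + T) = F n t" for n t
  proof -
    have "(t + T) / h n = t / h n + of_int (N n)"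
      using h[of n] N[of n] by (simp add: field_simps)
    then show ?thesis unfolding F_def using pl_interp_periodic[of "W n" "N n"] per by simp
  qed
  have Fint: "F n (t + of_int i * T) = F n t" for n t i
  proof -
    interpret periodic_fun_simple "F n" T by unfold_locales (rule FT)
    show ?thesis by (rule plus_of_int)
  qed
  obtain g0 :: "real \<Rightarrow> 'b" and k where k: "strict_mono (k :: nat \<Rightarrow> nat)"
    and unif: "\<And>e. 0 < e \<Longrightarrow> \<exists>n0. \<forall>n x. n \<ge> n0 \<and> x \<in> {0..T} \<longrightarrow> norm (F (k n) x - g0 x) < e"
  proof (rule Arzela_Ascoli[of "{0..T}" F B])
    show "norm (F n x) \<le> B" for n x unfolding F_def by (rule norm_pl_interp_le[OF B])
    show "\<exists>d. 0 < d \<and> (\<forall>n y. y \<in> {0..T} \<and> norm (x - y) < d \<longrightarrow> norm (F n x - F n y) < e)" if e: "0 < e" for x e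
    proof (intro exI[of _ "e / L"] conjI allI impI)
      fix n y assume "y \<in> {0..T} \<and> norm (x - y) < e / L"
      then have "L * \<bar>x - y\<bar> < e" using L by (simp add: field_simps)
      then show "norm (F n x - F n y) < e" using lip[of n x y] by linarith
    qed (use e L in simp)
  qed auto
  \<comment> \<open>The limit is controlled only on [0, T] and is extended from there by reducing t
    modulo T.\<close>
  define f where "f = (\<lambda>t. g0 (t - of_int \<lfloor>t / T\<rfloor> * T))"
  have unif': "\<exists>n0. \<forall>n\<ge>n0. \<forall>t. norm (F (k n) t - f t) < e" if e: "e > 0" for e
  proof -
    obtain n0 where n0: "\<And>n x. n \<ge> n0 \<Longrightarrow> x \<in> {0..T} \<Longrightarrow> norm (F (k n) x - g0 x) < e" using unif[OF e] by blast
    have "norm (F (k n) t - f t) < e" if "n \<ge> n0" for n t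
    proof -
      have "t - of_int \<lfloor>t / T\<rfloor> * T \<in> {0..T}" using shift_into_period[OF T, of t] by simp
      from n0[OF that this] show ?thesis
        using Fint[of "k n" t "- \<lfloor>t / T\<rfloor>"] by (simp add: f_def)
    qed
    then show ?thesis by blast
  qed
  show ?thesis
  proof (rule that[OF k, of f])
    have "(t + T) / T = t / T + of_int 1" for t using T by (simp add: add_divide_distrib)
    then have fl: "\<lfloor>(t + T) / T\<rfloor> = \<lfloor>t / T\<rfloor> + 1" for t by (metis floor_add_int)
    show "f (t + T) = f t" for t unfolding f_def fl by (simp add: algebra_simps)
    have ul: "uniform_limit UNIV (\<lambda>n. F (k n)) f sequentially"
      unfolding uniform_limit_iff eventually_sequentially using unif' by (auto simp: dist_norm)
    have "continuous_on UNIV (F n)" for n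
      unfolding continuous_on_iff
    proof (intro ballI allI impI)
      fix x e :: real assume "0 < e"
      show "\<exists>d>0. \<forall>x'\<in>UNIV. dist x' x < d \<longrightarrow> dist (F n x') (F n x) < e"
      proof (intro exI[of _ "e / L"] conjI ballI impI)
        fix y assume "dist y x < e / L"
        then have "L * \<bar>y - x\<bar> < e" using L by (simp add: dist_real_def field_simps)
        then show "dist (F n y) (F n x) < e" using lip[of n y x] by (simp add: dist_norm)
      qed (use L \<open>0 < e\<close> in simp)
    qed
    then show "continuous_on UNIV f"
      by (intro uniform_limit_theorem[OF _ ul]) auto
    show "\<exists>n0. \<forall>n\<ge>n0. \<forall>j. norm (W (k n) j - f (of_int j * h (k n))) < e" if "e > 0" for e
      using unif'[OF that] by (metis Fj)
    fix j :: "nat \<Rightarrow> int" and t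
    assume j: "(\<lambda>n. of_int (j n) * h (k n)) \<longlonglongrightarrow> t"
    have "(\<lambda>n. F (k n) t) \<longlonglongrightarrow> f t"
      unfolding LIMSEQ_iff using unif' by meson
    moreover have "(\<lambda>n. W (k n) (j n) - F (k n) t) \<longlonglongrightarrow> 0"
    proof (rule Lim_null_comparison)
      show "\<forall>\<^sub>F n in sequentially. norm (W (k n) (j n) - F (k n) t) \<le> L * \<bar>of_int (j n) * h (k n) - t\<bar>"
        using lip Fj by (intro always_eventually allI) metis
      have "(\<lambda>n. L * \<bar>of_int (j n) * h (k n) - t\<bar>) \<longlonglongrightarrow> L * \<bar>t - t\<bar>"
        by (intro tendsto_intros j)
      then show "(\<lambda>n. L * \<bar>of_int (j n) * h (k n) - t\<bar>) \<longlonglongrightarrow> 0" by simp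
    qed
    ultimately have "(\<lambda>n. (W (k n) (j n) - F (k n) t) + F (k n) t) \<longlonglongrightarrow> 0 + f t"
      by (intro tendsto_add)
    then show "(\<lambda>n. W (k n) (j n)) \<longlonglongrightarrow> f t" by simp
  qed
qed

text \<open>If all difference quotients near \<open>t0\<close> are within e of \<open>Q\<close>,
  summing the steps from s to t and passing to the limit gives |f t - f s - (t - s) Q| \<le> e (t -
  s).\<close>

lemma discrete_derivative_limit:
  fixes a q :: "nat \<Rightarrow> int \<Rightarrow> 'b::real_normed_vector" and h :: "nat \<Rightarrow> real"
  assumes h: "\<And>n. h n > 0" "h \<longlonglongrightarrow> 0"
    and step: "\<And>n j. a n (j + 1) = a n j + h n *\<^sub>R q n j"
    and conv: "\<And>j t. (\<lambda>n. of_int (j n) * h n) \<longlonglongrightarrow> t \<Longrightarrow> (\<lambda>n. a n (j n)) \<longlonglongrightarrow> f t"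
    and near: "\<And>e. e > 0 \<Longrightarrow> \<exists>d>0. \<exists>n0. \<forall>n\<ge>n0. \<forall>j. \<bar>of_int j * h n - t0\<bar> \<le> d \<longrightarrow> norm (q n j - Q) \<le> e"
  shows "(f has_vector_derivative Q) (at t0)"
proof -
  have sum: "norm (a n (j + int m) - a n j - (m * h n) *\<^sub>R Q) \<le> m * h n * e"
    if "\<And>l. l < m \<Longrightarrow> norm (q n (j + int l) - Q) \<le> e" for n j m e
    using that
  proof (induction m)
    case (Suc m)
    have "a n (j + int (Suc m)) - a n j - (Suc m * h n) *\<^sub>R Q
        = (a n (j + int m) - a n j - (m * h n) *\<^sub>R Q) + h n *\<^sub>R (q n (j + int m) - Q)"
      using step[of n "j + int m"] by (simp add: algebra_simps)
    also have "norm \<dots> \<le> m * h n * e + h n * e"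
      using Suc.IH Suc.prems h(1)[of n]
      by (intro order_trans[OF norm_triangle_ineq] add_mono) (auto intro!: mult_left_mono)
    finally show ?case by (simp add: algebra_simps)
  qed simp
  \<comment> \<open>Neither end is fixed at \<open>t0\<close>, so that one estimate serves the
    derivative from both sides.\<close>
  have main: "\<exists>d>0. \<forall>s t. s \<le> t \<longrightarrow> \<bar>s - t0\<bar> < d \<longrightarrow> \<bar>t - t0\<bar> < d \<longrightarrow> norm (f t - f s - (t - s) *\<^sub>R Q) \<le> e * (t - s)"
    if e: "e > 0" for e
  proof -
    obtain d n0 where d: "d > 0" and n0: "\<And>n j. n \<ge> n0 \<Longrightarrow> \<bar>of_int j * h n - t0\<bar> \<le> d \<Longrightarrow> norm (q n j - Q) \<le> e"
      using near[OF e] by blast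
    have "norm (f t - f s - (t - s) *\<^sub>R Q) \<le> e * (t - s)"
      if st: "s \<le> t" "\<bar>s - t0\<bar> < d / 2" "\<bar>t - t0\<bar> < d / 2" for s t
    proof -
      define i where "i = (\<lambda>n. \<lfloor>s / h n\<rfloor>)"
      define j where "j = (\<lambda>n. \<lfloor>t / h n\<rfloor>)"
      define m where "m = (\<lambda>n. nat (j n - i n))"
      have ij: "i n \<le> j n" for n unfolding i_def j_def
        using st(1) h(1)[of n] by (intro floor_mono divide_right_mono) auto
      have jm: "j n = i n + int (m n)" for n using ij[of n] by (simp add: m_def)
      have ilim: "(\<lambda>n. of_int (i n) * h n) \<longlonglongrightarrow> s" and jlim: "(\<lambda>n. of_int (j n) * h n) \<longlonglongrightarrow> t"
        unfolding i_def j_def using h by (rule floor_mesh_tendsto)+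
      have mh: "m n * h n = of_int (j n) * h n - of_int (i n) * h n" for n
        using jm[of n] by (simp add: algebra_simps)
      have mlim: "(\<lambda>n. m n * h n) \<longlonglongrightarrow> t - s" unfolding mh by (intro tendsto_diff ilim jlim)
      have "(\<lambda>n. norm (a n (j n) - a n (i n) - (m n * h n) *\<^sub>R Q)) \<longlonglongrightarrow> norm (f t - f s - (t - s) *\<^sub>R Q)"
        by (intro tendsto_intros conv ilim jlim mlim)
      moreover have "(\<lambda>n. m n * h n * e) \<longlonglongrightarrow> (t - s) * e" by (intro tendsto_intros mlim)
      moreover have "\<forall>\<^sub>F n in sequentially. norm (a n (j n) - a n (i n) - (m n * h n) *\<^sub>R Q) \<le> m n * h n * e"
      proof -
        \<comment> \<open>Rounding s down to the grid moves it by less than one mesh, so all indices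
          in between stay within d of \<open>t0\<close>.\<close>
        have "\<forall>\<^sub>F n in sequentially. h n < d / 2" by (rule order_tendstoD(2)[OF h(2)]) (use d in simp)
        moreover have "\<forall>\<^sub>F n in sequentially. n \<ge> n0" by (rule eventually_ge_at_top)
        ultimately show ?thesis
        proof eventually_elim
          case (elim n)
          have "norm (q n (i n + int l) - Q) \<le> e" if "l < m n" for l
          proof (rule n0[OF elim(2)])
            have "of_int (i n) * h n \<le> of_int (i n + int l) * h n" "of_int (i n + int l) * h n \<le> of_int (j n) * h n"
              using that h(1)[of n] unfolding jm by (intro mult_right_mono; simp)+
            moreover have "of_int (i n) * h n \<ge> s - h n"
              unfolding i_def using floor_divide_upper[OF h(1)[of n], of s] by (simp add: algebra_simps)
            moreover have "of_int (j n) * h n \<le> t"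
              unfolding j_def using floor_divide_lower[OF h(1)[of n], of t] by simp
            ultimately show "\<bar>of_int (i n + int l) * h n - t0\<bar> \<le> d" using st elim(1) by linarith
          qed
          then show ?case unfolding jm by (rule sum)
        qed
      qed
      ultimately have "norm (f t - f s - (t - s) *\<^sub>R Q) \<le> (t - s) * e"
        by (intro tendsto_le[OF sequentially_bot]) 
      then show ?thesis by (simp add: mult.commute)
    qed
    then show ?thesis using d by (intro exI[of _ "d / 2"]) auto
  qed
  show ?thesis
    unfolding has_vector_derivative_def has_derivative_at_alt
  proof (intro conjI allI impI)
    show "bounded_linear (\<lambda>x. x *\<^sub>R Q)" by (rule bounded_linear_scaleR_left)
    fix e :: real assume "0 < e"
    then obtain d where d: "d > 0" and D: "\<And>s t. s \<le> t \<Longrightarrow> \<bar>s - t0\<bar> < d \<Longrightarrow> \<bar>t - t0\<bar> < d \<Longrightarrow> norm (f t - f s - (t - s) *\<^sub>R Q) \<le> e * (t - s)"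
      using main by blast
    have "norm (f y - f t0 - (y - t0) *\<^sub>R Q) \<le> e * norm (y - t0)" if y: "norm (y - t0) < d" for y
    proof (cases "t0 \<le> y")
      case True then show ?thesis using D[of t0 y] y d by simp
    next
      case False
      have "norm (f y - f t0 - (y - t0) *\<^sub>R Q) = norm (f t0 - f y - (t0 - y) *\<^sub>R Q)"
        by (subst norm_minus_cancel[symmetric]) (simp add: algebra_simps)
      then show ?thesis using D[of y t0] y d False by simp
    qed
    then show "\<exists>d>0. \<forall>y. norm (y - t0) < d \<longrightarrow> norm (f y - f t0 - (y - t0) *\<^sub>R Q) \<le> e * norm (y - t0)"
      using d by blast
  qed
qed

section \<open>Solutions as limits of discrete critical points\<close>

context superquadratic_potential
begin

text \<open>The level B + 1 lies above every critical value attained with norms at most R + 1. The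
  discrete solutions therefore exceed R + 1 somewhere, and the extra 1 absorbs the error of uniform
  convergence.\<close>

lemma large_solution:
  "\<exists>u. periodic_solution T V u \<and> (\<exists>t. norm (u t) > R)"
proof -
  obtain B where B: "\<And>M u. M > 0 \<Longrightarrow> (\<And>i. action_grad M u i = 0) \<Longrightarrow> (\<And>i. i < M \<Longrightarrow> norm (u i) \<le> R + 1) \<Longrightarrow> action M u \<le> B"
    using critical_action_le[of "R + 1"] by metis
  obtain K \<beta> where K: "K > 0" and crit: "\<And>r. r > 0 \<Longrightarrow> \<exists>u\<in>finite_seqs (2 * K * r). B + 1 \<le> action (2 * K * r) u \<and>
      action (2 * K * r) u \<le> \<beta> \<and> (\<forall>i. action_grad (2 * K * r) u i = 0)"
    using discrete_critical_points[of "B + 1"] by metis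
  define M where "M = (\<lambda>n. 2 * K * Suc n)"
  have M: "M n > 0" for n using K by (simp add: M_def)
  obtain x where x1: "\<And>n. B + 1 \<le> action (M n) (x n)" and x2: "\<And>n. action (M n) (x n) \<le> \<beta>"
    and x3: "\<And>n i. action_grad (M n) (x n) i = 0"
    using crit[of "Suc _"] unfolding M_def by (metis zero_less_Suc)
  obtain S where S: "\<And>M u i. M > 0 \<Longrightarrow> (\<And>i. action_grad M u i = 0) \<Longrightarrow> action M u \<le> \<beta> \<Longrightarrow> i < M \<Longrightarrow> norm (u i) \<le> S"
    using critical_sup_bound[of \<beta>] by metis
  obtain \<Gamma> where \<Gamma>: "\<Gamma> > 0" "\<And>t y. norm y \<le> S \<Longrightarrow> norm (g t y) \<le> \<Gamma>"
    using bounded_on_balls[of S] by metis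
  define h where "h = (\<lambda>n. mesh (M n))"
  have h: "h n > 0" for n using mesh_pos[OF M] by (simp add: h_def)
  have Mh: "of_int (int (M n)) * h n = T" for n using mesh_mult[OF M[of n]] by (simp add: h_def)
  have h0: "h \<longlonglongrightarrow> 0"
  proof (rule Lim_null_comparison[of _ "\<lambda>n. T / real (Suc n)"])
    show "\<forall>\<^sub>F n in sequentially. norm (h n) \<le> T / real (Suc n)"
    proof (intro always_eventually allI)
      fix n
      have "1 * Suc n \<le> M n" unfolding M_def using K by (intro mult_right_mono) auto
      then have "Suc n \<le> M n" by simp
      then have "real (Suc n) \<le> real (M n)" by (simp only: of_nat_le_iff)
      then have "T / real (M n) \<le> T / real (Suc n)" using T_pos by (intro divide_left_mono) auto
      then show "norm (h n) \<le> T / real (Suc n)" using T_pos by (simp add: h_def mesh_def)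
    qed
    show "(\<lambda>n. T / real (Suc n)) \<longlonglongrightarrow> 0"
      using tendsto_mult_right_zero[OF LIMSEQ_inverse_real_of_nat, of T] by (simp add: divide_inverse)
  qed
  \<comment> \<open>The periodic extension to all integer indices, which removes the wrap-around
    from the recursion.\<close>
  define U where "U = (\<lambda>n j. x n (nat (j mod int (M n))))"
  define v where "v = (\<lambda>n j. (1 / h n) *\<^sub>R (U n (j + 1) - U n j))"
  have idx: "nat (j mod int (M n)) < M n" for n j
    using M[of n] by (metis nat_less_iff of_nat_0_less_iff pos_mod_bound pos_mod_sign)
  have Unorm: "norm (U n j) \<le> S" for n j
    unfolding U_def by (rule S[OF M x3 x2 idx])
  have Uper: "U n (j + int (M n)) = U n j" for n j by (simp add: U_def)
  have vper: "v n (j + int (M n)) = v n j" for n j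
    using Uper[of n "j + 1"] Uper[of n j] by (simp add: v_def algebra_simps)
  have Ustep: "U n (j + 1) = U n j + h n *\<^sub>R v n j" for n j using h[of n] by (simp add: v_def)
  \<comment> \<open>The difference equation as a first-order recursion. The force sits at j + 1
    because the second difference there compares the quotients \<open>v\<close> at j and j +
    1.\<close>
  have vstep: "v n (j + 1) = v n j + h n *\<^sub>R (- g (of_int (j + 1) * h n) (U n (j + 1)))" for n j
  proof -
    define i where "i = nat ((j + 1) mod int (M n))"
    have i: "i < M n" unfolding i_def by (rule idx)
    have ij: "int i = (j + 1) mod int (M n)" using M[of n] by (simp add: i_def)
    have "int (cyc_next (M n) i) = ((j + 1) mod int (M n) + 1) mod int (M n)"
      unfolding cyc_next_def zmod_int using ij by (simp add: add.commute)
    then have "int (cyc_next (M n) i) = (j + 1 + 1) mod int (M n)" by (simp only: mod_add_left_eq)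
    then have nx: "x n (cyc_next (M n) i) = U n (j + 1 + 1)" unfolding U_def by (metis nat_int)
    have "int (cyc_prev (M n) i) = ((j + 1) mod int (M n) + (int (M n) - 1)) mod int (M n)"
      unfolding cyc_prev_def zmod_int using ij M[of n] by (simp add: of_nat_diff algebra_simps)
    also have "\<dots> = (j + 1 + (int (M n) - 1)) mod int (M n)" by (rule mod_add_left_eq)
    also have "\<dots> = (j + int (M n)) mod int (M n)" by simp
    also have "\<dots> = j mod int (M n)" by simp
    finally have pv: "x n (cyc_prev (M n) i) = U n j" unfolding U_def by (metis nat_int)
    have xi: "x n i = U n (j + 1)" by (simp add: U_def i_def)
    have "of_int (j + 1) * h n = real i * h n + of_int ((j + 1) div int (M n)) * T"
    proof -
      have "j + 1 = int i + ((j + 1) div int (M n)) * int (M n)" unfolding ij by simp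
      then have "of_int (j + 1) = real i + of_int ((j + 1) div int (M n)) * real (M n)"
        by (metis of_int_add of_int_mult of_int_of_nat_eq)
      then show ?thesis using Mh[of n] by (simp add: algebra_simps)
    qed
    then have "g (of_int (j + 1) * h n) (U n (j + 1)) = g (i * h n) (x n i)"
      by (simp add: periodic_of_int xi)
    moreover have "(1 / h n) *\<^sub>R ((U n (j + 1) - U n j) - (U n (j + 1 + 1) - U n (j + 1))) = h n *\<^sub>R g (i * h n) (x n i)"
      using x3[of n i] i by (simp add: action_grad_def nx pv xi h_def)
    ultimately show ?thesis by (simp add: v_def scaleR_right_diff_distrib algebra_simps)
  qed
  have vdiff: "norm (v n (j + int l) - v n j) \<le> l * h n * \<Gamma>" for n j l
  proof (induction l)
    case (Suc l)
    have "v n (j + int (Suc l)) - v n j = (v n (j + int l) - v n j) + h n *\<^sub>R (- g (of_int (j + int l + 1) * h n) (U n (j + int l + 1)))"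
      using vstep[of n "j + int l"] by (simp add: algebra_simps)
    also have "norm \<dots> \<le> l * h n * \<Gamma> + h n * \<Gamma>"
      using Suc h[of n] \<Gamma>(2)[OF Unorm]
      by (intro order_trans[OF norm_triangle_ineq] add_mono) (auto intro!: mult_left_mono)
    finally show ?case by (simp add: algebra_simps)
  qed simp
  \<comment> \<open>The difference quotients sum to zero over a period, so each equals its mean
    deviation from the others, and deviations are bounded by integrating the force.\<close>
  have vnorm: "norm (v n j) \<le> T * \<Gamma>" for n j
  proof -
    have "U n (j + int m) - U n j = h n *\<^sub>R (\<Sum>l<m. v n (j + int l))" for m
      using Ustep[of n "j + int _"]
      by (induction m) (simp_all add: algebra_simps)
    from this[of "M n"] have "(\<Sum>l<M n. v n (j + int l)) = 0" using Uper h[of n] by simp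
    then have "real (M n) *\<^sub>R v n j = (\<Sum>l<M n. - (v n (j + int l) - v n j))"
      by (simp add: sum_subtractf sum_constant_scaleR)
    also have "norm \<dots> \<le> (\<Sum>l<M n. T * \<Gamma>)"
    proof (rule sum_norm_le)
      fix l assume "l \<in> {..<M n}"
      then have "real l * h n * \<Gamma> \<le> real (M n) * h n * \<Gamma>" using h[of n] \<Gamma>(1) by (intro mult_right_mono) auto
      then show "norm (- (v n (j + int l) - v n j)) \<le> T * \<Gamma>" using vdiff[of n j l] Mh[of n] by (simp add: norm_minus_commute)
    qed
    finally have "real (M n) * norm (v n j) \<le> real (M n) * (T * \<Gamma>)" by simp
    then show ?thesis using M[of n] by simp
  qed
  \<comment> \<open>Position and velocity are paired so that one subsequence serves both.\<close>
  define W where "W = (\<lambda>n j. (U n j, v n j))"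
  obtain k f where k: "strict_mono k" and fper: "\<And>t. f (t + T) = f t" and fcont: "continuous_on UNIV f"
    and funif: "\<And>e. e > 0 \<Longrightarrow> \<exists>n0. \<forall>n\<ge>n0. \<forall>j. norm (W (k n) j - f (of_int j * h (k n))) < e"
    and fconv: "\<And>j t. (\<lambda>n. of_int (j n) * h (k n)) \<longlonglongrightarrow> t \<Longrightarrow> (\<lambda>n. W (k n) (j n)) \<longlonglongrightarrow> f t"
  proof (rule discrete_compactness[of T h "\<lambda>n. int (M n)" W "T * \<Gamma> + \<Gamma>" "S + T * \<Gamma>"])
    show "norm (W n (j + 1) - W n j) \<le> (T * \<Gamma> + \<Gamma>) * h n" for n j
    proof -
      have "norm (W n (j + 1) - W n j) \<le> norm (U n (j + 1) - U n j) + norm (v n (j + 1) - v n j)"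
        by (simp add: W_def norm_Pair_le)
      also have "\<dots> \<le> h n * (T * \<Gamma>) + 1 * h n * \<Gamma>"
        using h[of n] vnorm vdiff[of n j 1] by (intro add_mono) (auto simp: Ustep intro!: mult_left_mono)
      finally show ?thesis by (simp add: algebra_simps)
    qed
    show "norm (W n j) \<le> S + T * \<Gamma>" for n j
      unfolding W_def by (intro order_trans[OF norm_Pair_le] add_mono Unorm vnorm)
    show "0 < T * \<Gamma> + \<Gamma>" using T_pos \<Gamma>(1) by (simp add: add_pos_pos)
  qed (use T_pos h Mh Uper vper in \<open>auto simp: W_def\<close>)
  define w where "w = (\<lambda>t. fst (f t))"
  define w' where "w' = (\<lambda>t. snd (f t))"
  have Wfst: "norm (U n j - w t) \<le> norm (W n j - f t)" and Wsnd: "norm (v n j - w' t) \<le> norm (W n j - f t)" for n j t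
    using norm_fst_le[of "U n j - fst (f t)" "v n j - snd (f t)"] norm_snd_le[of "v n j - snd (f t)" "U n j - fst (f t)"]
    by (simp_all add: W_def w_def w'_def prod_eq_iff minus_prod_def)
  have hk: "(\<lambda>n. h (k n)) \<longlonglongrightarrow> 0" using LIMSEQ_subseq_LIMSEQ[OF h0 k] by (simp add: o_def)
  have near: "\<exists>d>0. \<exists>n0. \<forall>n\<ge>n0. \<forall>j. \<bar>of_int j * h (k n) - t0\<bar> \<le> d \<longrightarrow> norm (W (k n) j - f t0) \<le> e"
    if e: "e > 0" for t0 e
  proof -
    obtain d where d: "d > 0" "\<And>t. dist t t0 < d \<Longrightarrow> dist (f t) (f t0) < e / 2"
      using fcont e unfolding continuous_on_iff by (metis UNIV_I half_gt_zero)
    obtain n0 where n0: "\<And>n j. n \<ge> n0 \<Longrightarrow> norm (W (k n) j - f (of_int j * h (k n))) < e / 2"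
      using funif[of "e / 2"] e by auto
    have "norm (W (k n) j - f t0) \<le> e" if "n \<ge> n0" "\<bar>of_int j * h (k n) - t0\<bar> \<le> d / 2" for n j
    proof -
      have "dist (f (of_int j * h (k n))) (f t0) < e / 2"
        using that d(1) by (intro d(2)) (simp add: dist_real_def)
      then have "norm (f (of_int j * h (k n)) - f t0) < e / 2" by (simp add: dist_norm)
      with n0[OF that(1), of j] norm_diff_triangle_less
      show ?thesis by (metis field_sum_of_halves less_imp_le)
    qed
    then show ?thesis using d(1) by (intro exI[of _ "d / 2"]) auto
  qed
  have dw: "(w has_vector_derivative w' t0) (at t0)" for t0
  proof (rule discrete_derivative_limit[of "\<lambda>n. h (k n)" "\<lambda>n. U (k n)" "\<lambda>n. v (k n)"])
    show "(\<lambda>n. U (k n) (j n)) \<longlonglongrightarrow> w t" if "(\<lambda>n. of_int (j n) * h (k n)) \<longlonglongrightarrow> t" for j t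
      using tendsto_fst[OF fconv[OF that]] by (simp add: W_def w_def)
    show "\<exists>d>0. \<exists>n0. \<forall>n\<ge>n0. \<forall>j. \<bar>of_int j * h (k n) - t0\<bar> \<le> d \<longrightarrow> norm (v (k n) j - w' t0) \<le> e" if "e > 0" for e
      using near[OF that, of t0] Wsnd by (meson order_trans)
  qed (use h hk Ustep in auto)
  have dw': "(w' has_vector_derivative - g t0 (w t0)) (at t0)" for t0
  proof (rule discrete_derivative_limit[of "\<lambda>n. h (k n)" "\<lambda>n. v (k n)" "\<lambda>n j. - g (of_int (j + 1) * h (k n)) (U (k n) (j + 1))"])
    show "(\<lambda>n. v (k n) (j n)) \<longlonglongrightarrow> w' t" if "(\<lambda>n. of_int (j n) * h (k n)) \<longlonglongrightarrow> t" for j t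
      using tendsto_snd[OF fconv[OF that]] by (simp add: W_def w'_def)
    fix e :: real assume "e > 0"
    then obtain \<delta> where \<delta>: "\<delta> > 0" "\<And>s y. dist (s, y) (t0, w t0) < \<delta> \<Longrightarrow> dist (g s y) (g t0 (w t0)) < e"
      using g_cont unfolding continuous_on_iff by (metis UNIV_I case_prod_conv)
    obtain d n0 where d: "d > 0" and n0: "\<And>n j. n \<ge> n0 \<Longrightarrow> \<bar>of_int j * h (k n) - t0\<bar> \<le> d \<Longrightarrow> norm (W (k n) j - f t0) \<le> \<delta> / 3"
      using near[of "\<delta> / 3" t0] \<delta>(1) by auto
    \<comment> \<open>The force is evaluated one mesh further on; halving leaves room for this
      shift, as 2 d' is at most \<open>d\<close> and at most a third of the tolerance.\<close>
    define d' where "d' = min d (\<delta> / 3) / 2"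
    have d': "d' > 0" using d \<delta>(1) by (simp add: d'_def)
    then obtain n1 where n1: "\<And>n. n \<ge> n1 \<Longrightarrow> h (k n) < d'"
      using order_tendstoD(2)[OF hk, of d'] by (auto simp: eventually_sequentially)
    have "norm (- g (of_int (j + 1) * h (k n)) (U (k n) (j + 1)) - - g t0 (w t0)) \<le> e"
      if "n \<ge> max n0 n1" "\<bar>of_int j * h (k n) - t0\<bar> \<le> d'" for n j
    proof -
      have *: "\<bar>of_int (j + 1) * h (k n) - t0\<bar> \<le> 2 * d'"
        using that n1[of n] h[of "k n"] by (simp add: algebra_simps abs_le_iff)
      then have "norm (W (k n) (j + 1) - f t0) \<le> \<delta> / 3"
        using that by (intro n0) (auto simp: d'_def)
      then have "norm (U (k n) (j + 1) - w t0) \<le> \<delta> / 3" using Wfst order_trans by blast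
      moreover have "dist (of_int (j + 1) * h (k n), U (k n) (j + 1)) (t0, w t0)
          \<le> \<bar>of_int (j + 1) * h (k n) - t0\<bar> + norm (U (k n) (j + 1) - w t0)"
        using norm_Pair_le[of "of_int (j + 1) * h (k n) - t0" "U (k n) (j + 1) - w t0"] by (simp add: dist_norm)
      ultimately have "dist (of_int (j + 1) * h (k n), U (k n) (j + 1)) (t0, w t0) < \<delta>"
        using * \<delta>(1) unfolding d'_def by linarith
      from \<delta>(2)[OF this] show ?thesis by (simp add: dist_norm norm_minus_commute)
    qed
    then show "\<exists>d>0. \<exists>n0. \<forall>n\<ge>n0. \<forall>j. \<bar>of_int j * h (k n) - t0\<bar> \<le> d \<longrightarrow>
        norm (- g (of_int (j + 1) * h (k n)) (U (k n) (j + 1)) - - g t0 (w t0)) \<le> e"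
      using d' by blast
  qed (use h hk vstep in auto)
  have "gradient (V t) y = g t y" for t y
    by (rule gradient_eqI) (use V_deriv[of t y] in \<open>simp add: gderiv_def inner_commute\<close>)
  moreover have "w (t + T) = w t" "w' (t + T) = w' t" for t using fper by (simp_all add: w_def w'_def)
  moreover have "w 0 = w T" "w' 0 = w' T" using fper[of 0] by (simp_all add: w_def w'_def)
  ultimately have sol: "periodic_solution T V w"
    unfolding periodic_solution_def using dw dw'
    by - (rule conjI, simp, rule exI[of _ w'], rule exI[of _ "\<lambda>t. - g t (w t)"], simp)
  have "\<exists>t. norm (w t) > R"
  proof (rule ccontr)
    assume "\<not> ?thesis"
    then have wR: "norm (w t) \<le> R" for t by (simp add: not_less)
    obtain n0 where n0: "\<And>n j. n \<ge> n0 \<Longrightarrow> norm (W (k n) j - f (of_int j * h (k n))) < 1"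
      using funif[of 1] by auto
    have "norm (x (k n0) i) \<le> R + 1" if "i < M (k n0)" for i
    proof -
      have xU: "x (k n0) i = U (k n0) (int i)" using that by (simp add: U_def flip: zmod_int)
      have "norm (U (k n0) (int i) - w (of_int (int i) * h (k n0))) \<le> 1"
        using Wfst n0[of n0 "int i"] by (meson less_imp_le order_refl order_trans)
      then show ?thesis
        unfolding xU using wR[of "of_int (int i) * h (k n0)"] norm_triangle_sub[of "U (k n0) (int i)" "w (of_int (int i) * h (k n0))"] by linarith
    qed
    from B[OF M x3 this] x1[of "k n0"] show False by simp
  qed
  with sol show ?thesis by blast
qed

text \<open>Each periodic solution is bounded, so finitely many would share a bound, which a large
  solution exceeds.\<close>

lemma infinitely_many_solutions: "infinite {u. periodic_solution T V u \<and> u \<noteq> (\<lambda>t. 0)}"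
proof
  assume fin: "finite {u. periodic_solution T V u \<and> u \<noteq> (\<lambda>t. 0)}" (is "finite ?X")
  have "\<exists>B. \<forall>t. norm (u t) \<le> B" if "u \<in> ?X" for u
  proof -
    have per: "u (t + T) = u t" and diff: "\<exists>u'. \<forall>t. (u has_vector_derivative u' t) (at t)" for t
      using that by (auto simp: periodic_solution_def)
    have "continuous_on {0..T} u"
      using diff by (meson continuous_at_imp_continuous_on has_vector_derivative_continuous)
    then have "bounded (u ` {0..T})" by (intro compact_imp_bounded compact_continuous_image) auto
    then obtain B where "\<forall>y\<in>u ` {0..T}. norm y \<le> B" unfolding bounded_iff by blast
    then have B: "norm (u t) \<le> B" if "t \<in> {0..T}" for t using that by blast
    have "norm (u t) \<le> B" for t
    proof -
      interpret periodic_fun_simple u T by unfold_locales (rule per)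
      have "u t = u (t + of_int (- \<lfloor>t / T\<rfloor>) * T)" by (rule plus_of_int[symmetric])
      moreover have "t + of_int (- \<lfloor>t / T\<rfloor>) * T \<in> {0..T}" by (rule shift_into_period[OF T_pos])
      ultimately show ?thesis using B by metis
    qed
    then show ?thesis by blast
  qed
  then obtain B where B: "\<And>u t. u \<in> ?X \<Longrightarrow> norm (u t) \<le> B u" by metis
  obtain u t where u: "periodic_solution T V u" "norm (u t) > (\<Sum>u\<in>?X. \<bar>B u\<bar>)"
    using large_solution by blast
  have "(\<Sum>u\<in>?X. \<bar>B u\<bar>) \<ge> 0" by (intro sum_nonneg) auto
  then have "norm (u t) > 0" using u(2) by linarith
  then have "u t \<noteq> 0" by simp
  then have "u \<in> ?X" using u(1) by auto
  then have "\<bar>B u\<bar> \<le> (\<Sum>u\<in>?X. \<bar>B u\<bar>)" using fin by (intro member_le_sum) auto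
  then show False using B[OF \<open>u \<in> ?X\<close>, of t] u(2) by linarith
qed

end

subsection \<open>Infinitely many solutions\<close>

lemma has_derivative_quadratic_form:
  fixes A :: "real ^ 'n ^ 'n"
  assumes "transpose A = A"
  shows "((\<lambda>u. 1 / 2 * ((A *v u) \<bullet> u)) has_derivative (\<lambda>h. (A *v x) \<bullet> h)) (at x)"
proof -
  have "((\<lambda>u. (A *v u) \<bullet> u) has_derivative (\<lambda>h. (A *v x) \<bullet> h + (A *v h) \<bullet> x)) (at x)"
    by (intro has_derivative_inner bounded_linear.has_derivative[OF matrix_vector_mul_bounded_linear] has_derivative_ident)
  moreover have "(A *v h) \<bullet> x = (A *v x) \<bullet> h" for h
    by (metis assms dot_lmul_matrix inner_commute vector_transpose_matrix)
  ultimately have "((\<lambda>u. (A *v u) \<bullet> u) has_derivative (\<lambda>h. 2 * ((A *v x) \<bullet> h))) (at x)" by simp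
  from has_derivative_mult_right[OF this, of "1 / 2"] show ?thesis by simp
qed

text \<open>The gradient in the second variable is read off from the total derivative in the
  directions (0, b), and so inherits joint continuity.\<close>

lemma C1_gradient:
  fixes V :: "real \<Rightarrow> 'a::euclidean_space \<Rightarrow> real"
  assumes "C1 (\<lambda>(t, u). V t u)"
  obtains g where "continuous_on UNIV (\<lambda>(t, u). V t u)" "continuous_on UNIV (\<lambda>(t, u). g t u)"
    "\<And>t x. (V t has_derivative (\<lambda>y. g t x \<bullet> y)) (at x)"
proof -
  obtain f' where f': "\<And>p. ((\<lambda>(t, u). V t u) has_derivative blinfun_apply (f' p)) (at p)" and c: "continuous_on UNIV f'"
    using assms by (auto simp: C1_def)
  define g where "g = (\<lambda>t x. \<Sum>b\<in>Basis. blinfun_apply (f' (t, x)) (0, b) *\<^sub>R (b :: 'a))"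
  show ?thesis
  proof (rule that[of g])
    show "continuous_on UNIV (\<lambda>(t, u). V t u)"
      by (intro continuous_at_imp_continuous_on ballI has_derivative_continuous[OF f'])
    have "continuous_on UNIV (\<lambda>p. \<Sum>b\<in>Basis. blinfun_apply (f' p) (0, b) *\<^sub>R (b :: 'a))"
      by (intro continuous_on_sum continuous_on_scaleR continuous_on_const bounded_bilinear.continuous_on[OF bounded_bilinear_blinfun_apply c])
    then show "continuous_on UNIV (\<lambda>(t, u). g t u)" by (simp add: g_def case_prod_unfold)
    fix t :: real and x :: 'a
    have "((\<lambda>u. (t, u)) has_derivative (\<lambda>h. (0, h))) (at x)"
      by (intro has_derivative_Pair has_derivative_const has_derivative_ident)
    from has_derivative_compose[OF this f'[of "(t, x)"]]
    have "(V t has_derivative (\<lambda>h. blinfun_apply (f' (t, x)) (0, h))) (at x)" by simp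
    moreover have "blinfun_apply (f' (t, x)) (0, h) = g t x \<bullet> h" for h
    proof -
      have eq: "(0, h) = (\<Sum>b\<in>Basis. (h \<bullet> b) *\<^sub>R (0 :: real, b))"
        by (simp add: prod_eq_iff fst_sum snd_sum euclidean_representation)
      have "blinfun_apply (f' (t, x)) (0, h) = (\<Sum>b\<in>Basis. (h \<bullet> b) * blinfun_apply (f' (t, x)) (0, b))"
        unfolding eq by (simp only: blinfun.sum_right blinfun.scaleR_right real_scaleR_def)
      also have "\<dots> = g t x \<bullet> h"
        by (simp add: g_def inner_sum_left mult.commute inner_commute[of h])
      finally show ?thesis .
    qed
    ultimately show "(V t has_derivative (\<lambda>y. g t x \<bullet> y)) (at x)" by simp
  qed
qed

lemma norm_matrix_vector_mult_le:
  fixes A :: "real ^ 'n ^ 'm"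
  shows "norm (A *v x) \<le> real CARD('m) * norm A * norm x"
proof -
  have "norm (A *v x) \<le> (\<Sum>i\<in>UNIV. \<bar>(A *v x) $ i\<bar>)" by (rule norm_le_l1_cart)
  also have "\<dots> \<le> (\<Sum>i\<in>(UNIV :: 'm set). norm A * norm x)"
  proof (rule sum_mono)
    fix i
    have "\<bar>(A *v x) $ i\<bar> = \<bar>A $ i \<bullet> x\<bar>" by (simp add: matrix_vector_mul_component)
    also have "\<dots> \<le> norm (A $ i) * norm x" by (rule Cauchy_Schwarz_ineq2)
    also have "\<dots> \<le> norm A * norm x" by (intro mult_right_mono Finite_Cartesian_Product.norm_nth_le) auto
    finally show "\<bar>(A *v x) $ i\<bar> \<le> norm A * norm x" .
  qed
  finally show ?thesis by simp
qed

lemma powr_le_one_add_powr: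
  assumes "0 \<le> p" "p \<le> q" "0 \<le> y"
  shows "y powr p \<le> 1 + y powr (q :: real)"
proof (cases "y \<le> 1")
  case True
  then have "y powr p \<le> 1 powr p" using assms by (intro powr_mono2) auto
  then show ?thesis by (simp add: add_increasing2)
next
  case False
  then have "y powr p \<le> y powr q" using assms by (intro powr_mono) auto
  then show ?thesis by simp
qed

theorem theorem1p2:
  fixes T :: real
    and V W :: "real \<Rightarrow> real ^ 'n \<Rightarrow> real"
    and U :: "real \<Rightarrow> real ^ 'n ^ 'n"
    and a\<^sub>1 \<nu> \<rho> b :: real
  assumes "T > 0"
    and V_C1: "C1 (\<lambda>(t, u). V t u)"
    and V_periodic: "\<And>t u. V (t + T) u = V t u"
    and V_form: "\<And>t u. V t u = 1 / 2 * ((U t *v u) \<bullet> u) + W t u"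
    and U_cont: "continuous_on UNIV U"
    and U_periodic: "\<And>t. U (t + T) = U t"
    and U_sym: "\<And>t. transpose (U t) = U t"
    and SQ1: "a\<^sub>1 > 0" "\<nu> > 2"
      "\<And>t u. t \<in> {0..T} \<Longrightarrow> norm (gradient (W t) u) \<le> a\<^sub>1 * (1 + norm u powr (\<nu> - 1))"
    and SQ2: "\<And>t u. t \<in> {0..T} \<Longrightarrow> W t u \<ge> 0"
      "filterlim (\<lambda>(t, u). W t u / (norm u)\<^sup>2) at_top (at_infinity_unif T)"
    and SQ3: "\<rho> \<ge> 1" "\<rho> > \<nu> - 2" "b > 0"
      "Liminf (at_infinity_unif T)
         (\<lambda>(t, u). ereal ((gradient (W t) u \<bullet> u - 2 * W t u) / norm u powr \<rho>)) \<ge> ereal b"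
    and W_even: "\<And>t u. t \<in> {0..T} \<Longrightarrow> W t (- u) = W t u"
  shows "infinite {u. periodic_solution T V u \<and> u \<noteq> (\<lambda>t. 0)}"
proof -
  obtain g where V_cont: "continuous_on UNIV (\<lambda>(t, u). V t u)" and g_cont: "continuous_on UNIV (\<lambda>(t, u). g t u)"
    and V_deriv: "\<And>t x. (V t has_derivative (\<lambda>y. g t x \<bullet> y)) (at x)"
    using C1_gradient[OF V_C1] by metis
  have gradV: "gradient (V t) x = g t x" for t x
    by (rule gradient_eqI) (use V_deriv[of t x] in \<open>simp add: gderiv_def inner_commute\<close>)
  have VT: "V (t + T) = V t" for t using V_periodic by auto
  have gT: "g (t + T) x = g t x" for t x unfolding gradV[symmetric] VT ..
  \<comment> \<open>The growth, sign and evenness conditions concern only t in [0, T]; this carries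
    their consequences for \<open>V\<close> and \<open>g\<close> to all times.\<close>
  have red: "\<exists>s\<in>{0..T}. V t = V s \<and> g t = g s" for t
  proof (intro bexI conjI)
    interpret periodic_fun_simple V T by unfold_locales (rule VT)
    show VV: "V t = V (t + of_int (- \<lfloor>t / T\<rfloor>) * T)" by (rule plus_of_int[symmetric])
    show "g t = g (t + of_int (- \<lfloor>t / T\<rfloor>) * T)" by (rule ext) (metis VV gradV)
    show "t + of_int (- \<lfloor>t / T\<rfloor>) * T \<in> {0..T}" by (rule shift_into_period[OF \<open>T > 0\<close>])
  qed
  have gradW: "gradient (W t) x = g t x - U t *v x" for t x
  proof (rule gradient_eqI)
    have "W t = (\<lambda>u. V t u - 1 / 2 * ((U t *v u) \<bullet> u))" using V_form by (auto simp: fun_eq_iff)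
    then have "(W t has_derivative (\<lambda>h. g t x \<bullet> h - (U t *v x) \<bullet> h)) (at x)"
      using has_derivative_diff[OF V_deriv has_derivative_quadratic_form[OF U_sym]] by simp
    then show "GDERIV (W t) x :> g t x - U t *v x"
      by (simp add: gderiv_def inner_diff_right inner_diff_left inner_commute)
  qed
  have gap_eq: "gradient (W t) x \<bullet> x - 2 * W t x = g t x \<bullet> x - 2 * V t x" for t x
    by (simp add: gradW V_form inner_diff_left)
  obtain B\<^sub>U where B\<^sub>U: "B\<^sub>U \<ge> 0" "\<And>t x. t \<in> {0..T} \<Longrightarrow> norm (U t *v x) \<le> B\<^sub>U * norm x"
  proof -
    have "bounded (U ` {0..T})"
      by (intro compact_imp_bounded compact_continuous_image continuous_on_subset[OF U_cont]) auto
    then obtain B where B: "B > 0" "\<And>t. t \<in> {0..T} \<Longrightarrow> norm (U t) \<le> B"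
      unfolding bounded_pos by (auto simp: image_iff)
    have "norm (U t *v x) \<le> (real CARD('n) * B) * norm x" if "t \<in> {0..T}" for t x
      using B(2)[OF that]
      by (intro order_trans[OF norm_matrix_vector_mult_le] mult_right_mono mult_left_mono) auto
    with B(1) show ?thesis by (intro that[of "real CARD('n) * B"]) auto
  qed
  have quad_le: "\<bar>(U t *v x) \<bullet> x\<bar> \<le> B\<^sub>U * (norm x)\<^sup>2" if "t \<in> {0..T}" for t x
  proof -
    have "\<bar>(U t *v x) \<bullet> x\<bar> \<le> norm (U t *v x) * norm x" by (rule Cauchy_Schwarz_ineq2)
    also have "\<dots> \<le> (B\<^sub>U * norm x) * norm x" using B\<^sub>U(2)[OF that] by (intro mult_right_mono) auto
    finally show ?thesis by (simp add: power2_eq_square mult.assoc)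
  qed
  have V_even: "V t (- x) = V t x" for t x
  proof -
    obtain s where s: "s \<in> {0..T}" "V t = V s" using red by blast
    have "U s *v (- x) = - (U s *v x)" using matrix_vector_mult_diff_distrib[of "U s" 0 x] by simp
    then show ?thesis using W_even[OF s(1), of x] by (simp add: s(2) V_form)
  qed
  have g_odd: "g t (- x) = - g t x" for t x
  proof -
    have "((\<lambda>y. V t (- y)) has_derivative (\<lambda>h. g t (- x) \<bullet> (- h))) (at x)"
      by (rule has_derivative_compose[OF has_derivative_minus[OF has_derivative_ident] V_deriv])
    then have "GDERIV (V t) x :> - g t (- x)" by (simp add: V_even gderiv_def inner_commute)
    then have "gradient (V t) x = - g t (- x)" by (rule gradient_eqI)
    then show ?thesis by (simp add: gradV)
  qed
  have superquadratic: "\<exists>C. \<forall>t x. V t x \<ge> K * (norm x)\<^sup>2 - C" for K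
  proof -
    \<comment> \<open>The additional \<open>B\<^sub>U\<close> pays for the quadratic form in
      \<open>V\<close>.\<close>
    obtain R where R: "\<And>x t. R \<le> norm x \<Longrightarrow> t \<in> {0..T} \<Longrightarrow> K + B\<^sub>U \<le> W t x / (norm x)\<^sup>2"
      using SQ2(2) unfolding filterlim_at_infinity_unif by metis
    obtain B where B: "B > 0" "\<And>t x. t \<in> {0..T} \<Longrightarrow> norm x \<le> max R 1 \<Longrightarrow> norm (V t x) \<le> B"
      using bounded_on_cylinder[OF V_cont] by metis
    have "V t x \<ge> K * (norm x)\<^sup>2 - (B + \<bar>K\<bar> * (max R 1)\<^sup>2)" for t x
    proof -
      obtain s where s: "s \<in> {0..T}" "V t = V s" using red by blast
      have "V s x \<ge> K * (norm x)\<^sup>2 - (B + \<bar>K\<bar> * (max R 1)\<^sup>2)"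
      proof (cases "norm x \<le> max R 1")
        case True
        have "K * (norm x)\<^sup>2 \<le> \<bar>K\<bar> * (max R 1)\<^sup>2"
          using True by (intro mult_mono power_mono) auto
        with B(2)[OF s(1) True] show ?thesis by simp
      next
        case False
        then have "K + B\<^sub>U \<le> W s x / (norm x)\<^sup>2" using s(1) by (intro R) auto
        moreover have "(norm x)\<^sup>2 > 0" using False by auto
        ultimately have "(K + B\<^sub>U) * (norm x)\<^sup>2 \<le> W s x" by (simp add: pos_le_divide_eq)
        moreover have "B\<^sub>U * (norm x)\<^sup>2 \<ge> 0" using B\<^sub>U(1) by simp
        moreover have "B + \<bar>K\<bar> * (max R 1)\<^sup>2 \<ge> 0" using B(1) by simp
        ultimately show ?thesis
          using quad_le[OF s(1), of x] V_form[of s x] unfolding distrib_right by linarith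
      qed
      then show ?thesis by (simp add: s(2))
    qed
    then show ?thesis by blast
  qed
  \<comment> \<open>(SQ3) allows \<rho> to exceed \<nu>. The larger exponent still bounds the growth
    and remains below \<rho> + 2.\<close>
  define q where "q = max \<nu> \<rho>"
  obtain C\<^sub>0 where gap: "\<And>t x. g t x \<bullet> x - 2 * V t x \<ge> b / 2 * norm x powr \<rho> - C\<^sub>0"
  proof -
    \<comment> \<open>A lower limit of at least b guarantees only constants strictly below b, such
      as b/2, outside some ball.\<close>
    obtain R where R: "\<And>x t. R \<le> norm x \<Longrightarrow> t \<in> {0..T} \<Longrightarrow> b / 2 < (g t x \<bullet> x - 2 * V t x) / norm x powr \<rho>"
      using SQ3(3,4) unfolding Liminf_at_infinity_unif gap_eq by (metis field_sum_of_halves less_add_same_cancel1 half_gt_zero)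
    define R' where "R' = max R 1"
    obtain B where B: "B > 0" "\<And>t x. t \<in> {0..T} \<Longrightarrow> norm x \<le> R' \<Longrightarrow> norm (g t x \<bullet> x - 2 * V t x) \<le> B"
    proof (rule bounded_on_cylinder[of "\<lambda>t x. g t x \<bullet> x - 2 * V t x" T R'])
      show "continuous_on UNIV (\<lambda>(t, x). g t x \<bullet> x - 2 * V t x)"
        using V_cont g_cont unfolding case_prod_unfold
        by (intro continuous_on_diff continuous_on_inner continuous_on_mult continuous_on_const continuous_on_snd continuous_on_id)
    qed blast
    have "g t x \<bullet> x - 2 * V t x \<ge> b / 2 * norm x powr \<rho> - (B + b / 2 * R' powr \<rho>)" for t x
    proof -
      obtain s where s: "s \<in> {0..T}" "V t = V s" "g t = g s" using red by blast
      have "g s x \<bullet> x - 2 * V s x \<ge> b / 2 * norm x powr \<rho> - (B + b / 2 * R' powr \<rho>)"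
      proof (cases "norm x \<le> R'")
        case True
        then have "b / 2 * norm x powr \<rho> \<le> b / 2 * R' powr \<rho>"
          using SQ3(1,3) by (intro mult_left_mono powr_mono2) auto
        with B(2)[OF s(1) True] show ?thesis unfolding real_norm_def by linarith
      next
        case False
        then have "b / 2 < (g s x \<bullet> x - 2 * V s x) / norm x powr \<rho>" using s(1) by (intro R) (auto simp: R'_def)
        moreover have "norm x powr \<rho> > 0" using False by (auto simp: R'_def)
        ultimately have "b / 2 * norm x powr \<rho> < g s x \<bullet> x - 2 * V s x" by (simp add: less_divide_eq)
        moreover have "b / 2 * R' powr \<rho> \<ge> 0" using SQ3(3) by simp
        ultimately show ?thesis using B(1) by linarith
      qed
      then show ?thesis by (simp add: s(2,3))
    qed
    then show ?thesis by (rule that)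
  qed
  have growth: "g t x \<bullet> x \<le> (2 * a\<^sub>1 + B\<^sub>U) * (1 + norm x powr q)" for t x
  proof -
    obtain s where s: "s \<in> {0..T}" "g t = g s" using red by blast
    have p: "norm x powr p \<le> 1 + norm x powr q" if "0 \<le> p" "p \<le> \<nu>" for p
      using that by (intro powr_le_one_add_powr) (auto simp: q_def)
    have "gradient (W s) x \<bullet> x \<le> norm (gradient (W s) x) * norm x" by (rule norm_cauchy_schwarz)
    also have "\<dots> \<le> a\<^sub>1 * (1 + norm x powr (\<nu> - 1)) * norm x" using SQ1(3)[OF s(1)] by (intro mult_right_mono) auto
    also have "\<dots> = a\<^sub>1 * (norm x powr 1 + norm x powr \<nu>)"
    proof -
      have "norm x powr (\<nu> - 1) * norm x = norm x powr \<nu>"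
        by (cases "x = 0") (simp_all add: powr_diff)
      then show ?thesis by (simp add: algebra_simps)
    qed
    also have "\<dots> \<le> a\<^sub>1 * ((1 + norm x powr q) + (1 + norm x powr q))"
      using SQ1(1,2) by (intro mult_left_mono add_mono p) auto
    finally have "gradient (W s) x \<bullet> x \<le> 2 * a\<^sub>1 * (1 + norm x powr q)" by (simp add: algebra_simps)
    moreover have "(U s *v x) \<bullet> x \<le> B\<^sub>U * (1 + norm x powr q)"
    proof -
      have "(U s *v x) \<bullet> x \<le> B\<^sub>U * (norm x)\<^sup>2" using quad_le[OF s(1), of x] by linarith
      also have "(norm x)\<^sup>2 = norm x powr 2" by simp
      also have "B\<^sub>U * norm x powr 2 \<le> B\<^sub>U * (1 + norm x powr q)"
        using B\<^sub>U(1) SQ1(2) by (intro mult_left_mono p) auto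
      finally show ?thesis .
    qed
    moreover have "g s x \<bullet> x = gradient (W s) x \<bullet> x + (U s *v x) \<bullet> x" by (simp add: gradW inner_diff_left)
    ultimately show ?thesis by (simp add: s(2) distrib_right)
  qed
  interpret superquadratic_potential T V g q \<rho> "b / 2" C\<^sub>0 "2 * a\<^sub>1 + B\<^sub>U"
    using \<open>T > 0\<close> V_cont g_cont V_deriv V_periodic gT g_odd superquadratic SQ3 SQ1(1) B\<^sub>U(1) gap growth
    by unfold_locales (auto simp: q_def)
  show ?thesis by (rule infinitely_many_solutions)
qed

end
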